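(* The GKM graph of a (integer or rational) GKM $T^k$-manifold is orientable.
   Context: GKM manifolds. Let $T=T^k$ act smoothly and effectively on a smooth compact connected orientable $2n$-dimensional manifold $M$ with $H^{odd}(M;\mathbb{Z})=0$. If the fixed point set $M^T$ is finite and the one-skeleton $M_1=\{p\in M\mid \dim Tp\le 1\}$ is a finite union of $T$-invariant $2$-spheres, then $M$ is an integer GKM $T$-manifold; if only $H^{odd}(M;\mathbb{Q})=0$ is required it is a rational GKM $T$-manifold. Its GKM graph $(\Gamma,\alpha)$ has vertices the fixed points, one edge between $p$ and $q$ for each invariant $2$-sphere containing $p$ and $q$, and label $\alpha(e)\in \mathrm{Hom}(T,S^1)/\pm 1\cong\mathbb{Z}^k/\pm1$ such that the $T$-action on the corresponding $2$-sphere is equivariantly diffeomorphic to the pullback along $\alpha(e)$ of the standard unit speed rotation of $S^2$. The graph is $n$-valent and labels of distinct edges at a vertex are linearly independent. Connections. Write $E(\Gamma)_v$ for the set of edges at $v$. A compatible connection $\nabla$ consists of bijections $\nabla_{e,v,w}\colon E(\Gamma)_v\to E(\Gamma)_w$ for every edge $e$ connecting $v$ and $w$ with $\nabla_{e,v,w}(e)=e$, $\nabla_{e,w,v}=\nabla_{e,v,w}^{-1}$, such that for all $f\in E(\Gamma)_v$ there is $c\in\mathbb{Z}$ with $\alpha(\nabla_{e,v,w}(f))=\pm\alpha(f)+c\,\alpha(e)$. It is known that the GKM graph of a GKM manifold admits a compatible connection. Orientability. Fix a compatible connection and a choice of signs for the labels, i.e. a lift $\alpha\colon E(\Gamma)\to\mathbb{Z}^k$.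 For an edge $e_1$ from $v$ to $w$ with $E(\Gamma)_v=\{e_1,\dots,e_n\}$ there are, for $i\ge2$, unique $\varepsilon_i\in\{\pm1\}$, $k_i\in\mathbb{Z}$ with $\alpha(\nabla_{e_1,v,w}(e_i))=\varepsilon_i\alpha(e_i)+k_i\alpha(e_1)$. Set $\eta(e_1)=-\varepsilon_2\cdots\varepsilon_n$. The GKM graph is orientable if there is a choice of signs for the labels such that $\prod_{i=1}^m\eta(f_i)=1$ for every closed edge path $f_1,\dots,f_m$. *)

theory Defs
  imports "HOL-Analysis.Analysis" "HOL-Homology.Homology" "HOL-Algebra.Group_Action"
begin

section \<open>Smooth manifolds\<close>

(* Meaningful for open S only: the derivatives are taken in the ambient space. *)
primrec Ck_on :: "nat \<Rightarrow> 'a::real_normed_vector set \<Rightarrow> ('a \<Rightarrow> 'b::real_normed_vector) \<Rightarrow> bool" where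
  "Ck_on 0 S f \<longleftrightarrow> continuous_on S f"
| "Ck_on (Suc k) S f \<longleftrightarrow>
     (\<forall>x\<in>S. f differentiable (at x)) \<and> (\<forall>v. Ck_on k S (\<lambda>x. frechet_derivative f (at x) v))"

definition smooth_on :: "'a::real_normed_vector set \<Rightarrow> ('a \<Rightarrow> 'b::real_normed_vector) \<Rightarrow> bool" where
  "smooth_on S f \<longleftrightarrow> (\<forall>k. Ck_on k S f)"

type_synonym ('a, 'e) chart = "'a set \<times> ('a \<Rightarrow> 'e)"

definition is_chart :: "'a topology \<Rightarrow> ('a, 'e::euclidean_space) chart \<Rightarrow> bool" where
  "is_chart X c \<longleftrightarrow> (case c of (U, x) \<Rightarrow>
     openin X U \<and> open (x ` U) \<and> homeomorphic_map (subtopology X U) (top_of_set (x ` U)) x)"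

definition transition :: "('a, 'e) chart \<Rightarrow> ('a, 'f) chart \<Rightarrow> 'e \<Rightarrow> 'f" where
  "transition c d = snd d \<circ> inv_into (fst c) (snd c)"

definition smooth_atlas :: "'a topology \<Rightarrow> ('a, 'e::euclidean_space) chart set \<Rightarrow> bool" where
  "smooth_atlas X A \<longleftrightarrow>
     (\<forall>c\<in>A. is_chart X c) \<and> (\<Union>c\<in>A. fst c) = topspace X \<and>
     (\<forall>c\<in>A. \<forall>d\<in>A. smooth_on (snd c ` (fst c \<inter> fst d)) (transition c d))"

definition smooth_manifold :: "'a topology \<Rightarrow> ('a, 'e::euclidean_space) chart set \<Rightarrow> bool" where
  "smooth_manifold X A \<longleftrightarrow> Hausdorff_space X \<and> second_countable X \<and> smooth_atlas X A"

definition orientable_manifold :: "'a topology \<Rightarrow> ('a, real^'m) chart set \<Rightarrow> bool" where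
  "orientable_manifold X A \<longleftrightarrow>
     (\<exists>B. smooth_atlas X B \<and> smooth_atlas X (A \<union> B) \<and>
       (\<forall>c\<in>B. \<forall>d\<in>B. \<forall>y \<in> snd c ` (fst c \<inter> fst d).
          det (matrix (frechet_derivative (transition c d) (at y))) > 0))"

definition local_map :: "('a, 'e) chart \<Rightarrow> ('b, 'f) chart \<Rightarrow> ('a \<Rightarrow> 'b) \<Rightarrow> 'e \<Rightarrow> 'f" where
  "local_map c d f = snd d \<circ> f \<circ> inv_into (fst c) (snd c)"

definition local_domain :: "('a, 'e) chart \<Rightarrow> ('b, 'f) chart \<Rightarrow> ('a \<Rightarrow> 'b) \<Rightarrow> 'e set" where
  "local_domain c d f = snd c ` {p \<in> fst c. f p \<in> fst d}"

definition smooth_map ::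
  "'a topology \<Rightarrow> ('a, 'e::euclidean_space) chart set \<Rightarrow>
   'b topology \<Rightarrow> ('b, 'f::euclidean_space) chart set \<Rightarrow> ('a \<Rightarrow> 'b) \<Rightarrow> bool" where
  "smooth_map X A Y B f \<longleftrightarrow>
     continuous_map X Y f \<and> (\<forall>c\<in>A. \<forall>d\<in>B. smooth_on (local_domain c d f) (local_map c d f))"

definition smooth_embedding ::
  "'a topology \<Rightarrow> ('a, 'e::euclidean_space) chart set \<Rightarrow>
   'b topology \<Rightarrow> ('b, 'f::euclidean_space) chart set \<Rightarrow> ('a \<Rightarrow> 'b) \<Rightarrow> bool" where
  "smooth_embedding X A Y B f \<longleftrightarrow>
     smooth_map X A Y B f \<and> embedding_map X Y f \<and>
     (\<forall>c\<in>A. \<forall>d\<in>B. \<forall>y \<in> local_domain c d f. inj (frechet_derivative (local_map c d f) (at y)))"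

definition embedded_submanifold ::
  "'a topology \<Rightarrow> ('a, 'e::euclidean_space) chart set \<Rightarrow> 'a set \<Rightarrow> nat \<Rightarrow> bool" where
  "embedded_submanifold X A S d \<longleftrightarrow> S \<subseteq> topspace X \<and>
     (\<forall>p\<in>S. \<exists>U x V. p \<in> U \<and> smooth_atlas X (insert (U, x) A) \<and>
        subspace V \<and> dim V = d \<and> x ` (S \<inter> U) = x ` U \<inter> V)"

definition product_atlas ::
  "('a, 'e) chart set \<Rightarrow> ('b, 'f) chart set \<Rightarrow> ('a \<times> 'b, 'e \<times> 'f) chart set" where
  "product_atlas A B = {(U \<times> V, map_prod x y) | U x V y. (U, x) \<in> A \<and> (V, y) \<in> B}"


section \<open>Singular cohomology with coefficients in an abelian group\<close>

definition cochain_group :: "nat \<Rightarrow> 'a topology \<Rightarrow> 'g monoid \<Rightarrow> ('a chain \<Rightarrow> 'g) monoid" where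
  "cochain_group p X G =
     \<lparr>carrier = hom (chain_group p X) G \<inter> extensional (carrier (chain_group p X)),
      mult = (\<lambda>f g. \<lambda>c\<in>carrier (chain_group p X). f c \<otimes>\<^bsub>G\<^esub> g c),
      one = (\<lambda>c\<in>carrier (chain_group p X). \<one>\<^bsub>G\<^esub>)\<rparr>"

definition coboundary :: "nat \<Rightarrow> 'a topology \<Rightarrow> ('a chain \<Rightarrow> 'g) \<Rightarrow> 'a chain \<Rightarrow> 'g" where
  "coboundary p X f = (\<lambda>c\<in>carrier (chain_group (Suc p) X). f (chain_boundary (Suc p) c))"

definition cocycles :: "nat \<Rightarrow> 'a topology \<Rightarrow> 'g monoid \<Rightarrow> ('a chain \<Rightarrow> 'g) set" where
  "cocycles p X G = kernel (cochain_group p X G) (cochain_group (Suc p) X G) (coboundary p X)"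

definition coboundaries :: "nat \<Rightarrow> 'a topology \<Rightarrow> 'g monoid \<Rightarrow> ('a chain \<Rightarrow> 'g) set" where
  "coboundaries p X G =
     (case p of 0 \<Rightarrow> {\<one>\<^bsub>cochain_group 0 X G\<^esub>}
      | Suc q \<Rightarrow> coboundary q X ` carrier (cochain_group q X G))"

definition cohomology_group :: "nat \<Rightarrow> 'a topology \<Rightarrow> 'g monoid \<Rightarrow> ('a chain \<Rightarrow> 'g) set monoid" where
  "cohomology_group p X G =
     (cochain_group p X G)\<lparr>carrier := cocycles p X G\<rparr> Mod coboundaries p X G"

definition rational_group :: "rat monoid" where
  "rational_group = \<lparr>carrier = UNIV, mult = (+), one = 0\<rparr>"


section \<open>The torus and the two-sphere\<close>

definition torus :: "(complex^'k) monoid" where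
  "torus = \<lparr>carrier = {t. \<forall>i. cmod (t $ i) = 1}, mult = (*), one = 1\<rparr>"

definition torus_space :: "(complex^'k) topology" where
  "torus_space = top_of_set (carrier torus)"

definition torus_exp :: "real^'k \<Rightarrow> complex^'k" where
  "torus_exp \<theta> = (\<chi> i. cis (\<theta> $ i))"

definition torus_atlas :: "(complex^'k, real^'k) chart set" where
  "torus_atlas = {(torus_exp ` U, inv_into U torus_exp) | U. open U \<and> inj_on torus_exp U}"

(* The isomorphism from Z^k to Hom(T,S^1). *)
definition character :: "int^'k \<Rightarrow> complex^'k \<Rightarrow> complex" where
  "character a t = (\<Prod>i\<in>UNIV. (t $ i) powi (a $ i))"

(* The norm on complex * real is the Euclidean one. *)
definition S2 :: "(complex \<times> real) set" where
  "S2 = sphere 0 1"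

(* Stereographic projections from the two poles. *)
definition S2_atlas :: "(complex \<times> real, complex) chart set" where
  "S2_atlas =
     {(S2 - {(0, 1)}, \<lambda>(z, h). z / of_real (1 - h)),
      (S2 - {(0, -1)}, \<lambda>(z, h). z / of_real (1 + h))}"

definition rotation :: "complex \<Rightarrow> complex \<times> real \<Rightarrow> complex \<times> real" where
  "rotation s = (\<lambda>(z, h). (s * z, h))"


section \<open>GKM manifolds\<close>

(* In faithful_action, act t is a bijection of topspace X with value undefined elsewhere. *)
definition smooth_effective_torus_action ::
  "'a topology \<Rightarrow> ('a, 'e::euclidean_space) chart set \<Rightarrow> (complex^'k \<Rightarrow> 'a \<Rightarrow> 'a) \<Rightarrow> bool" where
  "smooth_effective_torus_action X A act \<longleftrightarrow>
     faithful_action torus (topspace X) act \<and>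
     smooth_map (prod_topology torus_space X) (product_atlas torus_atlas A) X A (\<lambda>(t, p). act t p)"

definition fixed_points :: "'a topology \<Rightarrow> (complex^'k \<Rightarrow> 'a \<Rightarrow> 'a) \<Rightarrow> 'a set" where
  "fixed_points X act = {p \<in> topspace X. \<forall>t \<in> carrier torus. act t p = p}"

(* The orbits of a smooth torus action are embedded submanifolds, so each has a dimension. *)
definition one_skeleton ::
  "'a topology \<Rightarrow> ('a, 'e::euclidean_space) chart set \<Rightarrow> (complex^'k \<Rightarrow> 'a \<Rightarrow> 'a) \<Rightarrow> 'a set" where
  "one_skeleton X A act =
     {p \<in> topspace X. \<exists>d\<le>1. embedded_submanifold X A (orbit torus act p) d}"

definition invariant_2_sphere ::
  "'a topology \<Rightarrow> ('a, 'e::euclidean_space) chart set \<Rightarrow> (complex^'k \<Rightarrow> 'a \<Rightarrow> 'a) \<Rightarrow> 'a set \<Rightarrow> bool" where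
  "invariant_2_sphere X A act N \<longleftrightarrow>
     (\<exists>\<iota>. smooth_embedding (top_of_set S2) S2_atlas X A \<iota> \<and> N = \<iota> ` S2) \<and>
     (\<forall>t \<in> carrier torus. act t ` N \<subseteq> N)"

definition gkm_manifold ::
  "'g monoid \<Rightarrow> 'a topology \<Rightarrow> ('a, real^'m) chart set \<Rightarrow> (complex^'k \<Rightarrow> 'a \<Rightarrow> 'a) \<Rightarrow> bool" where
  "gkm_manifold G X A act \<longleftrightarrow>
     even CARD('m) \<and>
     smooth_manifold X A \<and> compact_space X \<and> connected_space X \<and> orientable_manifold X A \<and>
     smooth_effective_torus_action X A act \<and>
     (\<forall>p. odd p \<longrightarrow> trivial_group (cohomology_group p X G)) \<and>
     finite (fixed_points X act) \<and>
     (\<exists>F. finite F \<and> (\<forall>N\<in>F. invariant_2_sphere X A act N) \<and> one_skeleton X A act = \<Union>F)"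

abbreviation integer_gkm_manifold ::
  "'a topology \<Rightarrow> ('a, real^'m) chart set \<Rightarrow> (complex^'k \<Rightarrow> 'a \<Rightarrow> 'a) \<Rightarrow> bool" where
  "integer_gkm_manifold \<equiv> gkm_manifold integer_group"

abbreviation rational_gkm_manifold ::
  "'a topology \<Rightarrow> ('a, real^'m) chart set \<Rightarrow> (complex^'k \<Rightarrow> 'a \<Rightarrow> 'a) \<Rightarrow> bool" where
  "rational_gkm_manifold \<equiv> gkm_manifold rational_group"


section \<open>GKM graphs\<close>

(* Multiple edges are allowed; glabel e is an element {a, -a} of the quotient of Z^k by sign. *)
record ('v, 'e, 'k) labelled_graph =
  verts :: "'v set"
  edges :: "'e set"
  ends :: "'e \<Rightarrow> 'v set"
  glabel :: "'e \<Rightarrow> (int^'k) set"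

(* The embedding is an equivariant diffeomorphism from the pullback of the rotation onto N. *)
definition has_rotation_label ::
  "'a topology \<Rightarrow> ('a, 'e::euclidean_space) chart set \<Rightarrow> (complex^'k \<Rightarrow> 'a \<Rightarrow> 'a) \<Rightarrow>
   'a set \<Rightarrow> int^'k \<Rightarrow> bool" where
  "has_rotation_label X A act N a \<longleftrightarrow>
     (\<exists>\<iota>. smooth_embedding (top_of_set S2) S2_atlas X A \<iota> \<and> N = \<iota> ` S2 \<and>
        (\<forall>t \<in> carrier torus. \<forall>z \<in> S2. \<iota> (rotation (character a t) z) = act t (\<iota> z)))"

definition is_gkm_graph ::
  "'a topology \<Rightarrow> ('a, 'e::euclidean_space) chart set \<Rightarrow> (complex^'k \<Rightarrow> 'a \<Rightarrow> 'a) \<Rightarrow>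
   ('a, 'a set, 'k) labelled_graph \<Rightarrow> bool" where
  "is_gkm_graph X A act \<Gamma> \<longleftrightarrow>
     verts \<Gamma> = fixed_points X act \<and>
     edges \<Gamma> = {N. invariant_2_sphere X A act N} \<and>
     (\<forall>N \<in> edges \<Gamma>. ends \<Gamma> N = N \<inter> fixed_points X act \<and>
        (\<exists>a. glabel \<Gamma> N = {a, - a} \<and> has_rotation_label X A act N a))"

definition edges_at :: "('v, 'e, 'k::finite) labelled_graph \<Rightarrow> 'v \<Rightarrow> 'e set" where
  "edges_at \<Gamma> v = {e \<in> edges \<Gamma>. v \<in> ends \<Gamma> e}"

definition connects :: "('v, 'e, 'k::finite) labelled_graph \<Rightarrow> 'e \<Rightarrow> 'v \<Rightarrow> 'v \<Rightarrow> bool" where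
  "connects \<Gamma> e v w \<longleftrightarrow> e \<in> edges \<Gamma> \<and> ends \<Gamma> e = {v, w}"

(* The congruence does not depend on the representatives chosen for the three labels. *)
definition compatible_connection ::
  "('v, 'e, 'k::finite) labelled_graph \<Rightarrow> ('e \<Rightarrow> 'v \<Rightarrow> 'v \<Rightarrow> 'e \<Rightarrow> 'e) \<Rightarrow> bool" where
  "compatible_connection \<Gamma> conn \<longleftrightarrow>
     (\<forall>e v w. connects \<Gamma> e v w \<longrightarrow>
        bij_betw (conn e v w) (edges_at \<Gamma> v) (edges_at \<Gamma> w) \<and>
        conn e v w e = e \<and>
        (\<forall>f \<in> edges_at \<Gamma> v. conn e w v (conn e v w f) = f) \<and>
        (\<forall>f \<in> edges_at \<Gamma> v.
           \<forall>a \<in> glabel \<Gamma> e. \<forall>b \<in> glabel \<Gamma> f. \<forall>b' \<in> glabel \<Gamma> (conn e v w f).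
             \<exists>c. b' = b + c *s a \<or> b' = - b + c *s a))"

definition sign_choice :: "('v, 'e, 'k::finite) labelled_graph \<Rightarrow> ('e \<Rightarrow> int^'k) \<Rightarrow> bool" where
  "sign_choice \<Gamma> \<alpha> \<longleftrightarrow> (\<forall>e \<in> edges \<Gamma>. \<alpha> e \<in> glabel \<Gamma> e)"

definition transport_sign ::
  "('e \<Rightarrow> 'v \<Rightarrow> 'v \<Rightarrow> 'e \<Rightarrow> 'e) \<Rightarrow> ('e \<Rightarrow> int^'k) \<Rightarrow> 'e \<Rightarrow> 'v \<Rightarrow> 'v \<Rightarrow> 'e \<Rightarrow> int" where
  "transport_sign conn \<alpha> e v w f =
     (THE s. s \<in> {1, - 1} \<and> (\<exists>c. \<alpha> (conn e v w f) = s *s \<alpha> f + c *s \<alpha> e))"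

definition edge_sign ::
  "('v, 'e, 'k::finite) labelled_graph \<Rightarrow> ('e \<Rightarrow> 'v \<Rightarrow> 'v \<Rightarrow> 'e \<Rightarrow> 'e) \<Rightarrow> ('e \<Rightarrow> int^'k) \<Rightarrow>
   'e \<Rightarrow> 'v \<Rightarrow> 'v \<Rightarrow> int" where
  "edge_sign \<Gamma> conn \<alpha> e v w = - (\<Prod>f \<in> edges_at \<Gamma> v - {e}. transport_sign conn \<alpha> e v w f)"

(* The edge fs ! i is traversed from vs ! i to vs ! Suc i. *)
definition closed_edge_path ::
  "('v, 'e, 'k::finite) labelled_graph \<Rightarrow> 'v list \<Rightarrow> 'e list \<Rightarrow> bool" where
  "closed_edge_path \<Gamma> vs fs \<longleftrightarrow>
     length vs = Suc (length fs) \<and> set vs \<subseteq> verts \<Gamma> \<and>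
     (\<forall>i < length fs. connects \<Gamma> (fs ! i) (vs ! i) (vs ! Suc i)) \<and> hd vs = last vs"

definition orientable_gkm_graph ::
  "('v, 'e, 'k::finite) labelled_graph \<Rightarrow> ('e \<Rightarrow> 'v \<Rightarrow> 'v \<Rightarrow> 'e \<Rightarrow> 'e) \<Rightarrow> bool" where
  "orientable_gkm_graph \<Gamma> conn \<longleftrightarrow>
     (\<exists>\<alpha>. sign_choice \<Gamma> \<alpha> \<and>
        (\<forall>vs fs. closed_edge_path \<Gamma> vs fs \<longrightarrow>
           (\<Prod>i<length fs. edge_sign \<Gamma> conn \<alpha> (fs ! i) (vs ! i) (vs ! Suc i)) = 1))"

end

(* At a fixed point v the isotropy representation splits T_v M into the tangent planes of the
   invariant spheres through v, and the signs chosen for the labels turn each plane into a complex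
   line. Comparing the resulting orientation of T_v M with the one of M gives a sign o(v), and the
   theorem follows from eta(e) = o(v) o(w) for an edge e from v to w.

   To see this, choose a torsion element g of the torus that fixes the sphere e pointwise and acts
   without eigenvalues 1 or -1 on the other planes at v and w. The maps dg on the tangent spaces
   along the sphere form a continuous family of isomorphic representations of a finite cyclic
   group. Parallel transport from v to w can therefore be made to commute with dg and to respect
   the tangent planes of e. Outside the plane of e it is complex linear for the complex structure
   in which the eigenvalues of g have positive imaginary part; this structure differs from the one
   given by the labels by signs which change by the epsilon_i from v to w. On the plane of e the
   labels induce opposite orientations at the two poles, whence the additional sign.

   The GKM condition enters in the splitting of T_v M: after linearization of the action near v,
   a weight vector gives points whose orbits have dimension at most one. These points lie on one of
   finitely many invariant spheres, so the weight vector is tangent to one of them. *)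

theory Submission
  imports Defs
begin

section \<open>Calculus of smooth functions\<close>

text \<open>The edges of the graph are all invariant spheres, whereas the GKM condition speaks of
  some finite family covering the one-skeleton. Finiteness of the set of edges at a fixed point,
  independence of the labels and the valence are therefore derived. The crucial point is that an
  invariant sphere is determined by a fixed point on it and the rational line of its label: two
  spheres with the same data agree on a set that is open and closed in both. The argument avoids
  metrics, exponential maps and bundles. Linearization becomes an averaged chart map that is a
  Lipschitz perturbation of the identity; it yields points with the right stabilizer in
  approximately the right direction, so that tangency is a statement about limits. Fourier
  coefficients of the isotropy representation stand in for its weight spaces. Parallel transport
  becomes an equivalence relation between tangent spaces whose classes along a sphere are open,
  because the identity can be averaged over the cyclic group of \<open>g\<close>.\<close>

lemma Ck_on_cong_imp:
  assumes "open S" "\<And>x. x \<in> S \<Longrightarrow> f x = g x" "Ck_on k S f"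
  shows "Ck_on k S g"
  using assms(2,3)
proof (induction k arbitrary: f g)
  case 0
  then show ?case by (auto intro: continuous_on_eq)
next
  case (Suc k)
  have D: "(g has_derivative frechet_derivative f (at x)) (at x)" if "x \<in> S" for x
  proof -
    have "(f has_derivative frechet_derivative f (at x)) (at x)"
      using Suc.prems(2) that by (simp add: frechet_derivative_works)
    then show ?thesis
      by (rule has_derivative_transform_within_open[OF _ \<open>open S\<close> that]) (use Suc.prems in auto)
  qed
  have "Ck_on k S (\<lambda>x. frechet_derivative g (at x) v)" for v
    by (rule Suc.IH[of "\<lambda>x. frechet_derivative f (at x) v"])
       (use D frechet_derivative_at Suc.prems(2) in fastforce)+
  moreover have "g differentiable (at x)" if "x \<in> S" for x
    using D[OF that] by (auto simp: differentiable_def)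
  ultimately show ?case by simp
qed

text \<open>Regularity is proved by exhibiting a derivative; the \<open>frechet_derivative\<close>
  that occurs in \<open>Ck_on\<close> agrees with it on the open set.\<close>

lemma Ck_on_Suc_intro:
  assumes "open S" "\<And>x. x \<in> S \<Longrightarrow> (f has_derivative f' x) (at x)"
    and "\<And>v. Ck_on k S (\<lambda>x. f' x v)"
  shows "Ck_on (Suc k) S f"
proof -
  have D: "frechet_derivative f (at x) = f' x" if "x \<in> S" for x
    using assms(2)[OF that] frechet_derivative_at by metis
  have "f differentiable (at x)" if "x \<in> S" for x
    using assms(2)[OF that] by (auto simp: differentiable_def)
  moreover have "Ck_on k S (\<lambda>x. frechet_derivative f (at x) v)" for v
    by (rule Ck_on_cong_imp[OF \<open>open S\<close> _ assms(3)[of v]]) (simp add: D)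
  ultimately show ?thesis by simp
qed

lemma Ck_on_Suc_deriv:
  assumes "Ck_on (Suc k) S f" "x \<in> S"
  shows "(f has_derivative frechet_derivative f (at x)) (at x)"
  using assms by (simp add: frechet_derivative_works)

lemma Ck_on_mono: "Ck_on k S f \<Longrightarrow> T \<subseteq> S \<Longrightarrow> Ck_on k T f"
  by (induction k arbitrary: f) (auto intro: continuous_on_subset)

lemma Ck_on_SucD: "Ck_on (Suc k) S f \<Longrightarrow> Ck_on k S f"
proof (induction k arbitrary: f)
  case 0
  then show ?case
    by (auto intro!: continuous_at_imp_continuous_on differentiable_imp_continuous_within)
next
  case (Suc k)
  then show ?case by (metis Ck_on.simps(2))
qed

lemma Ck_on_local:
  assumes "open S" "\<And>x. x \<in> S \<Longrightarrow> \<exists>T. open T \<and> x \<in> T \<and> Ck_on k T f"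
  shows "Ck_on k S f"
  using assms(2)
proof (induction k arbitrary: f)
  case 0
  have "continuous (at x) f" if x: "x \<in> S" for x
  proof -
    obtain T where "open T" "x \<in> T" "continuous_on T f" using 0[OF x] by auto
    then show ?thesis by (simp add: continuous_on_eq_continuous_at)
  qed
  then show ?case by (simp add: continuous_at_imp_continuous_on)
next
  case (Suc k)
  then show ?case by (metis Ck_on.simps(2))
qed

lemma Ck_on_const: "open S \<Longrightarrow> Ck_on k S (\<lambda>x. c)"
proof (induction k arbitrary: c)
  case (Suc k)
  show ?case
    by (rule Ck_on_Suc_intro[where f' = "\<lambda>x v. 0"]) (use Suc in auto)
qed simp

lemma Ck_on_linear_image:
  assumes "bounded_linear h" "open S" "Ck_on k S f"
  shows "Ck_on k S (\<lambda>x. h (f x))"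
  using assms(3)
proof (induction k arbitrary: f)
  case 0
  then show ?case by (simp add: bounded_linear.continuous_on[OF assms(1)])
next
  case (Suc k)
  show ?case
  proof (rule Ck_on_Suc_intro[where f' = "\<lambda>x v. h (frechet_derivative f (at x) v)", OF \<open>open S\<close>])
    show "((\<lambda>x. h (f x)) has_derivative (\<lambda>v. h (frechet_derivative f (at x) v))) (at x)" if "x \<in> S" for x
      using Ck_on_Suc_deriv[OF Suc.prems that] bounded_linear.has_derivative[OF assms(1)] by blast
  qed (use Suc in auto)
qed

lemma Ck_on_linear:
  assumes "bounded_linear h" "open S"
  shows "Ck_on k S h"
proof (cases k)
  case 0
  then show ?thesis using assms by (simp add: linear_continuous_on)
next
  case (Suc j)
  show ?thesis unfolding Suc
    by (rule Ck_on_Suc_intro[where f' = "\<lambda>x. h"])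
       (use assms in \<open>auto intro: bounded_linear_imp_has_derivative Ck_on_const\<close>)
qed

lemma Ck_on_add:
  assumes "open S" "Ck_on k S f" "Ck_on k S g"
  shows "Ck_on k S (\<lambda>x. f x + g x)"
  using assms(2,3)
proof (induction k arbitrary: f g)
  case 0
  then show ?case by (simp add: continuous_on_add)
next
  case (Suc k)
  show ?case
    by (rule Ck_on_Suc_intro[where f' = "\<lambda>x v. frechet_derivative f (at x) v + frechet_derivative g (at x) v", OF \<open>open S\<close>])
       (use Suc in \<open>auto intro!: has_derivative_add Ck_on_Suc_deriv\<close>)
qed

lemma Ck_on_sum:
  assumes "open S" "\<And>i. i \<in> I \<Longrightarrow> Ck_on k S (f i)"
  shows "Ck_on k S (\<lambda>x. \<Sum>i\<in>I. f i x)"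
  using assms(2)
  by (induction I rule: infinite_finite_induct) (auto intro: Ck_on_const Ck_on_add assms(1))

lemma Ck_on_scaleR:
  assumes "open S" "Ck_on k S f" "Ck_on k S g"
  shows "Ck_on k S (\<lambda>x. f x *\<^sub>R g x)"
  using assms(2,3)
proof (induction k arbitrary: f g)
  case 0
  then show ?case by (simp add: continuous_on_scaleR)
next
  case (Suc k)
  show ?case
  proof (rule Ck_on_Suc_intro[where f' = "\<lambda>x v. f x *\<^sub>R frechet_derivative g (at x) v
      + frechet_derivative f (at x) v *\<^sub>R g x", OF \<open>open S\<close>])
    show "((\<lambda>x. f x *\<^sub>R g x) has_derivative (\<lambda>v. f x *\<^sub>R frechet_derivative g (at x) v
      + frechet_derivative f (at x) v *\<^sub>R g x)) (at x)" if "x \<in> S" for x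
      using that Suc.prems by (intro has_derivative_scaleR Ck_on_Suc_deriv)
    show "Ck_on k S (\<lambda>x. f x *\<^sub>R frechet_derivative g (at x) v
      + frechet_derivative f (at x) v *\<^sub>R g x)" for v
      using Suc.prems by (intro Ck_on_add \<open>open S\<close> Suc.IH) (auto intro: Ck_on_SucD)
  qed
qed

text \<open>The chain rule is written in a basis of the intermediate space. The derivative of the
  composite becomes a sum of scalar functions times partial derivatives of \<open>g\<close> along
  \<open>f\<close>, to which \<open>Ck_on_scaleR\<close> and the induction hypothesis apply.\<close>

lemma Ck_on_compose:
  fixes f :: "'a::real_normed_vector \<Rightarrow> 'b::euclidean_space"
  assumes "open S" "open T" "f ` S \<subseteq> T" "Ck_on k S f" "Ck_on k T g"
  shows "Ck_on k S (\<lambda>x. g (f x))"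
  using assms(4,5)
proof (induction k arbitrary: g)
  case 0
  then show ?case using assms(3) by (auto intro: continuous_on_compose2)
next
  case (Suc k)
  let ?f' = "\<lambda>x. frechet_derivative f (at x)" and ?g' = "\<lambda>y. frechet_derivative g (at y)"
  have f': "(f has_derivative ?f' x) (at x)" if "x \<in> S" for x
    using Ck_on_Suc_deriv[OF Suc.prems(1) that] .
  have g': "(g has_derivative ?g' (f x)) (at (f x))" if "x \<in> S" for x
    using Ck_on_Suc_deriv[OF Suc.prems(2)] that assms(3) by blast
  have lin: "?g' (f x) w = (\<Sum>b\<in>Basis. (w \<bullet> b) *\<^sub>R ?g' (f x) b)" if "x \<in> S" for x w
  proof -
    have "linear (?g' (f x))" using g'[OF that] has_derivative_linear by blast
    then have "?g' (f x) (\<Sum>b\<in>Basis. (w \<bullet> b) *\<^sub>R b) = (\<Sum>b\<in>Basis. (w \<bullet> b) *\<^sub>R ?g' (f x) b)"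
      by (simp add: linear_sum linear_cmul)
    then show ?thesis by (simp add: euclidean_representation)
  qed
  show ?case
  proof (rule Ck_on_Suc_intro[where f' = "\<lambda>x v. \<Sum>b\<in>Basis. (?f' x v \<bullet> b) *\<^sub>R ?g' (f x) b", OF \<open>open S\<close>])
    show "((\<lambda>x. g (f x)) has_derivative (\<lambda>v. \<Sum>b\<in>Basis. (?f' x v \<bullet> b) *\<^sub>R ?g' (f x) b)) (at x)"
      if "x \<in> S" for x
      using has_derivative_compose[OF f'[OF that] g'[OF that]] unfolding lin[OF that, symmetric] .
    show "Ck_on k S (\<lambda>x. \<Sum>b\<in>Basis. (?f' x v \<bullet> b) *\<^sub>R ?g' (f x) b)" for v
    proof (intro Ck_on_sum Ck_on_scaleR \<open>open S\<close>)
      show "Ck_on k S (\<lambda>x. ?f' x v \<bullet> b)" for b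
        using Suc.prems(1) by (intro Ck_on_linear_image[OF bounded_linear_inner_left \<open>open S\<close>]) auto
      show "Ck_on k S (\<lambda>x. ?g' (f x) b)" for b
        using Suc.prems(2) by (intro Suc.IH[OF Ck_on_SucD[OF Suc.prems(1)]]) auto
    qed
  qed
qed

lemma Ck_on_inverse: "Ck_on k (- {0}) (inverse :: real \<Rightarrow> real)"
proof (induction k)
  case 0
  then show ?case by (auto intro!: continuous_intros)
next
  case (Suc k)
  show ?case
  proof (rule Ck_on_Suc_intro[where f' = "\<lambda>x v. (- v) *\<^sub>R (inverse x *\<^sub>R inverse x)"])
    show "(inverse has_derivative (\<lambda>v. (- v) *\<^sub>R (inverse x *\<^sub>R inverse x))) (at x)"
      if "x \<in> - {0}" for x :: real
      using that by (auto intro!: derivative_eq_intros simp: algebra_simps)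
    show "Ck_on k (- {0}) (\<lambda>x::real. (- v) *\<^sub>R (inverse x *\<^sub>R inverse x))" for v
      by (intro Ck_on_linear_image[OF bounded_linear_scaleR_right] Ck_on_scaleR Suc.IH) auto
  qed auto
qed

text \<open>Smoothness of germs: composites can be formed without tracking domains, which shrink
  whenever charts are involved.\<close>

definition smooth_at :: "('a::real_normed_vector \<Rightarrow> 'b::real_normed_vector) \<Rightarrow> 'a \<Rightarrow> bool" where
  "smooth_at f z \<longleftrightarrow> (\<exists>S. open S \<and> z \<in> S \<and> smooth_on S f)"

lemma smooth_atI: "smooth_on S f \<Longrightarrow> open T \<Longrightarrow> T \<subseteq> S \<Longrightarrow> z \<in> T \<Longrightarrow> smooth_at f z"
  unfolding smooth_at_def smooth_on_def by (intro exI[of _ T]) (auto intro: Ck_on_mono)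

lemma smooth_on_if_smooth_at: "open S \<Longrightarrow> (\<And>z. z \<in> S \<Longrightarrow> smooth_at f z) \<Longrightarrow> smooth_on S f"
  unfolding smooth_at_def smooth_on_def using Ck_on_local by metis

lemma smooth_at_eventually: "smooth_at f z \<Longrightarrow> \<forall>\<^sub>F x in nhds z. smooth_at f x"
  unfolding smooth_at_def eventually_nhds by blast

lemma smooth_at_cong:
  assumes "smooth_at f z" "\<forall>\<^sub>F x in nhds z. f x = g x"
  shows "smooth_at g z"
proof -
  obtain S where S: "open S" "z \<in> S" "smooth_on S f" using assms(1) unfolding smooth_at_def by blast
  obtain T where T: "open T" "z \<in> T" "\<forall>x\<in>T. f x = g x" using assms(2) unfolding eventually_nhds by blast
  have "smooth_on (S \<inter> T) g"
    unfolding smooth_on_def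
  proof
    fix k
    have "Ck_on k (S \<inter> T) f" using S(3) Ck_on_mono unfolding smooth_on_def by blast
    then show "Ck_on k (S \<inter> T) g"
      using Ck_on_cong_imp[of "S \<inter> T" f g k] S T by auto
  qed
  then show ?thesis unfolding smooth_at_def using S T by (meson IntI open_Int)
qed

lemma smooth_at_differentiable: "smooth_at f z \<Longrightarrow> f differentiable (at z)"
  using Ck_on.simps(2)[of 0] unfolding smooth_at_def smooth_on_def by blast

lemma smooth_at_has_derivative:
  "smooth_at f z \<Longrightarrow> (f has_derivative frechet_derivative f (at z)) (at z)"
  using smooth_at_differentiable frechet_derivative_works by blast

lemma smooth_at_linear_deriv: "smooth_at f z \<Longrightarrow> linear (frechet_derivative f (at z))"
  by (simp add: linear_frechet_derivative smooth_at_differentiable)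

lemma smooth_at_isCont: "smooth_at f z \<Longrightarrow> isCont f z"
  by (simp add: differentiable_imp_continuous_within smooth_at_differentiable)

lemma smooth_at_deriv: "smooth_at f z \<Longrightarrow> smooth_at (\<lambda>x. frechet_derivative f (at x) v) z"
  using Ck_on.simps(2) unfolding smooth_at_def smooth_on_def by blast

lemma smooth_at_linear: "bounded_linear h \<Longrightarrow> smooth_at h z"
  unfolding smooth_at_def smooth_on_def using Ck_on_linear open_UNIV by blast

lemma smooth_at_const: "smooth_at (\<lambda>x. c) z"
  unfolding smooth_at_def smooth_on_def using Ck_on_const open_UNIV by blast

lemma smooth_at_ident: "smooth_at (\<lambda>x. x) z"
  by (rule smooth_at_linear) (rule bounded_linear_ident)

lemma smooth_at_linear_image: "bounded_linear h \<Longrightarrow> smooth_at f z \<Longrightarrow> smooth_at (\<lambda>x. h (f x)) z"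
  unfolding smooth_at_def smooth_on_def using Ck_on_linear_image by blast

lemma smooth_at_common:
  assumes "smooth_at f z" "smooth_at g z"
  obtains S where "open S" "z \<in> S" "\<And>k. Ck_on k S f" "\<And>k. Ck_on k S g"
proof -
  obtain S T where "open S" "z \<in> S" "smooth_on S f" "open T" "z \<in> T" "smooth_on T g"
    using assms unfolding smooth_at_def by blast
  then show ?thesis
    by (intro that[of "S \<inter> T"]) (auto simp: smooth_on_def intro: Ck_on_mono)
qed

lemma smooth_at_add: "smooth_at f z \<Longrightarrow> smooth_at g z \<Longrightarrow> smooth_at (\<lambda>x. f x + g x) z"
  by (erule (1) smooth_at_common) (auto simp: smooth_at_def smooth_on_def intro: Ck_on_add)

lemma smooth_at_diff: "smooth_at f z \<Longrightarrow> smooth_at g z \<Longrightarrow> smooth_at (\<lambda>x. f x - g x) z"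
  using smooth_at_add[of f z "\<lambda>x. - g x"] smooth_at_linear_image[OF bounded_linear_minus[OF bounded_linear_ident], of g z]
  by simp

lemma smooth_at_Pair:
  assumes "smooth_at f z" "smooth_at g z"
  shows "smooth_at (\<lambda>x. (f x, g x)) z"
proof -
  have "smooth_at (\<lambda>x. (f x, 0) + (0, g x)) z"
    by (intro smooth_at_add smooth_at_linear_image[OF _ assms(1)] smooth_at_linear_image[OF _ assms(2)]
        bounded_linear_Pair bounded_linear_ident bounded_linear_zero)
  then show ?thesis by simp
qed

lemma smooth_at_compose:
  fixes f :: "'a::real_normed_vector \<Rightarrow> 'b::euclidean_space"
  assumes "smooth_at f z" "smooth_at g (f z)"
  shows "smooth_at (\<lambda>x. g (f x)) z"
proof -
  obtain S T where S: "open S" "z \<in> S" "smooth_on S f" and T: "open T" "f z \<in> T" "smooth_on T g"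
    using assms unfolding smooth_at_def by blast
  have "continuous_on S f" using S(3) unfolding smooth_on_def by (metis Ck_on.simps(1))
  then have "open (S \<inter> f -` T)" using S(1) T(1) by (simp add: continuous_open_preimage)
  moreover have "smooth_on (S \<inter> f -` T) (\<lambda>x. g (f x))"
    unfolding smooth_on_def
  proof
    fix k
    have "Ck_on k (S \<inter> f -` T) f" using S(3) Ck_on_mono unfolding smooth_on_def by blast
    moreover have "Ck_on k T g" using T(3) unfolding smooth_on_def by blast
    ultimately show "Ck_on k (S \<inter> f -` T) (\<lambda>x. g (f x))"
      using Ck_on_compose[OF \<open>open (S \<inter> f -` T)\<close> T(1), of f k g] by auto
  qed
  ultimately show ?thesis unfolding smooth_at_def using S(2) T(2) by blast
qed

text \<open>Continuity of the derivative is known for each direction separately; in finite dimension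
  the basis directions control the operator norm.\<close>

lemma smooth_at_deriv_onorm:
  fixes f :: "'a::euclidean_space \<Rightarrow> 'b::real_normed_vector"
  assumes "smooth_at f z" "0 < e"
  shows "\<forall>\<^sub>F x in nhds z. onorm (\<lambda>v. frechet_derivative f (at x) v - frechet_derivative f (at z) v) \<le> e"
proof -
  let ?D = "\<lambda>x. frechet_derivative f (at x)"
  define e' where "e' = e / DIM('a)"
  have e': "e' > 0" using assms(2) by (simp add: e'_def)
  have "\<forall>\<^sub>F x in nhds z. norm (?D x b - ?D z b) < e'" for b
  proof -
    have "((\<lambda>x. ?D x b) \<longlongrightarrow> ?D z b) (nhds z)"
      using smooth_at_isCont[OF smooth_at_deriv[OF assms(1), of b]]
      unfolding isCont_def by (rule tendsto_at_iff_tendsto_nhds[THEN iffD1])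
    from tendstoD[OF this e'] show ?thesis by (simp add: dist_norm)
  qed
  then have "\<forall>\<^sub>F x in nhds z. \<forall>b\<in>Basis. norm (?D x b - ?D z b) < e'"
    by (intro eventually_ball_finite) auto
  then show ?thesis
    using smooth_at_eventually[OF assms(1)]
  proof eventually_elim
    case (elim x)
    interpret l: linear "\<lambda>v. ?D x v - ?D z v"
      by (intro linear_compose_sub smooth_at_linear_deriv elim assms)
    show ?case
    proof (rule onorm_le)
      fix v
      have "norm (?D x v - ?D z v) = norm (\<Sum>b\<in>Basis. (v \<bullet> b) *\<^sub>R (?D x b - ?D z b))"
        using l.sum[of "\<lambda>b. (v \<bullet> b) *\<^sub>R b" Basis] by (simp add: euclidean_representation l.scaleR)
      also have "\<dots> \<le> (\<Sum>b\<in>(Basis::'a set). norm v * e')"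
      proof (rule sum_norm_le)
        fix b :: 'a assume b: "b \<in> Basis"
        have "\<bar>v \<bullet> b\<bar> \<le> norm v" using Basis_le_norm[OF b] .
        then show "norm ((v \<bullet> b) *\<^sub>R (?D x b - ?D z b)) \<le> norm v * e'"
          using elim(1) b by (auto intro!: mult_mono simp: less_imp_le)
      qed
      also have "\<dots> = e * norm v" by (simp add: e'_def)
      finally show "norm (?D x v - ?D z v) \<le> e * norm v" .
    qed
  qed
qed

text \<open>Strict differentiability, with both points varying. It makes the averaged chart map a
  perturbation of the identity and separates nearby fixed points of a torus element.\<close>

lemma smooth_at_strict:
  fixes f :: "'a::euclidean_space \<Rightarrow> 'b::real_normed_vector"
  assumes "smooth_at f z" "0 < e"
  shows "\<exists>d>0. \<forall>x\<in>ball z d. \<forall>y\<in>ball z d.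
    norm (f x - f y - frechet_derivative f (at z) (x - y)) \<le> e * norm (x - y)"
proof -
  let ?D = "\<lambda>x. frechet_derivative f (at x)"
  have "\<forall>\<^sub>F x in nhds z. smooth_at f x \<and> onorm (\<lambda>v. ?D x v - ?D z v) \<le> e"
    using smooth_at_eventually[OF assms(1)] smooth_at_deriv_onorm[OF assms] by eventually_elim auto
  then obtain d where d: "d > 0" "\<And>x. dist x z < d \<Longrightarrow> smooth_at f x \<and> onorm (\<lambda>v. ?D x v - ?D z v) \<le> e"
    unfolding eventually_nhds_metric by blast
  show ?thesis
  proof (intro exI conjI ballI)
    fix x y assume xy: "x \<in> ball z d" "y \<in> ball z d"
    have "norm (f x - f y - ?D z (x - y)) \<le> norm (x - y) * e"
    proof (rule differentiable_bound_linearization[where S = "ball z d"])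
      show "y + t *\<^sub>R (x - y) \<in> ball z d" if "t \<in> {0..1}" for t
        using convexD_alt[OF convex_ball xy(2,1), of t] that by (simp add: algebra_simps)
    qed (use d xy in \<open>auto intro: has_derivative_at_withinI[OF smooth_at_has_derivative] simp: dist_commute fun_diff_def\<close>)
    then show "norm (f x - f y - ?D z (x - y)) \<le> e * norm (x - y)" by (simp add: mult.commute)
  qed fact
qed

section \<open>Linear algebra\<close>

definition complex_matrix :: "real^'m^'m \<Rightarrow> real^'m^'m \<Rightarrow> complex^'m^'m" where
  "complex_matrix U V = (\<chi> i j. Complex (U$i$j) (V$i$j))"

lemma det_complex_matrix_cnj:
  "det (complex_matrix U (- V)) = cnj (det (complex_matrix U V))"
  unfolding det_def complex_matrix_def by (simp add: cnj_sum cnj_prod complex_cnj)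

lemma det_complex_matrix_real: "det (complex_matrix U 0) = of_real (det U)"
  unfolding det_def complex_matrix_def by (simp add: complex_of_real_def[symmetric])

text \<open>When \<open>U\<close> and \<open>V\<close> commute, \<open>U\<^sup>2 + V\<^sup>2\<close>
  factors over the complex numbers as \<open>(U - iV)(U + iV)\<close>, and the determinants of the
  two factors are conjugate.\<close>

lemma det_sum_of_squares_nonneg:
  fixes U V :: "real^'m^'m"
  assumes "U ** V = V ** U"
  shows "0 \<le> det (U ** U + V ** V)"
proof -
  have "complex_matrix U (- V) ** complex_matrix U V
      = complex_matrix (U ** U + V ** V) (U ** V - V ** U)"
    by (simp add: vec_eq_iff complex_matrix_def matrix_matrix_mult_def complex_eq_iff
        sum.distrib sum_subtractf sum_negf)
  then have "complex_of_real (det (U ** U + V ** V))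
      = cnj (det (complex_matrix U V)) * det (complex_matrix U V)"
    using assms by (simp flip: det_complex_matrix_real det_complex_matrix_cnj det_mul)
  also have "\<dots> = of_real ((cmod (det (complex_matrix U V)))\<^sup>2)"
    by (simp only: complex_norm_square mult.commute)
  finally show ?thesis by (simp only: of_real_eq_iff) simp
qed

text \<open>With \<open>U = (M + 1) / 2\<close> and \<open>V = (M - 1) J / 2\<close> one has \<open>U\<^sup>2 + V\<^sup>2 = M\<close>.\<close>

lemma det_complex_linear_nonneg:
  fixes M J :: "real^'m \<Rightarrow> real^'m"
  assumes M: "linear M" and J: "linear J" "\<And>u. J (J u) = - u" and MJ: "\<And>u. M (J u) = J (M u)"
  shows "0 \<le> det (matrix M)"
proof -
  define U where "U = (\<lambda>u. (1/2) *\<^sub>R (M u + u))"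
  define V where "V = (\<lambda>u. (1/2) *\<^sub>R (M (J u) - J u))"
  have lin: "linear U" "linear V"
    unfolding U_def V_def
    using M J(1) by (auto intro!: linearI simp: linear_add linear_cmul algebra_simps)
  note M_simps = linear_add[OF M] linear_cmul[OF M] linear_diff[OF M] linear_neg[OF M]
    and J_simps = linear_add[OF J(1)] linear_cmul[OF J(1)] linear_diff[OF J(1)] linear_neg[OF J(1)]
  have "U \<circ> V = V \<circ> U"
    by (auto simp: fun_eq_iff U_def V_def M_simps J_simps MJ algebra_simps)
  then have "matrix U ** matrix V = matrix V ** matrix U"
    using lin by (metis matrix_compose)
  moreover have "matrix U ** matrix U + matrix V ** matrix V = matrix M"
  proof -
    have "M = (\<lambda>u. (U \<circ> U) u + (V \<circ> V) u)"
    proof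
      fix u
      have "U (U u) + V (V u) = (1/4) *\<^sub>R (M u + M u + M u + M u)"
        by (simp add: U_def V_def M_simps J_simps MJ J(2) algebra_simps)
      also have "\<dots> = M u" by (simp add: vec_eq_iff)
      finally show "M u = (U \<circ> U) u + (V \<circ> V) u" by simp
    qed
    then have "matrix M = matrix (U \<circ> U) + matrix (V \<circ> V)"
      by (simp add: matrix_def vec_eq_iff)
    then show ?thesis using lin by (simp add: matrix_compose)
  qed
  ultimately show ?thesis using det_sum_of_squares_nonneg by metis
qed

lemma subspace_in_finite_Union:
  fixes W :: "'a::euclidean_space set"
  assumes "finite \<P>" "\<And>P. P \<in> \<P> \<Longrightarrow> subspace P" "subspace W" "W \<subseteq> \<Union>\<P>"
  shows "\<exists>P\<in>\<P>. W \<subseteq> P"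
  using assms
proof (induction \<P> rule: finite_induct)
  case empty
  then show ?case using subspace_0 by blast
next
  case (insert P \<P>)
  show ?case
  proof (cases "W \<subseteq> P")
    case False
    then obtain u where u: "u \<in> W" "u \<notin> P" by blast
    have sub: "subspace P" using insert.prems by blast
    have "W \<subseteq> \<Union>\<P>"
    proof
      fix x assume x: "x \<in> W"
      show "x \<in> \<Union>\<P>"
      proof (cases "x \<in> P")
        case True
        define y where "y = (\<lambda>n. x + inverse (real (Suc n)) *\<^sub>R u)"
        have "y n \<in> \<Union>\<P>" for n
        proof -
          have "y n \<notin> P"
          proof
            assume "y n \<in> P"
            then have "real (Suc n) *\<^sub>R (y n - x) \<in> P"
              using True sub by (intro subspace_scale subspace_diff)
            then show False using u(2) by (simp add: y_def)
          qed
          moreover have "y n \<in> W"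
            using x u(1) insert.prems(2) by (simp add: y_def subspace_add subspace_scale)
          ultimately show ?thesis using insert.prems(3) by auto
        qed
        moreover have "y \<longlonglongrightarrow> x + 0 *\<^sub>R u"
          unfolding y_def by (intro tendsto_intros LIMSEQ_inverse_real_of_nat)
        moreover have "closed (\<Union>\<P>)"
          using insert.prems(1) insert.hyps(1) by (intro closed_Union) (auto intro: closed_subspace)
        ultimately show ?thesis
          using closed_sequentially[of "\<Union>\<P>" y x] by simp
      qed (use x insert.prems in auto)
    qed
    then show ?thesis using insert by auto
  qed auto
qed

section \<open>Continuous families of linear maps of finite order\<close>

lemma tendsto_det:
  fixes A :: "'z \<Rightarrow> real^'m^'m"
  assumes "\<And>i j. ((\<lambda>z. A z $ i $ j) \<longlongrightarrow> B $ i $ j) F"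
  shows "((\<lambda>z. det (A z)) \<longlongrightarrow> det B) F"
  unfolding det_def by (intro tendsto_intros assms)

text \<open>Pointwise convergence of linear maps on a Euclidean space is uniform on bounded sets, so
  the argument may move along; the basis expansion makes this explicit.\<close>

lemma tendsto_linear_family:
  fixes R :: "'z \<Rightarrow> 'a::euclidean_space \<Rightarrow> 'b::real_normed_vector"
  assumes ev: "\<forall>\<^sub>F z in F. linear (R z)" and "linear R0"
    and R: "\<And>u. ((\<lambda>z. R z u) \<longlongrightarrow> R0 u) F" and w: "(w \<longlongrightarrow> w0) F"
  shows "((\<lambda>z. R z (w z)) \<longlongrightarrow> R0 w0) F"
proof -
  have expand: "L x = (\<Sum>b\<in>Basis. (x \<bullet> b) *\<^sub>R L b)" if "linear L" for L :: "'a \<Rightarrow> 'b" and x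
    using linear_sum[OF that, of "\<lambda>b. (x \<bullet> b) *\<^sub>R b" Basis] that
    by (simp add: euclidean_representation linear_cmul)
  have "((\<lambda>z. \<Sum>b\<in>Basis. (w z \<bullet> b) *\<^sub>R R z b) \<longlongrightarrow> (\<Sum>b\<in>Basis. (w0 \<bullet> b) *\<^sub>R R0 b)) F"
    by (intro tendsto_intros R w)
  moreover have "\<forall>\<^sub>F z in F. (\<Sum>b\<in>Basis. (w z \<bullet> b) *\<^sub>R R z b) = R z (w z)"
    using ev by eventually_elim (rule expand[symmetric])
  ultimately show ?thesis unfolding expand[OF \<open>linear R0\<close>, of w0]
    by (rule Lim_transform_eventually)
qed

lemma linear_funpow: "linear R \<Longrightarrow> linear (R ^^ j)" for R :: "'a::real_vector \<Rightarrow> 'a"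
  by (induction j) (auto intro: linear_compose linear_id simp: id_def[symmetric])

text \<open>The identity, averaged over the cyclic groups generated by \<open>R0\<close> and \<open>R\<close>.\<close>

lemma average_intertwines:
  fixes R R0 :: "'a::real_vector \<Rightarrow> 'a"
  assumes "linear R" "linear R0" "\<And>u. (R ^^ n) u = u" "\<And>u. (R0 ^^ n) u = u"
  shows "R (\<Sum>j<n. (R ^^ j) ((R0 ^^ (n - j)) u)) = (\<Sum>j<n. (R ^^ j) ((R0 ^^ (n - j)) (R0 u)))"
proof -
  have "R (\<Sum>j<n. (R ^^ j) ((R0 ^^ (n - j)) u)) = (\<Sum>j<n. (R ^^ Suc j) ((R0 ^^ (Suc n - Suc j)) u))"
    using assms(1) by (simp add: linear_sum)
  moreover have "(\<Sum>j<n. (R ^^ j) ((R0 ^^ (n - j)) (R0 u))) = (\<Sum>j<n. (R ^^ j) ((R0 ^^ (Suc n - j)) u))"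
    by (intro sum.cong) (auto simp: Suc_diff_le funpow_swap1)
  moreover have "(\<Sum>j<n. (R ^^ Suc j) ((R0 ^^ (Suc n - Suc j)) u)) - (\<Sum>j<n. (R ^^ j) ((R0 ^^ (Suc n - j)) u))
      = (R ^^ n) ((R0 ^^ (Suc n - n)) u) - (R ^^ 0) ((R0 ^^ (Suc n - 0)) u)"
    unfolding sum_subtractf[symmetric]
    by (rule sum_lessThan_telescope[where f = "\<lambda>j. (R ^^ j) ((R0 ^^ (Suc n - j)) u)"])
  ultimately show ?thesis using assms(3,4) by simp
qed

text \<open>Nearby representations of a cyclic group are isomorphic. Averaging the identity gives an
  intertwiner \<open>S z\<close>, which need not carry \<open>D z0 x\<close> to
  \<open>D z x\<close>; the correction through an invariant left inverse \<open>\<Lambda>\<close> of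
  \<open>D z0\<close> repairs this and keeps equivariance. At \<open>z0\<close> the result is the
  identity, so its determinant stays positive nearby.\<close>

lemma local_intertwiner:
  fixes R :: "'z::topological_space \<Rightarrow> real^'m \<Rightarrow> real^'m" and D :: "'z \<Rightarrow> complex \<Rightarrow> real^'m"
  assumes n: "n > 0"
    and ev: "\<forall>\<^sub>F z in nhds z0. linear (R z) \<and> (\<forall>u. (R z ^^ n) u = u) \<and> linear (D z) \<and> (\<forall>x. R z (D z x) = D z x)"
    and contR: "\<And>u. ((\<lambda>z. R z u) \<longlongrightarrow> R z0 u) (nhds z0)"
    and contD: "\<And>x. ((\<lambda>z. D z x) \<longlongrightarrow> D z0 x) (nhds z0)"
    and inj: "inj (D z0)"
  shows "\<forall>\<^sub>F z in nhds z0. \<exists>\<Psi>. linear \<Psi> \<and> det (matrix \<Psi>) > 0 \<and>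
    (\<forall>u. \<Psi> (R z0 u) = R z (\<Psi> u)) \<and> (\<forall>x. \<Psi> (D z0 x) = D z x)"
proof -
  note z0 = eventually_nhds_x_imp_x[OF ev]
  define S where "S = (\<lambda>z u. (1 / real n) *\<^sub>R (\<Sum>j<n. (R z ^^ j) ((R z0 ^^ (n - j)) u)))"
  obtain \<Lambda>0 where \<Lambda>0: "linear \<Lambda>0" "\<And>x. \<Lambda>0 (D z0 x) = x"
    using linear_injective_left_inverse[of "D z0"] z0 inj by (auto simp: fun_eq_iff)
  \<comment> \<open>Averaging makes the left inverse \<open>\<Lambda>0\<close> invariant under
    \<open>R z0\<close>. It remains a left inverse because \<open>R z0\<close> fixes the range of
    \<open>D z0\<close>.\<close>
  define A where "A = (\<lambda>u. (1 / real n) *\<^sub>R (\<Sum>j<n. (R z0 ^^ j) u))"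
  define \<Lambda> where "\<Lambda> = \<Lambda>0 \<circ> A"
  define \<Psi> where "\<Psi> = (\<lambda>z u. S z u + (D z (\<Lambda> u) - S z (D z0 (\<Lambda> u))))"
  have linpow: "linear (R z0 ^^ j)" for j
    using z0 linear_funpow by blast
  have linA: "linear A"
    unfolding A_def by (intro linear_compose_scale_right linear_compose_sum ballI linpow)
  have lin\<Lambda>: "linear \<Lambda>" unfolding \<Lambda>_def by (intro linear_compose linA \<Lambda>0)
  have fixpow: "(R z0 ^^ j) (D z0 x) = D z0 x" for j x
    by (induction j) (use z0 in auto)
  have \<Lambda>D: "\<Lambda> (D z0 x) = x" for x
    using n by (simp add: \<Lambda>_def A_def fixpow sum_constant_scaleR \<Lambda>0 del: sum_constant)
  have A_R: "A (R z0 u) = A u" for u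
  proof -
    have "(\<Sum>j<n. (R z0 ^^ j) (R z0 u)) - (\<Sum>j<n. (R z0 ^^ j) u) = (\<Sum>j<n. (R z0 ^^ Suc j) u - (R z0 ^^ j) u)"
      by (simp add: sum_subtractf funpow_swap1)
    also have "\<dots> = 0"
      using z0 by (subst sum_lessThan_telescope) simp
    finally show ?thesis by (simp add: A_def)
  qed
  have \<Lambda>R: "\<Lambda> (R z0 u) = \<Lambda> u" for u by (simp add: \<Lambda>_def A_R)
  have main: "linear (\<Psi> z) \<and> (\<forall>u. \<Psi> z (R z0 u) = R z (\<Psi> z u)) \<and> (\<forall>x. \<Psi> z (D z0 x) = D z x)"
    if z: "linear (R z) \<and> (\<forall>u. (R z ^^ n) u = u) \<and> linear (D z) \<and> (\<forall>x. R z (D z x) = D z x)" for z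
  proof -
    have "linear (\<lambda>u. (R z ^^ j) ((R z0 ^^ i) u))" for i j
      using linear_compose[OF linpow[of i] linear_funpow[of "R z" j]] z by (simp add: o_def)
    then have linS: "linear (S z)"
      unfolding S_def by (intro linear_compose_scale_right linear_compose_sum ballI)
    have intS: "S z (R z0 u) = R z (S z u)" for u
      using average_intertwines[of "R z" "R z0" n u] z z0 by (simp add: S_def linear_cmul)
    have linD\<Lambda>: "linear (\<lambda>u. D z (\<Lambda> u))" "linear (\<lambda>u. D z0 (\<Lambda> u))"
      using linear_compose[OF lin\<Lambda>, of "D z"] linear_compose[OF lin\<Lambda>, of "D z0"] z z0
      by (auto simp: o_def)
    have "linear (\<lambda>u. S z (D z0 (\<Lambda> u)))"
      using linear_compose[OF linD\<Lambda>(2) linS] by (simp add: o_def)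
    then have "linear (\<Psi> z)"
      unfolding \<Psi>_def by (intro linear_compose_add linear_compose_sub linS linD\<Lambda>)
    moreover have "\<Psi> z (R z0 u) = R z (\<Psi> z u)" for u
    proof -
      have "R z (\<Psi> z u) = R z (S z u) + (R z (D z (\<Lambda> u)) - R z (S z (D z0 (\<Lambda> u))))"
        using z by (simp add: \<Psi>_def linear_add linear_diff)
      also have "\<dots> = S z (R z0 u) + (D z (\<Lambda> u) - S z (R z0 (D z0 (\<Lambda> u))))"
        using z by (simp add: intS)
      finally show ?thesis using z0 by (simp add: \<Psi>_def \<Lambda>R)
    qed
    moreover have "\<Psi> z (D z0 x) = D z x" for x by (simp add: \<Psi>_def \<Lambda>D)
    ultimately show ?thesis by blast
  qed
  have evlin: "\<forall>\<^sub>F z in nhds z0. linear (R z)" "\<forall>\<^sub>F z in nhds z0. linear (D z)"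
    using ev by (auto elim: eventually_mono)
  have pow: "((\<lambda>z. (R z ^^ j) w) \<longlongrightarrow> (R z0 ^^ j) w) (nhds z0)" for j w
  proof (induction j)
    case (Suc j)
    then show ?case using tendsto_linear_family[OF evlin(1) _ contR Suc] z0 by simp
  qed simp
  have S: "((\<lambda>z. S z u) \<longlongrightarrow> S z0 u) (nhds z0)" for u
    unfolding S_def by (intro tendsto_intros pow)
  have \<Psi>: "((\<lambda>z. \<Psi> z u) \<longlongrightarrow> \<Psi> z0 u) (nhds z0)" for u
    unfolding \<Psi>_def by (intro tendsto_intros S contD)
  have "\<Psi> z0 = (\<lambda>u. u)"
  proof
    fix u
    have "(R z0 ^^ j) ((R z0 ^^ (n - j)) w) = w" if "j < n" for j w
      using z0 that by (metis add_diff_inverse_nat comp_apply funpow_add less_imp_not_less)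
    then have "S z0 w = w" for w using n by (simp add: S_def sum_constant_scaleR del: sum_constant)
    then show "\<Psi> z0 u = u" by (simp add: \<Psi>_def)
  qed
  then have "det (matrix (\<Psi> z0)) = 1" by (simp add: matrix_id_mat_1[unfolded id_def])
  moreover have "((\<lambda>z. det (matrix (\<Psi> z))) \<longlongrightarrow> det (matrix (\<Psi> z0))) (nhds z0)"
    by (intro tendsto_det) (auto simp: matrix_def intro!: tendsto_vec_nth \<Psi>)
  ultimately have "\<forall>\<^sub>F z in nhds z0. det (matrix (\<Psi> z)) > 0"
    by (intro order_tendstoD(1)[of _ 1 "nhds z0" 0]) auto
  then show ?thesis
    using ev by eventually_elim (use main in blast)
qed


text \<open>\<open>h\<close> pairs up the coordinates, so that \<open>real^'m\<close> becomes the complex vector space of functions on \<open>I\<close>.\<close>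

locale coordinate_pairing =
  fixes I :: "'i set" and h :: "'i \<times> bool \<Rightarrow> 'm::finite"
  assumes h: "bij_betw h (I \<times> UNIV) UNIV"
begin

definition coord :: "real^'m \<Rightarrow> 'i \<Rightarrow> complex" where
  "coord u i = Complex (u $ h (i, False)) (u $ h (i, True))"

definition of_coords :: "('i \<Rightarrow> complex) \<Rightarrow> real^'m" where
  "of_coords f = (\<chi> j. case inv_into (I \<times> UNIV) h j of (i, b) \<Rightarrow> if b then Im (f i) else Re (f i))"

lemma h_inv: "i \<in> I \<Longrightarrow> inv_into (I \<times> UNIV) h (h (i, b)) = (i, b)"
  using h by (intro inv_into_f_f) (auto simp: bij_betw_def)

lemma finite_I: "finite I"
proof -
  have "finite (I \<times> (UNIV::bool set))" using bij_betw_finite[OF h] by simp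
  then show ?thesis by (auto simp: finite_cartesian_product_iff)
qed

lemma h_surj: obtains i b where "i \<in> I" "j = h (i, b)"
  using h that by (force simp: bij_betw_def)

lemma coord_of_coords [simp]: "i \<in> I \<Longrightarrow> coord (of_coords f) i = f i"
  by (simp add: coord_def of_coords_def h_inv complex_eq_iff)

lemma eq_if_coord: "(\<And>i. i \<in> I \<Longrightarrow> coord u i = coord v i) \<Longrightarrow> u = v"
  unfolding vec_eq_iff
proof
  fix j assume *: "\<And>i. i \<in> I \<Longrightarrow> coord u i = coord v i"
  obtain i b where "i \<in> I" "j = h (i, b)" using h_surj .
  then show "u $ j = v $ j" using *[of i] by (cases b) (auto simp: coord_def)
qed

lemma coord_simps [simp]:
  "coord (u + v) i = coord u i + coord v i" "coord (r *\<^sub>R u) i = r *\<^sub>R coord u i" "coord (- u) i = - coord u i"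
  "coord (u - v) i = coord u i - coord v i" "coord 0 i = 0"
  by (simp_all add: coord_def complex_eq_iff)

lemma coord_sum [simp]: "coord (\<Sum>x\<in>S. f x) i = (\<Sum>x\<in>S. coord (f x) i)"
  by (induction S rule: infinite_finite_induct) auto

lemma linear_coord: "linear (\<lambda>u. coord u i)"
  by (rule linearI) auto

definition coord_scale :: "('i \<Rightarrow> complex) \<Rightarrow> real^'m \<Rightarrow> real^'m" where
  "coord_scale \<omega> u = of_coords (\<lambda>i. \<omega> i * coord u i)"

lemma coord_scale [simp]: "i \<in> I \<Longrightarrow> coord (coord_scale \<omega> u) i = \<omega> i * coord u i"
  by (simp add: coord_scale_def)

lemma linear_scale: "linear (coord_scale \<omega>)"
  by (rule linearI; rule eq_if_coord) (simp_all add: algebra_simps)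

definition conj_at :: "('i \<Rightarrow> real) \<Rightarrow> real^'m \<Rightarrow> real^'m" where
  "conj_at s u = of_coords (\<lambda>i. if s i = 1 then coord u i else cnj (coord u i))"

lemma coord_conj_at [simp]: "i \<in> I \<Longrightarrow> coord (conj_at s u) i = (if s i = 1 then coord u i else cnj (coord u i))"
  by (simp add: conj_at_def)

lemma linear_conj_at: "linear (conj_at s)"
  by (rule linearI; rule eq_if_coord) simp_all

text \<open>The map is diagonal in the real coordinates: \<open>h (i, False)\<close> is kept and
  \<open>h (i, True)\<close> is multiplied by \<open>s i\<close>.\<close>

lemma det_conj_at:
  assumes s: "\<And>i. i \<in> I \<Longrightarrow> s i = 1 \<or> s i = - 1"
  shows "det (matrix (conj_at s)) = (\<Prod>i\<in>I. s i)"
proof -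
  have coord: "conj_at s u $ h (i, b) = (if b then s i else 1) * u $ h (i, b)" if "i \<in> I" for u i b
  proof -
    have "coord (conj_at s u) i = (if s i = 1 then coord u i else cnj (coord u i))" using that by simp
    then show ?thesis using s[OF that] by (cases b) (auto simp: coord_def complex_eq_iff)
  qed
  have "matrix (conj_at s) $ j $ l = (if j = l then matrix (conj_at s) $ j $ j else 0)" for j l
  proof -
    obtain i b where "i \<in> I" "j = h (i, b)" using h_surj .
    then show ?thesis using coord[of i "axis l 1" b]
      by (cases "j = l") (auto simp: matrix_def axis_def)
  qed
  then have "det (matrix (conj_at s)) = (\<Prod>j\<in>UNIV. matrix (conj_at s) $ j $ j)"
    by (intro det_diagonal) metis
  also have "\<dots> = (\<Prod>(i, b)\<in>I \<times> UNIV. matrix (conj_at s) $ h (i, b) $ h (i, b))"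
    by (simp add: prod.reindex_bij_betw[OF h, symmetric] case_prod_beta')
  also have "\<dots> = (\<Prod>(i, b)\<in>I \<times> UNIV. if b then s i else 1)"
    by (intro prod.cong) (auto simp: matrix_def coord)
  also have "\<dots> = (\<Prod>i\<in>I. s i)"
    by (simp add: prod.cartesian_product[symmetric] UNIV_bool)
  finally show ?thesis .
qed

text \<open>The weights \<open>\<omega>\<close>, \<open>\<omega>'\<close> determine complex structures which \<open>M\<close> intertwines;
  up to conjugating some of the coordinates, \<open>M\<close> is complex linear.\<close>

lemma sgn_det_intertwiner:
  assumes M: "linear M" and e: "e \<in> I" "e' \<in> I"
    and norm: "\<And>i. i \<in> I \<Longrightarrow> cmod (\<omega> i) = 1" "\<And>i. i \<in> I \<Longrightarrow> cmod (\<omega>' i) = 1"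
    and one: "\<omega> e = 1" "\<omega>' e' = 1"
    and Im: "\<And>i. i \<in> I - {e} \<Longrightarrow> Im (\<omega> i) \<noteq> 0" "\<And>i. i \<in> I - {e'} \<Longrightarrow> Im (\<omega>' i) \<noteq> 0"
    and inter: "\<And>u. M (coord_scale \<omega> u) = coord_scale \<omega>' (M u)"
    and Me: "\<And>x. M (of_coords (\<lambda>i. if i = e then x else 0)) = of_coords (\<lambda>i. if i = e' then - cnj x else 0)"
  shows "0 \<le> - (det (matrix M) * ((\<Prod>i\<in>I - {e}. sgn (Im (\<omega> i))) * (\<Prod>i\<in>I - {e'}. sgn (Im (\<omega>' i)))))"
proof -
  \<comment> \<open>On the line \<open>e\<close> the map sends \<open>x\<close> to
    \<open>- cnj x\<close>, which is conjugate linear. The value -1 of \<open>s'\<close> at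
    \<open>e'\<close> makes it complex linear there and produces the minus sign of the
    conclusion.\<close>
  define s where "s = (\<lambda>i. if i = e then 1 else sgn (Im (\<omega> i)))"
  define s' where "s' = (\<lambda>i. if i = e' then - 1 else sgn (Im (\<omega>' i)))"
  have s: "s i = 1 \<or> s i = - 1" if "i \<in> I" for i
    using Im(1)[of i] that by (auto simp: s_def sgn_if)
  have s': "s' i = 1 \<or> s' i = - 1" if "i \<in> I" for i
    using Im(2)[of i] that by (auto simp: s'_def sgn_if)
  let ?J = "\<lambda>s. coord_scale (\<lambda>i. \<i> * of_real (s i))"
  let ?B = "\<lambda>\<omega>. coord_scale (\<lambda>i. \<i> * of_real (Im (\<omega> i)))"
  have inter_cnj: "M (coord_scale (\<lambda>i. cnj (\<omega> i)) u) = coord_scale (\<lambda>i. cnj (\<omega>' i)) (M u)" for u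
  proof -
    have unit: "cnj z * (z * w) = w" if "cmod z = 1" for z w
      using that by (metis complex_norm_square mult.assoc mult.commute mult_1 of_real_1 one_power2)
    have "coord_scale (\<lambda>i. cnj (\<omega>' i)) (M (coord_scale \<omega> (coord_scale (\<lambda>i. cnj (\<omega> i)) u))) = M (coord_scale (\<lambda>i. cnj (\<omega> i)) u)"
      unfolding inter by (rule eq_if_coord) (simp add: unit norm)
    moreover have "coord_scale \<omega> (coord_scale (\<lambda>i. cnj (\<omega> i)) u) = u"
      by (rule eq_if_coord) (simp add: mult.left_commute[of "\<omega> _"] unit norm)
    ultimately show ?thesis by simp
  qed
  \<comment> \<open>Half the difference of \<open>\<omega>\<close> and its inverse is multiplication
    by \<open>\<i> * Im \<omega>\<close>: a positive multiple of the signed complex structure on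
    each line where \<open>Im \<omega>\<close> does not vanish.\<close>
  have B: "M (?B \<omega> u) = ?B \<omega>' (M u)" for u
  proof -
    have eq: "?B \<omega> u = (1/2) *\<^sub>R (coord_scale \<omega> u - coord_scale (\<lambda>i. cnj (\<omega> i)) u)" for \<omega> u
      by (rule eq_if_coord) (simp add: complex_eq_iff)
    show ?thesis unfolding eq by (simp add: linear_cmul[OF M] linear_diff[OF M] inter inter_cnj)
  qed
  have single: "M (?J s u) = ?J s' (M u)" if i: "i \<in> I" and u: "u = of_coords (\<lambda>j. if j = i then x else 0)" for i x u
  proof (cases "i = e")
    case True
    have "?J s u = of_coords (\<lambda>j. if j = e then \<i> * x else 0)"
      by (rule eq_if_coord) (simp add: u True s_def)
    moreover have "M u = of_coords (\<lambda>j. if j = e' then - cnj x else 0)" using Me u True by simp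
    ultimately show ?thesis
      by (simp only: Me, intro eq_if_coord) (simp add: s'_def)
  next
    case False
    define \<tau> where "\<tau> = Im (\<omega> i)"
    have \<tau>: "\<tau> \<noteq> 0" using Im(1) i False by (simp add: \<tau>_def)
    have Bu: "?B \<omega> u = \<bar>\<tau>\<bar> *\<^sub>R ?J s u"
      by (rule eq_if_coord) (simp add: u \<tau>_def s_def False scaleR_conv_of_real[where 'a = complex] sgn_if abs_if)
    \<comment> \<open>As \<open>M\<close> intertwines the squares, \<open>M u\<close> has components
      only on lines where \<open>Im \<omega>'\<close> has the same absolute value as
      \<open>\<tau>\<close>. On these lines the multiplier is \<open>\<bar>\<tau>\<bar>\<close>
      times the complex structure of the target.\<close>
    have BBu: "?B \<omega> (?B \<omega> u) = (- \<tau>\<^sup>2) *\<^sub>R u"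
      by (rule eq_if_coord) (auto simp: u \<tau>_def complex_eq_iff power2_eq_square algebra_simps)
    have "?B \<omega>' (?B \<omega>' (M u)) = (- \<tau>\<^sup>2) *\<^sub>R M u"
      unfolding B[symmetric] BBu by (rule linear_cmul[OF M])
    then have BBM: "coord (?B \<omega>' (?B \<omega>' (M u))) j = coord ((- \<tau>\<^sup>2) *\<^sub>R M u) j" for j by simp
    have "of_real ((Im (\<omega>' j))\<^sup>2) * coord (M u) j = of_real (\<tau>\<^sup>2) * coord (M u) j" if "j \<in> I" for j
    proof -
      have "coord (?B \<omega>' (?B \<omega>' (M u))) j = - (of_real ((Im (\<omega>' j))\<^sup>2) * coord (M u) j)"
        using that by (simp add: complex_eq_iff power2_eq_square algebra_simps)
      then show ?thesis using BBM[of j] by (auto simp: scaleR_conv_of_real[where 'a = complex])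
    qed
    then have alt: "coord (M u) j = 0 \<or> \<bar>Im (\<omega>' j)\<bar> = \<bar>\<tau>\<bar>" if "j \<in> I" for j
      using that unfolding mult_cancel_right of_real_eq_iff power2_eq_iff by fastforce
    have "\<bar>\<tau>\<bar> *\<^sub>R ?J s' (M u) = ?B \<omega>' (M u)"
    proof (rule eq_if_coord)
      fix j assume j: "j \<in> I"
      show "coord (\<bar>\<tau>\<bar> *\<^sub>R ?J s' (M u)) j = coord (?B \<omega>' (M u)) j"
      proof (cases "coord (M u) j = 0")
        case False
        then have "\<bar>Im (\<omega>' j)\<bar> = \<bar>\<tau>\<bar>" using alt j by blast
        moreover from this have "j \<noteq> e'" using \<tau> one by auto
        ultimately have "\<bar>\<tau>\<bar> * s' j = Im (\<omega>' j)"
          by (auto simp: s'_def sgn_if)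
        then show ?thesis using j by (simp add: scaleR_conv_of_real[where 'a = complex] flip: of_real_mult)
      qed (use j in simp)
    qed
    also have "\<dots> = \<bar>\<tau>\<bar> *\<^sub>R M (?J s u)"
      unfolding B[symmetric] Bu by (rule linear_cmul[OF M])
    finally show ?thesis using \<tau> by simp
  qed
  have MJ: "M (?J s u) = ?J s' (M u)" for u
  proof -
    have u: "u = (\<Sum>i\<in>I. of_coords (\<lambda>j. if j = i then coord u i else 0))"
      by (rule eq_if_coord) (simp add: finite_I)
    show ?thesis
      by (subst (1 2) u) (simp add: linear_sum[OF M] linear_sum[OF linear_scale] single)
  qed
  \<comment> \<open>Conjugating in source and target turns both signed structures into the standard
    one, for which the composite is complex linear.\<close>
  let ?N = "conj_at s' \<circ> M \<circ> conj_at s" and ?J1 = "coord_scale (\<lambda>i. \<i>)"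
  have J1: "?J1 (?J1 u) = - u" for u
    by (rule eq_if_coord) (simp flip: mult.assoc)
  have CJ: "conj_at s (?J1 u) = ?J s (conj_at s u)" for u
    by (rule eq_if_coord) (use s in force)
  have CJ': "conj_at s' (?J s' u) = ?J1 (conj_at s' u)" for u
    by (rule eq_if_coord) (use s' in force)
  have linN: "linear ?N"
    by (intro linear_compose linear_conj_at M)
  have "0 \<le> det (matrix ?N)"
    by (rule det_complex_linear_nonneg[OF linN linear_scale J1]) (simp add: CJ MJ CJ')
  also have "det (matrix ?N) = (\<Prod>i\<in>I. s' i) * det (matrix M) * (\<Prod>i\<in>I. s i)"
    by (simp add: matrix_compose linear_compose linear_conj_at M det_mul det_conj_at s s')
  also have "(\<Prod>i\<in>I. s i) = (\<Prod>i\<in>I - {e}. sgn (Im (\<omega> i)))"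
    by (simp add: prod.remove[OF finite_I e(1)] s_def)
  also have "(\<Prod>i\<in>I. s' i) = - (\<Prod>i\<in>I - {e'}. sgn (Im (\<omega>' i)))"
    by (simp add: prod.remove[OF finite_I e(2)] s'_def)
  finally show ?thesis by (simp add: mult_ac)
qed

end

section \<open>Perturbations of the identity and one-dimensional inverses\<close>

text \<open>Banach's fixed point theorem for the map
  \<open>z \<mapsto> z - (\<phi> z - \<phi> a - u)\<close>. The bound on \<open>u\<close> keeps the
  ball invariant, since \<open>e * r + (1 - e) * r = r\<close>.\<close>

lemma perturbed_identity_surj:
  fixes \<phi> :: "'a::euclidean_space \<Rightarrow> 'a"
  assumes e: "0 \<le> e" "e < 1" and r: "0 \<le> r"
    and lip: "\<And>y z. y \<in> cball a r \<Longrightarrow> z \<in> cball a r \<Longrightarrow> norm (\<phi> y - \<phi> z - (y - z)) \<le> e * norm (y - z)"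
    and u: "norm u \<le> (1 - e) * r"
  shows "\<exists>z\<in>cball a r. \<phi> z = \<phi> a + u"
proof -
  define T where "T = (\<lambda>z. z - (\<phi> z - \<phi> a - u))"
  have "\<exists>!z\<in>cball a r. T z = z"
  proof (rule Banach_fix)
    show "complete (cball a r)" by (simp add: complete_eq_closed)
    show "T ` cball a r \<subseteq> cball a r"
    proof (clarify)
      fix z assume z: "z \<in> cball a r"
      have a: "a \<in> cball a r" using r by simp
      have "norm (T z - a) \<le> norm (\<phi> z - \<phi> a - (z - a)) + norm u"
        using norm_triangle_ineq4[of u "\<phi> z - \<phi> a - (z - a)"] by (simp add: T_def algebra_simps)
      also have "\<dots> \<le> e * norm (z - a) + (1 - e) * r" using lip[OF z a] u by linarith
      also have "\<dots> \<le> e * r + (1 - e) * r"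
        using z e by (intro add_right_mono mult_left_mono) (auto simp: dist_norm norm_minus_commute)
      finally show "T z \<in> cball a r" by (simp add: dist_norm norm_minus_commute algebra_simps)
    qed
    show "dist (T y) (T z) \<le> e * dist y z" if "y \<in> cball a r" "z \<in> cball a r" for y z
    proof -
      have "T y - T z = - (\<phi> y - \<phi> z - (y - z))" by (simp add: T_def)
      then show ?thesis using lip[OF that] by (simp only: dist_norm norm_minus_cancel)
    qed
  qed (use e r in auto)
  then obtain z where "z \<in> cball a r" "T z = z" by blast
  then show ?thesis by (intro bexI[of _ z]) (auto simp: T_def algebra_simps)
qed

text \<open>A Lebesgue number argument. The number \<open>d\<close> is both the radius of a
  neighbourhood and a parameter of the property; monotonicity permits the minimum over a finite
  cover.\<close>

lemma compact_uniform_radius: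
  fixes K :: "'a::metric_space set"
  assumes "compact K" "\<And>x. x \<in> K \<Longrightarrow> \<exists>d>0. \<forall>y\<in>ball x d. P y d"
    and mono: "\<And>y d d'. P y d \<Longrightarrow> 0 < d' \<Longrightarrow> d' \<le> d \<Longrightarrow> P y d'"
  shows "\<exists>d>0. \<forall>y\<in>K. P y (d::real)"
proof -
  obtain \<delta> where \<delta>: "\<And>x. x \<in> K \<Longrightarrow> \<delta> x > 0" "\<And>x y. x \<in> K \<Longrightarrow> y \<in> ball x (\<delta> x) \<Longrightarrow> P y (\<delta> x)"
    using assms(2) by metis
  have "K \<subseteq> (\<Union>x\<in>K. ball x (\<delta> x))" using \<delta>(1) by force
  then obtain C where C: "C \<subseteq> K" "finite C" "K \<subseteq> (\<Union>x\<in>C. ball x (\<delta> x))"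
    using compactE_image[OF \<open>compact K\<close>, of K "\<lambda>x. ball x (\<delta> x)"] by blast
  \<comment> \<open>The element 1 is inserted because \<open>C\<close> may be empty.\<close>
  define d where "d = Min (insert 1 (\<delta> ` C))"
  have d: "d > 0" "\<And>x. x \<in> C \<Longrightarrow> d \<le> \<delta> x"
  proof -
    have "finite (insert 1 (\<delta> ` C))" using C(2) by simp
    moreover have "\<delta> x > 0" if "x \<in> C" for x using C(1) \<delta>(1) that by blast
    ultimately show "d > 0" unfolding d_def by (subst Min_gr_iff) auto
    show "d \<le> \<delta> x" if "x \<in> C" for x unfolding d_def using C(2) that by simp
  qed
  have "P y d" if y: "y \<in> K" for y
  proof -
    obtain x where "x \<in> C" "y \<in> ball x (\<delta> x)" using subsetD[OF C(3) y] by blast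
    then have "P y (\<delta> x)" using \<delta>(2)[of x y] C(1) by auto
    then show ?thesis by (rule mono) (use d \<open>x \<in> C\<close> in auto)
  qed
  then show ?thesis using d(1) by blast
qed

text \<open>In dimension one a positive derivative gives monotonicity, hence an inverse on the whole
  interval. Its smoothness is bootstrapped from the formula for its derivative, the reciprocal of
  the derivative of \<open>f\<close> at the inverse point.\<close>

lemma smooth_inverse_real:
  fixes f :: "real \<Rightarrow> real"
  assumes f: "smooth_at f 0" and pos: "frechet_derivative f (at 0) 1 > 0" and "\<delta> > 0"
  obtains \<epsilon> \<tau> where "0 < \<epsilon>" "\<epsilon> \<le> \<delta>" "open (f ` {-\<epsilon><..<\<epsilon>})" "\<And>s. s \<in> {-\<epsilon><..<\<epsilon>} \<Longrightarrow> \<tau> (f s) = s"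
    "smooth_on (f ` {-\<epsilon><..<\<epsilon>}) \<tau>"
proof -
  let ?d = "\<lambda>s. frechet_derivative f (at s) 1"
  have "(?d \<longlongrightarrow> ?d 0) (nhds 0)"
    using smooth_at_isCont[OF smooth_at_deriv[OF f, of 1]]
    unfolding isCont_def by (rule tendsto_at_iff_tendsto_nhds[THEN iffD1])
  then have "\<forall>\<^sub>F s in nhds 0. ?d s > 0" using order_tendstoD(1) pos by blast
  then have "\<forall>\<^sub>F s in nhds 0. smooth_at f s \<and> ?d s > 0"
    using smooth_at_eventually[OF f] by eventually_elim auto
  then obtain \<epsilon>0 where \<epsilon>0: "\<epsilon>0 > 0" "\<And>s. dist s 0 < \<epsilon>0 \<Longrightarrow> smooth_at f s \<and> ?d s > 0"
    unfolding eventually_nhds_metric by blast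
  define \<epsilon> where "\<epsilon> = min \<epsilon>0 \<delta>"
  have \<epsilon>: "\<epsilon> > 0" "\<epsilon> \<le> \<delta>" "\<And>s. dist s 0 < \<epsilon> \<Longrightarrow> smooth_at f s \<and> ?d s > 0"
    using \<epsilon>0 \<open>\<delta> > 0\<close> by (auto simp: \<epsilon>_def)
  define I where "I = {-\<epsilon><..<\<epsilon>}"
  have I: "open I" "\<And>s. s \<in> I \<Longrightarrow> smooth_at f s" "\<And>s. s \<in> I \<Longrightarrow> ?d s > 0"
    using \<epsilon> by (auto simp: I_def dist_real_def)
  have smooth_I: "smooth_on I f" using smooth_on_if_smooth_at[OF I(1)] I(2) by blast
  have D: "(f has_derivative (\<lambda>v. ?d s * v)) (at s)" if "s \<in> I" for s
  proof -
    have "frechet_derivative f (at s) v = ?d s * v" for v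
      using linear_cmul[OF smooth_at_linear_deriv[OF I(2)[OF that]], of v 1] by simp
    then show ?thesis using smooth_at_has_derivative[OF I(2)[OF that]] by (metis ext)
  qed
  have cont: "continuous_on I f"
    using smooth_I unfolding smooth_on_def by (metis Ck_on.simps(1))
  have "f x < f y" if "x \<in> I" "y \<in> I" "x < y" for x y
  proof (rule DERIV_pos_imp_increasing[OF \<open>x < y\<close>])
    fix s assume "x \<le> s" "s \<le> y"
    then have "s \<in> I" using that by (auto simp: I_def)
    then show "\<exists>y. (f has_real_derivative y) (at s) \<and> 0 < y"
      using D I(3) has_field_derivative_def by blast
  qed
  then have inj: "inj_on f I" by (metis inj_onI less_irrefl linorder_less_linear)
  have op: "open (f ` I)" using invariance_of_domain[OF cont I(1) inj] .
  define \<tau> where "\<tau> = inv_into I f"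
  have \<tau>: "\<tau> (f s) = s" if "s \<in> I" for s
    using inj that by (simp add: \<tau>_def)
  have D\<tau>: "(\<tau> has_derivative (\<lambda>v. v *\<^sub>R inverse (?d (\<tau> y)))) (at y)" if y: "y \<in> f ` I" for y
  proof -
    obtain s where s: "s \<in> I" "y = f s" using y by blast
    have "(\<tau> has_derivative (\<lambda>v. v *\<^sub>R inverse (?d s))) (at (f s))"
      by (rule has_derivative_inverse_strong[OF I(1) s(1) cont \<tau> D[OF s(1)]])
         (use I(3)[OF s(1)] in \<open>auto simp: fun_eq_iff\<close>)
    then show ?thesis using s \<tau> by simp
  qed
  have "Ck_on k (f ` I) \<tau>" for k
  proof (induction k)
    case 0
    have "continuous (at y) \<tau>" if "y \<in> f ` I" for y
      using D\<tau>[OF that] by (rule has_derivative_continuous)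
    then show ?case by (simp add: continuous_at_imp_continuous_on)
  next
    case (Suc k)
    show ?case
    proof (rule Ck_on_Suc_intro[OF op D\<tau>])
      have d: "Ck_on k I ?d" using smooth_I unfolding smooth_on_def by (metis Ck_on.simps(2))
      have "Ck_on k (f ` I) (\<lambda>y. ?d (\<tau> y))"
        by (rule Ck_on_compose[OF op I(1) _ Suc d]) (use \<tau> in auto)
      have "Ck_on k (f ` I) (\<lambda>y. inverse (?d (\<tau> y)))"
      proof (rule Ck_on_compose[where f = "\<lambda>y. ?d (\<tau> y)" and g = inverse and T = "- {0}"])
        show "Ck_on k (f ` I) (\<lambda>y. ?d (\<tau> y))" by fact
        show "(\<lambda>y. ?d (\<tau> y)) ` f ` I \<subseteq> - {0}"
        proof
          fix x assume "x \<in> (\<lambda>y. ?d (\<tau> y)) ` f ` I"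
          then obtain s where "s \<in> I" "x = ?d (\<tau> (f s))" by blast
          then show "x \<in> - {0}" using \<tau> I(3)[of s] by simp
        qed
      qed (auto simp: op Ck_on_inverse)
      then show "Ck_on k (f ` I) (\<lambda>y. v *\<^sub>R inverse (?d (\<tau> y)))" for v
        by (intro Ck_on_linear_image[OF bounded_linear_scaleR_right op])
    qed
  qed
  then have "smooth_on (f ` I) \<tau>" by (simp add: smooth_on_def)
  then show ?thesis using that[OF \<epsilon>(1,2), of \<tau>] op \<tau> unfolding I_def by blast
qed


section \<open>The torus\<close>

text \<open>The linear form on the Lie algebra of the torus whose exponential is
  \<open>character a\<close>.\<close>

definition angle :: "int^'k \<Rightarrow> real^'k \<Rightarrow> real" where
  "angle a \<theta> = (\<Sum>i\<in>UNIV. of_int (a$i) * \<theta>$i)"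

lemma torus_exp_nth [simp]: "torus_exp \<theta> $ i = cis (\<theta> $ i)"
  by (simp add: torus_exp_def)

lemma torus_exp_carrier [simp]: "torus_exp \<theta> \<in> carrier torus"
  by (simp add: torus_def)

lemma torus_exp_surj:
  assumes "t \<in> carrier torus"
  obtains \<theta> where "t = torus_exp \<theta>" "\<And>i. 0 \<le> \<theta>$i" "\<And>i. \<theta>$i \<le> 2 * pi"
proof
  show "t = torus_exp (\<chi> i. Arg2pi (t$i))"
  proof -
    have "cis (Arg2pi z) = z" if "cmod z = 1" for z
      using Arg2pi_eq[of z] that by (simp add: cis_conv_exp)
    then show ?thesis using assms by (auto simp: vec_eq_iff torus_def)
  qed
  show "0 \<le> (\<chi> i. Arg2pi (t$i)) $ i" "(\<chi> i. Arg2pi (t$i)) $ i \<le> 2 * pi" for i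
    by (auto simp: Arg2pi_ge_0 less_imp_le[OF Arg2pi_lt_2pi])
qed

lemma torus_exp_add: "torus_exp (\<theta> + \<eta>) = torus_exp \<theta> * torus_exp \<eta>"
  by (simp add: vec_eq_iff cis_mult)

lemma torus_exp_0 [simp]: "torus_exp 0 = 1"
  by (simp add: vec_eq_iff)

lemma torus_exp_minus: "torus_exp (- \<theta>) * torus_exp \<theta> = 1" "torus_exp \<theta> * torus_exp (- \<theta>) = 1"
  by (simp_all flip: torus_exp_add)

lemma continuous_on_torus_exp: "continuous_on S torus_exp"
  unfolding torus_exp_def by (intro continuous_on_vec_lambda continuous_intros)

lemma torus_mult_closed: "s \<in> carrier torus \<Longrightarrow> t \<in> carrier torus \<Longrightarrow> s * t \<in> carrier torus"
  by (simp add: torus_def norm_mult)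

lemma torus_one_closed: "1 \<in> carrier torus"
  by (simp add: torus_def)

lemma torus_power_closed: "t \<in> carrier torus \<Longrightarrow> t ^ n \<in> carrier torus"
  by (induction n) (auto intro: torus_mult_closed torus_one_closed)

lemma compact_torus: "compact (carrier torus :: (complex^'k) set)"
proof -
  have "carrier torus = torus_exp ` cbox (0::real^'k) (\<chi> i. 2 * pi)"
  proof
    show "carrier torus \<subseteq> torus_exp ` cbox (0::real^'k) (\<chi> i. 2 * pi)"
    proof
      fix t :: "complex^'k" assume "t \<in> carrier torus"
      then obtain \<theta> where "t = torus_exp \<theta>" "\<And>i. 0 \<le> \<theta>$i" "\<And>i. \<theta>$i \<le> 2 * pi"
        using torus_exp_surj by blast
      then show "t \<in> torus_exp ` cbox (0::real^'k) (\<chi> i. 2 * pi)"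
        by (auto simp: mem_box_cart)
    qed
  qed auto
  then show ?thesis by (simp add: compact_continuous_image continuous_on_torus_exp)
qed

lemma angle_add: "angle a (\<theta> + \<eta>) = angle a \<theta> + angle a \<eta>"
  by (simp add: angle_def algebra_simps sum.distrib)

lemma angle_scaleR: "angle a (r *\<^sub>R \<theta>) = r * angle a \<theta>"
  by (simp add: angle_def sum_distrib_left mult_ac)

lemma angle_diff: "angle a (\<theta> - \<eta>) = angle a \<theta> - angle a \<eta>"
  by (simp add: angle_def algebra_simps sum_subtractf)

lemma angle_axis: "angle a (axis i r) = of_int (a$i) * r"
  by (simp add: angle_def axis_def if_distrib[of "\<lambda>x. _ * x"] cong: if_cong)

lemma angle_add_left: "angle (a + b) \<theta> = angle a \<theta> + angle b \<theta>"
  and angle_diff_left: "angle (a - b) \<theta> = angle a \<theta> - angle b \<theta>"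
  by (simp_all add: angle_def algebra_simps sum.distrib sum_subtractf)

lemma angle_cmul_left: "angle (c *s a) \<theta> = of_int c * angle a \<theta>"
  by (simp add: angle_def sum_distrib_left mult_ac)

lemma cis_sum: "finite S \<Longrightarrow> cis (\<Sum>i\<in>S. f i) = (\<Prod>i\<in>S. cis (f i))"
  by (induction S rule: finite_induct) (auto simp: cis_mult[symmetric])

lemma character_exp: "character a (torus_exp \<theta>) = cis (angle a \<theta>)"
  unfolding character_def angle_def by (simp add: cis_sum cis_power_int)

text \<open>The shifted cube is cut at the hyperplane where the \<open>i\<close>-th coordinate
  equals \<open>2 * pi\<close>; periodicity moves the protruding slab back into the vacated part of
  the cube.\<close>

lemma torus_integral_shift_axis:
  fixes f :: "real^'k \<Rightarrow> 'b::euclidean_space"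
  assumes cont: "continuous_on UNIV f"
    and per: "\<And>x. f (x + axis i (2 * pi)) = f x" and r: "0 \<le> r" "r \<le> 2 * pi"
  shows "integral (cbox 0 (\<chi> j. 2 * pi)) (\<lambda>x. f (x + axis i r)) = integral (cbox 0 (\<chi> j. 2 * pi)) f"
proof -
  let ?b = "(\<chi> j. 2 * pi) :: real^'k" and ?e = "axis i 1 :: real^'k"
  define b' :: "real^'k" where "b' = (\<chi> j. if j = i then r else 2 * pi)"
  have intg: "f integrable_on cbox c d" for c d
    using cont continuous_on_subset integrable_continuous by blast
  have e: "?e \<in> Basis" by simp
  have split: "integral (cbox c d) f = integral (cbox c (\<chi> j. if j = i then min (d$i) m else d$j)) f
      + integral (cbox (\<chi> j. if j = i then max (c$i) m else c$j) d) f" for c d m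
    using integral_split[OF intg e, of c d m]
    by (simp add: inner_axis interval_split_cart[unfolded interval_cbox_cart])
  have "integral (cbox 0 ?b) (\<lambda>x. f (x + axis i r)) = integral (cbox (axis i r) (?b + axis i r)) f"
    using integral_shift_cbox_plus[of 0 ?b f "axis i r"] by (simp add: o_def add.commute)
  also have "\<dots> = integral (cbox (axis i r) ?b) f + integral (cbox (0 + axis i (2 * pi)) (b' + axis i (2 * pi))) f"
  proof -
    have "(\<chi> j. if j = i then min ((?b + axis i r)$i) (2 * pi) else (?b + axis i r)$j) = ?b"
      "(\<chi> j. if j = i then max (axis i r $ i) (2 * pi) else axis i r $ j) = 0 + axis i (2 * pi)"
      "?b + axis i r = b' + axis i (2 * pi)"
      using r by (auto simp: vec_eq_iff axis_def b'_def)
    then show ?thesis using split[of "axis i r" "?b + axis i r" "2 * pi"] by simp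
  qed
  also have "integral (cbox (0 + axis i (2 * pi)) (b' + axis i (2 * pi))) f = integral (cbox 0 b') f"
    unfolding integral_shift_cbox_plus[symmetric] using per by (simp add: o_def add.commute)
  also have "integral (cbox (axis i r) ?b) f + integral (cbox 0 b') f = integral (cbox 0 ?b) f"
  proof -
    have "(\<chi> j. if j = i then min (?b$i) r else ?b$j) = b'"
      "(\<chi> j. if j = i then max ((0::real^'k)$i) r else 0$j) = axis i r"
      using r by (auto simp: vec_eq_iff axis_def b'_def)
    then show ?thesis using split[of 0 ?b r] by simp
  qed
  finally show ?thesis .
qed

text \<open>The integral over the cube is the Haar integral. The shift is replaced by one with
  coordinates between 0 and \<open>2 * pi\<close>, which is then carried out one axis at a
  time.\<close>

lemma torus_integral_shift:
  fixes f :: "real^'k \<Rightarrow> 'b::euclidean_space"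
  assumes cont: "continuous_on UNIV f"
    and per: "\<And>x y. torus_exp x = torus_exp y \<Longrightarrow> f x = f y"
  shows "integral (cbox 0 (\<chi> j. 2 * pi)) (\<lambda>x. f (x + \<eta>)) = integral (cbox 0 (\<chi> j. 2 * pi)) f"
proof -
  obtain \<eta>' where \<eta>': "torus_exp \<eta> = torus_exp \<eta>'" "\<And>i. 0 \<le> \<eta>'$i" "\<And>i. \<eta>'$i \<le> 2 * pi"
    using torus_exp_surj torus_exp_carrier by metis
  have "integral (cbox 0 (\<chi> j. 2 * pi)) (\<lambda>x. f (x + (\<Sum>i\<in>S. axis i (\<eta>'$i)))) = integral (cbox 0 (\<chi> j. 2 * pi)) f"
    if "finite S" for S
    using that
  proof (induction S rule: finite_induct)
    case (insert i S)
    let ?g = "\<lambda>x. f (x + (\<Sum>i\<in>S. axis i (\<eta>'$i)))"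
    have "integral (cbox 0 (\<chi> j. 2 * pi)) (\<lambda>x. ?g (x + axis i (\<eta>'$i))) = integral (cbox 0 (\<chi> j. 2 * pi)) ?g"
    proof (rule torus_integral_shift_axis[OF _ _ \<eta>'(2,3)])
      show "continuous_on UNIV ?g"
        by (intro continuous_on_compose2[OF cont] continuous_intros) auto
      show "?g (x + axis i (2 * pi)) = ?g x" for x
        by (rule per) (simp add: vec_eq_iff axis_def flip: cis_mult)
    qed
    then show ?case using insert by (simp add: algebra_simps)
  qed simp
  note partial = this
  have "integral (cbox 0 (\<chi> j. 2 * pi)) (\<lambda>x. f (x + \<eta>')) = integral (cbox 0 (\<chi> j. 2 * pi)) f"
  proof -
    have "(\<Sum>i\<in>UNIV. axis i (\<eta>'$i)) = \<eta>'" by (simp add: vec_eq_iff axis_def)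
    then show ?thesis using partial[of UNIV] by simp
  qed
  moreover have "f (x + \<eta>) = f (x + \<eta>')" for x
    by (rule per) (simp add: torus_exp_add \<eta>'(1))
  ultimately show ?thesis by simp
qed


section \<open>Trigonometric polynomials and Fourier coefficients\<close>

inductive trig_poly :: "(real^'k \<Rightarrow> real) \<Rightarrow> bool" where
  cos: "trig_poly (\<lambda>\<theta>. c * cos (angle w \<theta>))"
| sin: "trig_poly (\<lambda>\<theta>. c * sin (angle w \<theta>))"
| add: "trig_poly p \<Longrightarrow> trig_poly q \<Longrightarrow> trig_poly (\<lambda>\<theta>. p \<theta> + q \<theta>)"

text \<open>The product-to-sum formulas replace a product of two waves by waves of frequencies
  \<open>v + w\<close> and \<open>v - w\<close>.\<close>

lemma trig_poly_mult_wave: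
  assumes "trig_poly p"
  shows "trig_poly (\<lambda>\<theta>. p \<theta> * (c * cos (angle w \<theta>)))" "trig_poly (\<lambda>\<theta>. p \<theta> * (c * sin (angle w \<theta>)))"
  using assms
proof (induction p rule: trig_poly.induct)
  case (cos d v)
  { case 1
    have "(\<lambda>\<theta>. d * cos (angle v \<theta>) * (c * cos (angle w \<theta>)))
      = (\<lambda>\<theta>. (c * d / 2) * cos (angle (v - w) \<theta>) + (c * d / 2) * cos (angle (v + w) \<theta>))"
      by (simp add: fun_eq_iff angle_add_left angle_diff_left cos_add cos_diff field_simps)
    then show ?case by (simp only: trig_poly.intros)
  next
    case 2
    have "(\<lambda>\<theta>. d * cos (angle v \<theta>) * (c * sin (angle w \<theta>)))
      = (\<lambda>\<theta>. (c * d / 2) * sin (angle (v + w) \<theta>) + (- (c * d / 2)) * sin (angle (v - w) \<theta>))"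
      by (simp add: fun_eq_iff angle_add_left angle_diff_left sin_add sin_diff field_simps)
    then show ?case by (simp only: trig_poly.intros)
  }
next
  case (sin d v)
  { case 1
    have "(\<lambda>\<theta>. d * sin (angle v \<theta>) * (c * cos (angle w \<theta>)))
      = (\<lambda>\<theta>. (c * d / 2) * sin (angle (v + w) \<theta>) + (c * d / 2) * sin (angle (v - w) \<theta>))"
      by (simp add: fun_eq_iff angle_add_left angle_diff_left sin_add sin_diff field_simps)
    then show ?case by (simp only: trig_poly.intros)
  next
    case 2
    have "(\<lambda>\<theta>. d * sin (angle v \<theta>) * (c * sin (angle w \<theta>)))
      = (\<lambda>\<theta>. (c * d / 2) * cos (angle (v - w) \<theta>) + (- (c * d / 2)) * cos (angle (v + w) \<theta>))"
      by (simp add: fun_eq_iff angle_add_left angle_diff_left cos_add cos_diff field_simps)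
    then show ?case by (simp only: trig_poly.intros)
  }
next
  case (add p q)
  { case 1 show ?case using trig_poly.add[OF add.IH(1) add.IH(3)] by (simp add: distrib_right)
  next case 2 show ?case using trig_poly.add[OF add.IH(2) add.IH(4)] by (simp add: distrib_right) }
qed

lemma trig_poly_mult: "trig_poly q \<Longrightarrow> trig_poly p \<Longrightarrow> trig_poly (\<lambda>\<theta>. p \<theta> * q \<theta>)"
proof (induction q rule: trig_poly.induct)
  case (add q r)
  then show ?case using trig_poly.add[OF add.IH(1) add.IH(2)] by (simp add: distrib_left)
qed (auto intro: trig_poly_mult_wave)

lemma trig_poly_const: "trig_poly (\<lambda>\<theta>. c)"
  using trig_poly.cos[of c 0] by (simp add: angle_def)

lemma trig_poly_sum: "finite S \<Longrightarrow> (\<And>i. i \<in> S \<Longrightarrow> trig_poly (p i)) \<Longrightarrow> trig_poly (\<lambda>\<theta>. \<Sum>i\<in>S. p i \<theta>)"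
  by (induction S rule: finite_induct) (auto intro: trig_poly_const trig_poly.add)

text \<open>The link to the Stone-Weierstrass theorem, which approximates by polynomial functions on
  the ambient space of the torus.\<close>

lemma trig_poly_polynomial:
  fixes p :: "complex^'k \<Rightarrow> real"
  assumes "real_polynomial_function p"
  shows "trig_poly (\<lambda>\<theta>. p (torus_exp \<theta>))"
  using assms
proof (induction p rule: real_polynomial_function.induct)
  case (linear h)
  interpret bounded_linear h by (rule linear)
  have "h (torus_exp \<theta>) = (\<Sum>i\<in>UNIV. h (axis i 1) * cos (angle (axis i 1) \<theta>) + h (axis i \<i>) * sin (angle (axis i 1) \<theta>))" for \<theta>
  proof -
    have "torus_exp \<theta> = (\<Sum>i\<in>UNIV. cos (\<theta>$i) *\<^sub>R axis i 1 + sin (\<theta>$i) *\<^sub>R axis i \<i>)"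
      by (simp add: vec_eq_iff axis_def sum.distrib if_distrib[of "\<lambda>x. _ *\<^sub>R x"] complex_eq_iff cong: if_cong)
    moreover have "angle (axis i 1) \<theta> = \<theta>$i" for i
      by (simp add: angle_def axis_def if_distrib[of of_int] if_distrib[of "\<lambda>x. x * _"] cong: if_cong)
    ultimately show ?thesis by (simp add: sum add scaleR mult.commute)
  qed
  then show ?case
    by (simp add: trig_poly_sum trig_poly.intros)
qed (auto intro: trig_poly_const trig_poly.add trig_poly_mult)

lemma continuous_on_angle [continuous_intros]:
  "continuous_on S f \<Longrightarrow> continuous_on S (\<lambda>x. angle a (f x))"
  unfolding angle_def by (intro continuous_intros)

text \<open>All trigonometric polynomials are orthogonal to \<open>f\<close>, and some of them are
  uniformly \<open>e\<close>-close to it. Hence the integral of the square of \<open>f\<close> is at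
  most \<open>e\<close> times that of its absolute value, for every \<open>e\<close>, and
  \<open>f\<close> vanishes. The value at 1 is the value at the corner 0 of the cube.\<close>

lemma fourier_uniqueness:
  fixes f :: "complex^'k \<Rightarrow> real"
  assumes cont: "continuous_on (carrier torus) f"
    and cos: "\<And>w. integral (cbox 0 (\<chi> j. 2 * pi)) (\<lambda>\<theta>. cos (angle w \<theta>) * f (torus_exp \<theta>)) = 0"
    and sin: "\<And>w. integral (cbox 0 (\<chi> j. 2 * pi)) (\<lambda>\<theta>. sin (angle w \<theta>) * f (torus_exp \<theta>)) = 0"
  shows "f 1 = 0"
proof -
  let ?Q = "cbox 0 (\<chi> j. 2 * pi) :: (real^'k) set" and ?F = "\<lambda>\<theta>. f (torus_exp \<theta>)"
  have F: "continuous_on UNIV ?F"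
    by (rule continuous_on_compose2[OF cont continuous_on_torus_exp]) auto
  have intg: "g integrable_on ?Q" if "continuous_on UNIV g" for g :: "real^'k \<Rightarrow> real"
    using that continuous_on_subset integrable_continuous by blast
  have trig: "continuous_on UNIV p \<and> integral ?Q (\<lambda>\<theta>. p \<theta> * ?F \<theta>) = 0" if "trig_poly p" for p
    using that
  proof (induction p rule: trig_poly.induct)
    case (cos c w)
    then show ?case using assms(2)[of w]
      by (auto simp: mult.assoc intro!: continuous_intros)
  next
    case (sin c w)
    then show ?case using assms(3)[of w]
      by (auto simp: mult.assoc intro!: continuous_intros)
  next
    case (add p q)
    then show ?case
      by (auto simp: distrib_right integral_add intg F continuous_on_mult continuous_on_add)
  qed
  have bound: "integral ?Q (\<lambda>\<theta>. ?F \<theta> * ?F \<theta>) \<le> e * integral ?Q (\<lambda>\<theta>. \<bar>?F \<theta>\<bar>)" if "e > 0" for e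
  proof -
    obtain p where p: "real_polynomial_function p" "\<And>t. t \<in> carrier torus \<Longrightarrow> \<bar>f t - p t\<bar> < e"
      using Stone_Weierstrass_real_polynomial_function[OF compact_torus cont \<open>e > 0\<close>] by metis
    let ?P = "\<lambda>\<theta>. p (torus_exp \<theta>)"
    have P: "continuous_on UNIV ?P" "integral ?Q (\<lambda>\<theta>. ?P \<theta> * ?F \<theta>) = 0"
      using trig[OF trig_poly_polynomial[OF p(1)]] by auto
    have "integral ?Q (\<lambda>\<theta>. ?F \<theta> * ?F \<theta>) = integral ?Q (\<lambda>\<theta>. ?F \<theta> * ?F \<theta> - ?P \<theta> * ?F \<theta>)"
      using P by (subst integral_diff) (auto intro!: intg continuous_intros F)
    also have "\<dots> \<le> integral ?Q (\<lambda>\<theta>. e * \<bar>?F \<theta>\<bar>)"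
    proof (rule integral_le)
      fix \<theta>
      have "?F \<theta> * ?F \<theta> - ?P \<theta> * ?F \<theta> \<le> \<bar>?F \<theta> - ?P \<theta>\<bar> * \<bar>?F \<theta>\<bar>"
        by (metis abs_ge_self abs_mult left_diff_distrib)
      also have "\<dots> \<le> e * \<bar>?F \<theta>\<bar>"
        using p(2)[of "torus_exp \<theta>"] by (intro mult_right_mono) auto
      finally show "?F \<theta> * ?F \<theta> - ?P \<theta> * ?F \<theta> \<le> e * \<bar>?F \<theta>\<bar>" .
    qed (auto intro!: intg continuous_intros F P)
    finally show ?thesis by simp
  qed
  have "integral ?Q (\<lambda>\<theta>. ?F \<theta> * ?F \<theta>) \<le> 0"
  proof (rule field_le_epsilon)
    fix e :: real assume e: "e > 0"
    let ?C = "integral ?Q (\<lambda>\<theta>. \<bar>?F \<theta>\<bar>)"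
    have "?C \<ge> 0" by (rule integral_nonneg) (auto intro!: intg continuous_intros F)
    then have "e / (?C + 1) * ?C \<le> e" using e by (simp add: field_simps)
    moreover have "e / (?C + 1) > 0" using e \<open>?C \<ge> 0\<close> by simp
    ultimately show "integral ?Q (\<lambda>\<theta>. ?F \<theta> * ?F \<theta>) \<le> 0 + e"
      using bound[of "e / (?C + 1)"] by simp
  qed
  moreover have "integral ?Q (\<lambda>\<theta>. ?F \<theta> * ?F \<theta>) \<ge> 0"
    by (rule integral_nonneg) (auto intro!: intg continuous_intros F)
  ultimately have "integral ?Q (\<lambda>\<theta>. ?F \<theta> * ?F \<theta>) = 0" by simp
  moreover have "box 0 (\<chi> j. 2 * pi) \<noteq> ({} :: (real^'k) set)"
    by (auto simp: box_ne_empty inner_axis Basis_vec_def)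
  moreover have "continuous_on ?Q (\<lambda>\<theta>. ?F \<theta> * ?F \<theta>)"
    using F continuous_on_subset by (intro continuous_intros) blast+
  moreover have "0 \<in> ?Q" by (simp add: mem_box_cart)
  ultimately show ?thesis
    using integral_cbox_eq_0_iff[of 0 "(\<chi> j. 2 * pi) :: real^'k" "\<lambda>\<theta>. ?F \<theta> * ?F \<theta>"] by force
qed

section \<open>Integer vectors as characters and cocharacters; generic torsion elements\<close>

definition idot :: "int^'k \<Rightarrow> int^'k \<Rightarrow> int" where
  "idot a b = (\<Sum>i\<in>UNIV. a$i * b$i)"

lemma idot_simps:
  "idot a (b + c) = idot a b + idot a c" "idot a (b - c) = idot a b - idot a c"
  "idot (b + c) a = idot b a + idot c a" "idot (b - c) a = idot b a - idot c a"
  "idot a (r *s b) = r * idot a b" "idot (r *s b) a = r * idot b a" "idot 0 a = 0"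
  by (simp_all add: idot_def algebra_simps sum.distrib sum_subtractf sum_distrib_left)

lemma idot_commute: "idot a b = idot b a"
  by (simp add: idot_def mult.commute)

lemma idot_self_eq_0: "idot a a = 0 \<longleftrightarrow> a = 0"
  unfolding idot_def by (subst sum_nonneg_eq_0_iff) (auto simp: vec_eq_iff)

text \<open>The vector \<open>b\<close> is a rational multiple of \<open>a\<close>. The zero vector
  is included, since only \<open>r\<close> has to be nonzero.\<close>

definition proportional :: "int^'k \<Rightarrow> int^'k \<Rightarrow> bool" where
  "proportional a b \<longleftrightarrow> (\<exists>r s. r \<noteq> 0 \<and> r *s b = s *s a)"

text \<open>Gram-Schmidt orthogonalization of \<open>z\<close> against \<open>a\<close> with
  denominators cleared. If \<open>z\<close> were orthogonal to the result, the result would be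
  orthogonal to itself.\<close>

lemma orthogonal_separates:
  assumes "\<not> proportional a z" "a \<noteq> 0"
  shows "\<exists>\<xi>. idot a \<xi> = 0 \<and> idot z \<xi> \<noteq> 0"
proof (intro exI conjI)
  let ?\<xi> = "idot a a *s z - idot a z *s a"
  show a: "idot a ?\<xi> = 0" by (simp add: idot_simps)
  show "idot z ?\<xi> \<noteq> 0"
  proof
    assume "idot z ?\<xi> = 0"
    then have "idot ?\<xi> ?\<xi> = 0"
      using a by (metis (no_types, lifting) idot_commute idot_simps(2,5) mult_zero_right diff_zero)
    then have "idot a a *s z = idot a z *s a" unfolding idot_self_eq_0 by simp
    then show False using assms idot_self_eq_0 unfolding proportional_def by metis
  qed
qed

text \<open>If the vector \<open>\<xi>\<close> found so far is orthogonal to the new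
  \<open>z\<close>, it is replaced by \<open>N *s \<xi> + \<eta>\<close>, where
  \<open>\<eta>\<close> separates \<open>z\<close> from \<open>a\<close>. As \<open>N\<close>
  exceeds all \<open>\<bar>idot y \<eta>\<bar>\<close>, nonzero values at the earlier
  \<open>y\<close> cannot be cancelled.\<close>

lemma generic_orthogonal:
  assumes "finite Z" "a \<noteq> 0" "\<And>z. z \<in> Z \<Longrightarrow> \<not> proportional a z"
  shows "\<exists>\<xi>. idot a \<xi> = 0 \<and> (\<forall>z\<in>Z. idot z \<xi> \<noteq> 0)"
  using assms(1,3)
proof (induction Z rule: finite_induct)
  case empty
  then show ?case by (auto intro: exI[of _ 0] simp: idot_def)
next
  case (insert z Z)
  then obtain \<xi> where \<xi>: "idot a \<xi> = 0" "\<And>z. z \<in> Z \<Longrightarrow> idot z \<xi> \<noteq> 0" by auto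
  obtain \<eta> where \<eta>: "idot a \<eta> = 0" "idot z \<eta> \<noteq> 0"
    using orthogonal_separates insert.prems \<open>a \<noteq> 0\<close> by blast
  show ?case
  proof (cases "idot z \<xi> = 0")
    case True
    define N where "N = 1 + (\<Sum>y\<in>Z. \<bar>idot y \<eta>\<bar>)"
    have "idot y (N *s \<xi> + \<eta>) \<noteq> 0" if "y \<in> Z" for y
    proof
      assume "idot y (N *s \<xi> + \<eta>) = 0"
      then have "\<bar>N\<bar> * \<bar>idot y \<xi>\<bar> = \<bar>idot y \<eta>\<bar>"
        by (simp add: idot_simps abs_mult[symmetric] abs_minus_commute add_eq_0_iff2)
      moreover have "\<bar>idot y \<eta>\<bar> < N"
        unfolding N_def using member_le_sum[OF that, of "\<lambda>y. \<bar>idot y \<eta>\<bar>"] insert.hyps(1) by simp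
      moreover have "\<bar>N\<bar> * 1 \<le> \<bar>N\<bar> * \<bar>idot y \<xi>\<bar>"
        using \<xi>(2)[OF that] by (intro mult_left_mono) auto
      ultimately show False by linarith
    qed
    then show ?thesis
      using \<xi>(1) \<eta> True by (intro exI[of _ "N *s \<xi> + \<eta>"]) (auto simp: idot_simps)
  qed (use \<xi> in auto)
qed

text \<open>Take the exponential of \<open>pi * \<xi> / N\<close> for a generic integer vector
  \<open>\<xi>\<close> orthogonal to \<open>a\<close>. A character \<open>b\<close> then has the
  angle \<open>pi * idot b \<xi> / N\<close>. Since \<open>N\<close> exceeds all
  \<open>\<bar>idot z \<xi>\<bar>\<close>, the angles belonging to \<open>Z\<close> are nonzero and
  strictly between \<open>- pi\<close> and \<open>pi\<close>. The denominator \<open>N\<close> gives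
  an order dividing \<open>2 * N\<close>.\<close>

lemma generic_torsion_element:
  assumes "finite Z" "a \<noteq> 0" "\<And>z. z \<in> Z \<Longrightarrow> \<not> proportional a z"
  obtains g n where "g \<in> carrier torus" "n > 0" "g ^ n = 1"
    "\<And>b. proportional a b \<Longrightarrow> character b g = 1" "\<And>z. z \<in> Z \<Longrightarrow> Im (character z g) \<noteq> 0"
proof -
  obtain \<xi> where \<xi>: "idot a \<xi> = 0" "\<And>z. z \<in> Z \<Longrightarrow> idot z \<xi> \<noteq> 0"
    using generic_orthogonal[OF assms] by blast
  define N where "N = 1 + (\<Sum>z\<in>Z. \<bar>idot z \<xi>\<bar>)"
  have N: "N > 0" unfolding N_def by (simp add: add_pos_nonneg sum_nonneg)
  define \<theta> :: "real^'a" where "\<theta> = (\<chi> i. pi * of_int (\<xi>$i) / of_int N)"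
  have angle: "angle b \<theta> = pi * of_int (idot b \<xi>) / of_int N" for b
    by (simp add: angle_def idot_def \<theta>_def sum_distrib_left sum_divide_distrib mult_ac)
  show ?thesis
  proof
    show "torus_exp \<theta> \<in> carrier torus" by simp
    show "2 * nat N > 0" using N by simp
    show "torus_exp \<theta> ^ (2 * nat N) = 1"
    proof -
      have "(torus_exp \<theta> ^ j) $ i = (torus_exp \<theta> $ i) ^ j" for i j
        by (induction j) auto
      moreover have "real (2 * nat N) * (\<theta> $ i) = 2 * pi * of_int (\<xi>$i)" for i
        using N by (simp add: \<theta>_def)
      ultimately have "(torus_exp \<theta> ^ (2 * nat N)) $ i = cis (2 * pi * of_int (\<xi>$i))" for i
        by (simp only: torus_exp_nth Complex.DeMoivre)
      then show ?thesis by (simp add: vec_eq_iff cis_multiple_2pi)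
    qed
    show "character b (torus_exp \<theta>) = 1" if pr: "proportional a b" for b
    proof -
      obtain r s where "r \<noteq> 0" "r *s b = s *s a" using pr unfolding proportional_def by blast
      then have "r * idot b \<xi> = s * idot a \<xi>" by (metis idot_simps(6))
      then show ?thesis using \<xi>(1) \<open>r \<noteq> 0\<close> by (simp add: character_exp angle)
    qed
    show "Im (character z (torus_exp \<theta>)) \<noteq> 0" if z: "z \<in> Z" for z
    proof -
      have "\<bar>idot z \<xi>\<bar> < N"
        unfolding N_def using member_le_sum[OF z, of "\<lambda>y. \<bar>idot y \<xi>\<bar>"] assms(1) by simp
      define x where "x = angle z \<theta>"
      have "\<bar>x\<bar> = pi * (\<bar>of_int (idot z \<xi>)\<bar> / of_int N)"
        using N by (simp add: x_def angle abs_mult)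
      moreover have "\<bar>real_of_int (idot z \<xi>)\<bar> / of_int N < 1"
        using \<open>\<bar>idot z \<xi>\<bar> < N\<close> N by simp
      ultimately have "\<bar>x\<bar> < pi * 1"
        by (simp only:) (intro mult_strict_left_mono, simp_all)
      moreover have "x \<noteq> 0"
        using \<xi>(2)[OF z] N by (simp add: x_def angle)
      ultimately have "sin x \<noteq> 0" using sin_gt_zero[of x] sin_gt_zero[of "- x"] by (cases "x > 0") auto
      then show ?thesis by (simp add: character_exp x_def)
    qed
  qed
qed

section \<open>Torus actions in charts\<close>

definition cinv :: "('a, 'e) chart \<Rightarrow> 'e \<Rightarrow> 'a" where
  "cinv c = inv_into (fst c) (snd c)"

lemma isCont_nhds: "isCont f x \<Longrightarrow> filterlim f (nhds (f x)) (nhds x)"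
  unfolding isCont_def by (rule tendsto_at_iff_tendsto_nhds[THEN iffD1])

lemma eventually_compose_isCont:
  "eventually P (nhds (f x)) \<Longrightarrow> isCont f x \<Longrightarrow> \<forall>\<^sub>F y in nhds x. P (f y)"
  by (rule eventually_compose_filterlim[OF _ isCont_nhds])

text \<open>The action is smooth with respect to the given atlas \<open>A\<close>, while the
  orientation is carried by a second, compatible atlas \<open>B\<close>. Both are used together, and
  determinants are compared only between charts of \<open>B\<close>.\<close>

locale oriented_torus_manifold =
  fixes X :: "'a topology" and A B :: "('a, real^'m) chart set" and act :: "complex^'k \<Rightarrow> 'a \<Rightarrow> 'a"
  assumes hausdorff: "Hausdorff_space X"
    and atlas_A: "smooth_atlas X A" and atlas_B: "smooth_atlas X B" and atlas: "smooth_atlas X (A \<union> B)"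
    and oriented: "\<And>c d y. c \<in> B \<Longrightarrow> d \<in> B \<Longrightarrow> y \<in> snd c ` (fst c \<inter> fst d) \<Longrightarrow>
      det (matrix (frechet_derivative (transition c d) (at y))) > 0"
    and action: "smooth_effective_torus_action X A act"
begin

abbreviation charts :: "('a, real^'m) chart set" where "charts \<equiv> A \<union> B"

lemma is_chart: "c \<in> charts \<Longrightarrow> is_chart X c"
  using atlas unfolding smooth_atlas_def by blast

lemma chart_open: "c \<in> charts \<Longrightarrow> openin X (fst c)"
  and chart_image_open: "c \<in> charts \<Longrightarrow> open (snd c ` fst c)"
  and chart_homeo: "c \<in> charts \<Longrightarrow>
    homeomorphic_map (subtopology X (fst c)) (top_of_set (snd c ` fst c)) (snd c)"
  using is_chart[of c] by (auto simp: is_chart_def split: prod.splits)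

lemma chart_subset: "c \<in> charts \<Longrightarrow> p \<in> fst c \<Longrightarrow> p \<in> topspace X"
  using chart_open openin_subset by blast

lemma ex_chart_A: "p \<in> topspace X \<Longrightarrow> \<exists>c\<in>A. p \<in> fst c"
  using atlas_A unfolding smooth_atlas_def by blast

lemma ex_chart_B: "p \<in> topspace X \<Longrightarrow> \<exists>c\<in>B. p \<in> fst c"
  using atlas_B unfolding smooth_atlas_def by blast

lemma chart_inj: "c \<in> charts \<Longrightarrow> inj_on (snd c) (fst c)"
  using homeomorphic_imp_injective_map[OF chart_homeo] chart_subset
  by (metis (no_types, lifting) Int_absorb1 subsetI topspace_subtopology)

lemma cinv_chart [simp]: "c \<in> charts \<Longrightarrow> p \<in> fst c \<Longrightarrow> cinv c (snd c p) = p"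
  by (simp add: cinv_def chart_inj)

lemma chart_cinv: "y \<in> snd c ` fst c \<Longrightarrow> snd c (cinv c y) = y" "y \<in> snd c ` fst c \<Longrightarrow> cinv c y \<in> fst c"
  by (auto simp: cinv_def f_inv_into_f inv_into_into)

lemma chart_continuous: "c \<in> charts \<Longrightarrow> continuous_map (subtopology X (fst c)) euclidean (snd c)"
  using homeomorphic_imp_continuous_map[OF chart_homeo] continuous_map_in_subtopology by blast

lemma cinv_continuous:
  assumes "c \<in> charts"
  shows "continuous_map (top_of_set (snd c ` fst c)) X (cinv c)"
proof -
  obtain g where g: "homeomorphic_maps (subtopology X (fst c)) (top_of_set (snd c ` fst c)) (snd c) g"
    using chart_homeo[OF assms] homeomorphic_map_maps by blast
  then have cont: "continuous_map (top_of_set (snd c ` fst c)) X g"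
    unfolding homeomorphic_maps_def continuous_map_in_subtopology by blast
  have "g y = cinv c y" if y: "y \<in> snd c ` fst c" for y
  proof -
    have "g (snd c p) = p" if "p \<in> fst c" for p
      using g that chart_subset[OF assms that] unfolding homeomorphic_maps_def by simp
    then show ?thesis using y assms by auto
  qed
  then show ?thesis using continuous_map_eq[OF cont] by simp
qed

lemma eventually_chart:
  assumes c: "c \<in> charts" and p: "p \<in> fst c" and W: "openin X W" "p \<in> W"
  shows "\<forall>\<^sub>F y in nhds (snd c p). y \<in> snd c ` fst c \<and> cinv c y \<in> W"
proof -
  have "openin (top_of_set (snd c ` fst c)) {y \<in> snd c ` fst c. cinv c y \<in> W}"
    using openin_continuous_map_preimage[OF cinv_continuous[OF c] W(1)] by simp
  then have "open {y \<in> snd c ` fst c. cinv c y \<in> W}"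
    using chart_image_open[OF c] openin_open_trans by blast
  then show ?thesis unfolding eventually_nhds
    using p W(2) c by (intro exI[of _ "{y \<in> snd c ` fst c. cinv c y \<in> W}"]) auto
qed

lemma openin_chart_preimage:
  assumes c: "c \<in> charts" and S: "open S"
  shows "openin X {p \<in> fst c. snd c p \<in> S}"
proof -
  have "openin (subtopology X (fst c)) {p \<in> topspace (subtopology X (fst c)). snd c p \<in> S}"
    using openin_continuous_map_preimage[OF chart_continuous[OF c]] S by auto
  then have "openin X {p \<in> topspace (subtopology X (fst c)). snd c p \<in> S}"
    using chart_open[OF c] openin_trans_full by blast
  moreover have "{p \<in> topspace (subtopology X (fst c)). snd c p \<in> S} = {p \<in> fst c. snd c p \<in> S}"
    using chart_subset[OF c] by auto
  ultimately show ?thesis by simp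
qed

lemma smooth_transition:
  assumes c: "c \<in> charts" "d \<in> charts" and p: "p \<in> fst c" "p \<in> fst d"
  shows "smooth_at (\<lambda>y. snd d (cinv c y)) (snd c p)"
proof -
  have sm: "smooth_on (snd c ` (fst c \<inter> fst d)) (\<lambda>y. snd d (cinv c y))"
    using atlas c unfolding smooth_atlas_def transition_def cinv_def o_def by blast
  obtain S where S: "open S" "snd c p \<in> S" "\<And>y. y \<in> S \<Longrightarrow> y \<in> snd c ` fst c \<and> cinv c y \<in> fst d"
    using eventually_chart[OF c(1) p(1) chart_open[OF c(2)] p(2)] unfolding eventually_nhds by blast
  have "S \<subseteq> snd c ` (fst c \<inter> fst d)"
  proof
    fix y assume "y \<in> S"
    then show "y \<in> snd c ` (fst c \<inter> fst d)"
      using S(3)[of y] chart_cinv[of y c] by (intro image_eqI[of _ _ "cinv c y"]) auto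
  qed
  then show ?thesis using smooth_atI[OF sm S(1)] S(2) by blast
qed

lemma faithful: "faithful_action torus (topspace X) act"
  using action unfolding smooth_effective_torus_action_def by blast

lemma act_bij: "t \<in> carrier torus \<Longrightarrow> bij_betw (act t) (topspace X) (topspace X)"
proof -
  interpret faithful_action torus "topspace X" act by (rule faithful)
  show "t \<in> carrier torus \<Longrightarrow> bij_betw (act t) (topspace X) (topspace X)"
    using bij_prop0 by (simp add: Bij_def)
qed

lemma act_closed: "t \<in> carrier torus \<Longrightarrow> p \<in> topspace X \<Longrightarrow> act t p \<in> topspace X"
  using act_bij bij_betwE by blast

lemma act_mult:
  assumes "s \<in> carrier torus" "t \<in> carrier torus" "p \<in> topspace X"
  shows "act (s * t) p = act s (act t p)"
proof -
  interpret faithful_action torus "topspace X" act by (rule faithful)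
  have "s * t = s \<otimes>\<^bsub>torus\<^esub> t" by (simp add: torus_def)
  then show ?thesis using composition_rule[OF assms(3,1,2)] by simp
qed

lemma act_one: "p \<in> topspace X \<Longrightarrow> act 1 p = p"
proof -
  interpret faithful_action torus "topspace X" act by (rule faithful)
  have "1 = \<one>\<^bsub>torus\<^esub>" by (simp add: torus_def)
  then show "p \<in> topspace X \<Longrightarrow> act 1 p = p" using id_eq_one by (metis restrict_apply')
qed

lemma act_power:
  assumes "t \<in> carrier torus" "p \<in> topspace X" "act t p = p"
  shows "act (t ^ n) p = p"
proof (induction n)
  case (Suc n)
  then show ?case using act_mult[OF assms(1) torus_power_closed[OF assms(1)] assms(2)] assms(3) by simp
qed (use act_one assms(2) in simp)

lemma act_smooth_map:
  "smooth_map (prod_topology torus_space X) (product_atlas torus_atlas A) X A (\<lambda>(t, p). act t p)"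
  using action unfolding smooth_effective_torus_action_def by blast

lemma eventually_act:
  assumes c: "c \<in> charts" and p: "p \<in> fst c" and W: "openin X W" "act (torus_exp \<theta>) p \<in> W"
  shows "\<forall>\<^sub>F z in nhds (\<theta>, snd c p). snd z \<in> snd c ` fst c \<and> act (torus_exp (fst z)) (cinv c (snd z)) \<in> W"
proof -
  let ?Y = "snd c ` fst c"
  have act: "continuous_map (prod_topology torus_space X) X (\<lambda>(t, p). act t p)"
    using act_smooth_map unfolding smooth_map_def by blast
  have "continuous_map (top_of_set (UNIV \<times> ?Y)) torus_space (\<lambda>z. torus_exp (fst z))"
    unfolding torus_space_def continuous_map_in_subtopology
    by (auto simp: image_subset_iff intro!: continuous_on_compose2[OF continuous_on_torus_exp[of UNIV]] continuous_intros)
  moreover have "continuous_map (top_of_set (UNIV \<times> ?Y)) X (\<lambda>z. cinv c (snd z))"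
    using continuous_map_compose[OF _ cinv_continuous[OF c], of "top_of_set (UNIV \<times> ?Y)" snd]
    by (simp add: o_def continuous_map_in_subtopology continuous_on_snd continuous_on_id Pi_def)
  ultimately have "continuous_map (top_of_set (UNIV \<times> ?Y)) (prod_topology torus_space X)
      (\<lambda>z. (torus_exp (fst z), cinv c (snd z)))"
    by (simp add: continuous_map_pairwise o_def)
  from continuous_map_compose[OF this act]
  have cont: "continuous_map (top_of_set (UNIV \<times> ?Y)) X (\<lambda>z. act (torus_exp (fst z)) (cinv c (snd z)))"
    by (simp add: o_def)
  let ?S = "{z \<in> UNIV \<times> ?Y. act (torus_exp (fst z)) (cinv c (snd z)) \<in> W}"
  have "openin (top_of_set (UNIV \<times> ?Y)) ?S"
    using openin_continuous_map_preimage[OF cont W(1)] by simp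
  then have "open ?S"
    using chart_image_open[OF c] openin_open_trans open_Times open_UNIV by blast
  then show ?thesis unfolding eventually_nhds
    using p W(2) c by (intro exI[of _ ?S]) auto
qed

text \<open>Smoothness of the action is given in charts of \<open>torus_atlas\<close>, which are
  local inverses of \<open>torus_exp\<close>; here it becomes smoothness in the angles
  themselves.\<close>

lemma smooth_act_A:
  assumes c: "c \<in> A" "d \<in> A" and p: "p \<in> fst c" "act (torus_exp \<theta>) p \<in> fst d"
  shows "smooth_at (\<lambda>z. snd d (act (torus_exp (fst z)) (cinv c (snd z)))) (\<theta>, snd c p)"
proof -
  \<comment> \<open>Coordinates of two points of the unit ball differ by less than 2, which is below
    the period \<open>2 * pi\<close>.\<close>
  define U where "U = ball \<theta> 1"
  have inj: "inj_on torus_exp U"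
  proof (rule inj_onI)
    fix x y assume xy: "x \<in> U" "y \<in> U" "torus_exp x = torus_exp y"
    have "dist x y < 2"
      using xy(1,2) dist_triangle2[of x y \<theta>] by (simp add: U_def dist_commute)
    have "x $ i = y $ i" for i
    proof -
      have "cis (x $ i) = cis (y $ i)" using xy(3) by (metis torus_exp_nth)
      then have "cis (x $ i - y $ i) = 1" by (metis cis_divide cis_neq_zero divide_self)
      then have "cos (x $ i - y $ i) = 1" by (metis cis.simps(1) one_complex.simps(1))
      moreover have "\<bar>x $ i - y $ i\<bar> < 2"
        using \<open>dist x y < 2\<close> dist_vec_nth_le[of x i y] by (simp add: dist_real_def)
      ultimately obtain n :: int where n: "x $ i - y $ i = n * 2 * pi" "\<bar>n * 2 * pi\<bar> < 2"
        unfolding cos_one_2pi_int by auto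
      have "n = 0"
      proof (rule ccontr)
        assume "n \<noteq> 0"
        then have "1 * pi \<le> \<bar>real_of_int n\<bar> * pi" by (intro mult_right_mono) auto
        moreover have "\<bar>real_of_int n\<bar> * pi < 1" using n(2) by (simp add: abs_mult)
        ultimately show False using pi_gt3 by linarith
      qed
      then show ?thesis using n(1) by simp
    qed
    then show "x = y" by (simp add: vec_eq_iff)
  qed
  define C where "C = (torus_exp ` U \<times> fst c, map_prod (inv_into U torus_exp) (snd c))"
  have "open U" by (simp add: U_def)
  then have "(torus_exp ` U, inv_into U torus_exp) \<in> torus_atlas"
    unfolding torus_atlas_def using inj by blast
  moreover have "(fst c, snd c) \<in> A" using c by simp
  ultimately have C: "C \<in> product_atlas torus_atlas A"
    unfolding product_atlas_def C_def by blast
  have cc: "c \<in> charts" "d \<in> charts" using c by auto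
  let ?f = "\<lambda>(t, p). act t p"
  have sm: "smooth_on (local_domain C d ?f) (local_map C d ?f)"
    using act_smooth_map C c(2) unfolding smooth_map_def by blast
  have injC: "inj_on (snd C) (fst C)"
    unfolding C_def using inj chart_inj[OF cc(1)]
    by (auto simp: inj_on_def inv_into_f_f)
  have invC: "inv_into (fst C) (snd C) (x, y) = (torus_exp x, cinv c y)" "snd C (torus_exp x, cinv c y) = (x, y)"
    "(torus_exp x, cinv c y) \<in> fst C"
    if "x \<in> U" "y \<in> snd c ` fst c" for x y
  proof -
    show *: "snd C (torus_exp x, cinv c y) = (x, y)" "(torus_exp x, cinv c y) \<in> fst C"
      using that inj chart_cinv[of y c] by (auto simp: C_def)
    show "inv_into (fst C) (snd C) (x, y) = (torus_exp x, cinv c y)"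
      using inv_into_f_f[OF injC *(2)] * by simp
  qed
  have "\<forall>\<^sub>F z in nhds (\<theta>, snd c p). fst z \<in> U"
    using eventually_nhds_in_open[of "U \<times> UNIV" "(\<theta>, snd c p)"]
    by (force simp: U_def open_Times elim: eventually_mono)
  then have "\<forall>\<^sub>F z in nhds (\<theta>, snd c p). fst z \<in> U \<and> snd z \<in> snd c ` fst c
      \<and> act (torus_exp (fst z)) (cinv c (snd z)) \<in> fst d"
    using eventually_act[OF cc(1) p(1) chart_open[OF cc(2)] p(2)] by eventually_elim auto
  then obtain S where S: "open S" "(\<theta>, snd c p) \<in> S" "\<And>z. z \<in> S \<Longrightarrow> fst z \<in> U \<and> snd z \<in> snd c ` fst c
      \<and> act (torus_exp (fst z)) (cinv c (snd z)) \<in> fst d"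
    unfolding eventually_nhds by blast
  have "S \<subseteq> local_domain C d ?f"
  proof
    fix z assume z: "z \<in> S"
    then have "z = snd C (torus_exp (fst z), cinv c (snd z))" "(torus_exp (fst z), cinv c (snd z)) \<in> fst C"
      using invC(2,3)[of "fst z" "snd z"] S(3)[OF z] by auto
    then show "z \<in> local_domain C d ?f"
      unfolding local_domain_def using S(3)[OF z] by (intro image_eqI[of _ _ "(torus_exp (fst z), cinv c (snd z))"]) auto
  qed
  then have "smooth_at (local_map C d ?f) (\<theta>, snd c p)"
    using smooth_atI[OF sm S(1)] S(2) by blast
  moreover have "\<forall>\<^sub>F z in nhds (\<theta>, snd c p). local_map C d ?f z = snd d (act (torus_exp (fst z)) (cinv c (snd z)))"
    unfolding eventually_nhds
  proof (intro exI[of _ S] conjI ballI S(1,2))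
    fix z assume "z \<in> S"
    then show "local_map C d ?f z = snd d (act (torus_exp (fst z)) (cinv c (snd z)))"
      using invC(1)[of "fst z" "snd z"] S(3)[of z] by (simp add: local_map_def)
  qed
  ultimately show ?thesis by (rule smooth_at_cong)
qed

lemma smooth_act:
  assumes c: "c \<in> charts" "d \<in> charts" and p: "p \<in> fst c" "act (torus_exp \<theta>) p \<in> fst d"
  shows "smooth_at (\<lambda>z. snd d (act (torus_exp (fst z)) (cinv c (snd z)))) (\<theta>, snd c p)"
proof -
  have pX: "p \<in> topspace X" using chart_subset c(1) p(1) by blast
  obtain c' where c': "c' \<in> A" "p \<in> fst c'" using ex_chart_A pX by blast
  obtain d' where d': "d' \<in> A" "act (torus_exp \<theta>) p \<in> fst d'" using ex_chart_A[OF act_closed[OF torus_exp_carrier pX]] by blast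
  have cc: "c' \<in> charts" "d' \<in> charts" using c' d' by auto
  let ?H = "\<lambda>z. snd d' (act (torus_exp (fst z)) (cinv c' (snd z)))"
  let ?g = "\<lambda>z. (fst z, snd c' (cinv c (snd z)))"
  have "smooth_at (\<lambda>z. snd c' (cinv c (snd z))) (\<theta>, snd c p)"
    by (rule smooth_at_compose[OF smooth_at_linear[OF bounded_linear_snd]])
       (simp add: smooth_transition[OF c(1) cc(1) p(1) c'(2)])
  then have g: "smooth_at ?g (\<theta>, snd c p)"
    by (intro smooth_at_Pair smooth_at_linear[OF bounded_linear_fst])
  have gp: "?g (\<theta>, snd c p) = (\<theta>, snd c' p)" using c p by simp
  have "smooth_at (\<lambda>z. ?H (?g z)) (\<theta>, snd c p)"
    by (rule smooth_at_compose[OF g]) (use gp smooth_act_A[OF c'(1) d'(1) c'(2) d'(2)] in simp)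
  moreover have "?H (?g (\<theta>, snd c p)) = snd d' (act (torus_exp \<theta>) p)"
    using c p cc c' by simp
  ultimately have sm: "smooth_at (\<lambda>z. snd d (cinv d' (?H (?g z)))) (\<theta>, snd c p)"
    using smooth_at_compose[of "\<lambda>z. ?H (?g z)" "(\<theta>, snd c p)" "\<lambda>y. snd d (cinv d' y)"]
      smooth_transition[OF cc(2) c(2) d'(2) p(2)] by simp
  have "\<forall>\<^sub>F z in nhds (\<theta>, snd c p). snd z \<in> snd c ` fst c \<and> act (torus_exp (fst z)) (cinv c (snd z)) \<in> fst d'"
    using eventually_act[OF c(1) p(1) chart_open[OF cc(2)] d'(2)] .
  moreover have "\<forall>\<^sub>F z in nhds (\<theta>, snd c p). cinv c (snd z) \<in> fst c'"
  proof -
    have "\<forall>\<^sub>F y in nhds (snd (\<theta>, snd c p)). cinv c y \<in> fst c'"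
      using eventually_chart[OF c(1) p(1) chart_open[OF cc(1)] c'(2)] by (auto elim: eventually_mono)
    then show ?thesis by (rule eventually_compose_isCont) simp
  qed
  ultimately have "\<forall>\<^sub>F z in nhds (\<theta>, snd c p). snd d (cinv d' (?H (?g z)))
      = snd d (act (torus_exp (fst z)) (cinv c (snd z)))"
  proof eventually_elim
    case (elim z)
    then show ?case using cinv_chart[OF cc(2)] cinv_chart[OF cc(1)] by simp
  qed
  then show ?thesis by (rule smooth_at_cong[OF sm])
qed


text \<open>The differential of \<open>t\<close> at \<open>p\<close>, read in \<open>c\<close> at
  the source and in \<open>d\<close> at the target. For \<open>t = 1\<close> it is the change of
  charts.\<close>

definition tact :: "('a, real^'m) chart \<Rightarrow> ('a, real^'m) chart \<Rightarrow> complex^'k \<Rightarrow> 'a \<Rightarrow> real^'m \<Rightarrow> real^'m" where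
  "tact c d t p = frechet_derivative (\<lambda>y. snd d (act t (cinv c y))) (at (snd c p))"

lemma smooth_act_at:
  assumes c: "c \<in> charts" "d \<in> charts" and p: "p \<in> fst c" "act t p \<in> fst d" and t: "t \<in> carrier torus"
  shows "smooth_at (\<lambda>y. snd d (act t (cinv c y))) (snd c p)"
proof -
  obtain \<theta> where \<theta>: "t = torus_exp \<theta>" using torus_exp_surj[OF t] by blast
  have "smooth_at (\<lambda>y. (\<theta>, y)) (snd c p)"
    by (intro smooth_at_Pair smooth_at_const smooth_at_ident)
  from smooth_at_compose[OF this] show ?thesis
    using smooth_act[OF c p(1), of \<theta>] p(2) \<theta> by fastforce
qed

lemma tact_linear:
  assumes "c \<in> charts" "d \<in> charts" "p \<in> fst c" "act t p \<in> fst d" "t \<in> carrier torus"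
  shows "linear (tact c d t p)"
  unfolding tact_def using smooth_at_linear_deriv[OF smooth_act_at[OF assms]] .

text \<open>Smooth maps that are defined on a whole Euclidean space; they serve as parametrizations
  of orbits by real numbers and of punctured spheres by complex numbers.\<close>

definition smooth_into :: "('z::euclidean_space \<Rightarrow> 'a) \<Rightarrow> bool" where
  "smooth_into \<kappa> \<longleftrightarrow> (\<forall>x. \<kappa> x \<in> topspace X) \<and>
    (\<forall>W x. openin X W \<longrightarrow> \<kappa> x \<in> W \<longrightarrow> (\<forall>\<^sub>F y in nhds x. \<kappa> y \<in> W)) \<and>
    (\<forall>x. \<forall>c\<in>charts. \<kappa> x \<in> fst c \<longrightarrow> smooth_at (\<lambda>x. snd c (\<kappa> x)) x)"

definition dchart :: "('a, real^'m) chart \<Rightarrow> ('z::euclidean_space \<Rightarrow> 'a) \<Rightarrow> 'z \<Rightarrow> 'z \<Rightarrow> real^'m" where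
  "dchart c \<kappa> x = frechet_derivative (\<lambda>x. snd c (\<kappa> x)) (at x)"

lemma smooth_intoD:
  assumes "smooth_into \<kappa>"
  shows "\<kappa> x \<in> topspace X" "openin X W \<Longrightarrow> \<kappa> x \<in> W \<Longrightarrow> \<forall>\<^sub>F y in nhds x. \<kappa> y \<in> W"
    "c \<in> charts \<Longrightarrow> \<kappa> x \<in> fst c \<Longrightarrow> smooth_at (\<lambda>x. snd c (\<kappa> x)) x"
    "c \<in> charts \<Longrightarrow> \<kappa> x \<in> fst c \<Longrightarrow> linear (dchart c \<kappa> x)"
    "c \<in> charts \<Longrightarrow> \<kappa> x \<in> fst c \<Longrightarrow> ((\<lambda>x. snd c (\<kappa> x)) has_derivative dchart c \<kappa> x) (at x)"
  using assms unfolding smooth_into_def dchart_def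
  by (blast intro: smooth_at_linear_deriv smooth_at_has_derivative)+

lemma smooth_into_continuous_map:
  assumes "smooth_into \<kappa>"
  shows "continuous_map euclidean X \<kappa>"
  unfolding continuous_map_def
proof (intro conjI allI impI)
  fix W assume "openin X W"
  then have "open {x. \<kappa> x \<in> W}"
    using smooth_intoD(2)[OF assms] by (subst open_subopen) (simp add: eventually_nhds subset_eq)
  then show "openin euclidean {x \<in> topspace euclidean. \<kappa> x \<in> W}" by simp
qed (use smooth_intoD(1)[OF assms] in auto)

lemma act_smooth_into:
  assumes \<kappa>: "smooth_into \<kappa>" and t: "t \<in> carrier torus"
  shows "smooth_into (\<lambda>x. act t (\<kappa> x))"
    and "c \<in> charts \<Longrightarrow> \<kappa> x \<in> fst c \<Longrightarrow> d \<in> charts \<Longrightarrow> act t (\<kappa> x) \<in> fst d \<Longrightarrow>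
      dchart d (\<lambda>x. act t (\<kappa> x)) x = tact c d t (\<kappa> x) \<circ> dchart c \<kappa> x"
proof -
  have ev: "\<forall>\<^sub>F y in nhds x. act t (\<kappa> y) \<in> W" if W: "openin X W" "act t (\<kappa> x) \<in> W" for W x
  proof -
    obtain c where c: "c \<in> charts" "\<kappa> x \<in> fst c" using ex_chart_A[OF smooth_intoD(1)[OF \<kappa>]] by blast
    obtain \<theta> where \<theta>: "t = torus_exp \<theta>" using torus_exp_surj[OF t] by blast
    have "\<forall>\<^sub>F z in nhds (\<theta>, snd c (\<kappa> x)). act (torus_exp (fst z)) (cinv c (snd z)) \<in> W"
      using eventually_act[OF c W(1), of \<theta>] W(2) unfolding \<theta> by (simp add: eventually_conj_iff)
    then have "\<forall>\<^sub>F y in nhds x. act (torus_exp (fst (\<theta>, snd c (\<kappa> y)))) (cinv c (snd (\<theta>, snd c (\<kappa> y)))) \<in> W"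
      by (rule eventually_compose_isCont)
         (intro continuous_intros smooth_at_isCont smooth_intoD(3)[OF \<kappa>] c)
    then show ?thesis
      using smooth_intoD(2)[OF \<kappa> chart_open[OF c(1)] c(2)]
      by eventually_elim (simp add: \<theta> cinv_chart[OF c(1)])
  qed
  have key: "((\<lambda>x. snd d (act t (\<kappa> x))) has_derivative tact c d t (\<kappa> x) \<circ> dchart c \<kappa> x) (at x)"
    "smooth_at (\<lambda>x. snd d (act t (\<kappa> x))) x"
    if c: "c \<in> charts" "\<kappa> x \<in> fst c" and d: "d \<in> charts" "act t (\<kappa> x) \<in> fst d" for x c d
  proof -
    have sm: "smooth_at (\<lambda>y. snd d (act t (cinv c (snd c (\<kappa> y))))) x"
      by (rule smooth_at_compose[OF smooth_intoD(3)[OF \<kappa> c] smooth_act_at[OF c(1) d(1) c(2) d(2) t]])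
    have D: "((\<lambda>y. snd d (act t (cinv c (snd c (\<kappa> y))))) has_derivative tact c d t (\<kappa> x) \<circ> dchart c \<kappa> x) (at x)"
      using diff_chain_at[OF smooth_intoD(5)[OF \<kappa> c] smooth_at_has_derivative[OF smooth_act_at[OF c(1) d(1) c(2) d(2) t]]]
      by (simp add: o_def tact_def)
    have eq: "\<forall>\<^sub>F y in nhds x. snd d (act t (cinv c (snd c (\<kappa> y)))) = snd d (act t (\<kappa> y))"
      using smooth_intoD(2)[OF \<kappa> chart_open[OF c(1)] c(2)] by eventually_elim (simp add: cinv_chart[OF c(1)])
    show "smooth_at (\<lambda>x. snd d (act t (\<kappa> x))) x" by (rule smooth_at_cong[OF sm eq])
    obtain S where "open S" "x \<in> S" "\<And>y. y \<in> S \<Longrightarrow> snd d (act t (cinv c (snd c (\<kappa> y)))) = snd d (act t (\<kappa> y))"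
      using eq unfolding eventually_nhds by blast
    then show "((\<lambda>x. snd d (act t (\<kappa> x))) has_derivative tact c d t (\<kappa> x) \<circ> dchart c \<kappa> x) (at x)"
      by (rule has_derivative_transform_within_open[OF D])
  qed
  show "smooth_into (\<lambda>x. act t (\<kappa> x))"
    unfolding smooth_into_def
  proof (intro conjI allI ballI impI)
    show "act t (\<kappa> x) \<in> topspace X" for x using act_closed[OF t smooth_intoD(1)[OF \<kappa>]] .
    fix x d assume d: "d \<in> charts" "act t (\<kappa> x) \<in> fst d"
    obtain c where c: "c \<in> charts" "\<kappa> x \<in> fst c" using ex_chart_A[OF smooth_intoD(1)[OF \<kappa>]] by blast
    show "smooth_at (\<lambda>x. snd d (act t (\<kappa> x))) x" by (rule key(2)[OF c d])
  qed (use ev in blast)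
  show "c \<in> charts \<Longrightarrow> \<kappa> x \<in> fst c \<Longrightarrow> d \<in> charts \<Longrightarrow> act t (\<kappa> x) \<in> fst d \<Longrightarrow>
      dchart d (\<lambda>x. act t (\<kappa> x)) x = tact c d t (\<kappa> x) \<circ> dchart c \<kappa> x"
    using frechet_derivative_at[OF key(1), of c x d] by (simp add: dchart_def)
qed

lemma dchart_change:
  assumes "smooth_into \<kappa>" "c \<in> charts" "\<kappa> x \<in> fst c" "d \<in> charts" "\<kappa> x \<in> fst d"
  shows "dchart d \<kappa> x = tact c d 1 (\<kappa> x) \<circ> dchart c \<kappa> x"
proof -
  have "(\<lambda>x. act 1 (\<kappa> x)) = \<kappa>" using act_one smooth_intoD(1)[OF assms(1)] by auto
  then show ?thesis using act_smooth_into(2)[OF assms(1) torus_one_closed assms(2,3,4)] assms(5)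
    by (simp add: act_one smooth_intoD(1)[OF assms(1)])
qed

lemma tact_chain:
  assumes c: "c \<in> charts" "p \<in> fst c" and t: "t \<in> carrier torus" and d: "d \<in> charts" "act t p \<in> fst d"
    and s: "s \<in> carrier torus" and e: "e \<in> charts" "act s (act t p) \<in> fst e"
  shows "tact c e (s * t) p = tact d e s (act t p) \<circ> tact c d t p"
proof -
  have D: "((\<lambda>y. snd e (act s (cinv d (snd d (act t (cinv c y)))))) has_derivative
      tact d e s (act t p) \<circ> tact c d t p) (at (snd c p))"
    using diff_chain_at[OF smooth_at_has_derivative[OF smooth_act_at[OF c(1) d(1) c(2) d(2) t]],
        of "\<lambda>y. snd e (act s (cinv d y))" "tact d e s (act t p)"]
      smooth_at_has_derivative[OF smooth_act_at[OF d(1) e(1) d(2) e(2) s]] c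
    by (simp add: o_def tact_def)
  obtain \<theta> where \<theta>: "t = torus_exp \<theta>" using torus_exp_surj[OF t] by blast
  have "\<forall>\<^sub>F z in nhds (\<theta>, snd c p). snd z \<in> snd c ` fst c \<and> act (torus_exp (fst z)) (cinv c (snd z)) \<in> fst d"
    using eventually_act[OF c chart_open[OF d(1)]] d(2) \<theta> by simp
  then have "\<forall>\<^sub>F y in nhds (snd c p). snd (\<theta>, y) \<in> snd c ` fst c \<and> act (torus_exp (fst (\<theta>, y))) (cinv c (snd (\<theta>, y))) \<in> fst d"
    by (rule eventually_compose_isCont) (intro continuous_intros)
  then have "\<forall>\<^sub>F y in nhds (snd c p). snd e (act s (cinv d (snd d (act t (cinv c y))))) = snd e (act (s * t) (cinv c y))"
  proof eventually_elim
    case (elim y)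
    then have "cinv c y \<in> topspace X" using chart_cinv(2)[of y c] chart_subset[OF c(1)] by simp
    then show ?case using elim d(1) unfolding \<theta>[symmetric] by (simp add: act_mult[OF s t] \<theta>[symmetric])
  qed
  then obtain S where "open S" "snd c p \<in> S" "\<And>y. y \<in> S \<Longrightarrow>
      snd e (act s (cinv d (snd d (act t (cinv c y))))) = snd e (act (s * t) (cinv c y))"
    unfolding eventually_nhds by blast
  then have "((\<lambda>y. snd e (act (s * t) (cinv c y))) has_derivative
      tact d e s (act t p) \<circ> tact c d t p) (at (snd c p))"
    by (rule has_derivative_transform_within_open[OF D])
  from frechet_derivative_at[OF this] show ?thesis by (simp add: tact_def)
qed

lemma tact_id:
  assumes c: "c \<in> charts" "p \<in> fst c"
  shows "tact c c 1 p = id"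
proof -
  have "\<forall>\<^sub>F y in nhds (snd c p). y = snd c (act 1 (cinv c y))"
    using eventually_chart[OF c chart_open[OF c(1)] c(2)]
  proof eventually_elim
    case (elim y)
    then show ?case using chart_cinv(1)[of y c] chart_subset[OF c(1)] act_one by simp
  qed
  then obtain S where "open S" "snd c p \<in> S" "\<And>y. y \<in> S \<Longrightarrow> y = snd c (act 1 (cinv c y))"
    unfolding eventually_nhds by blast
  then have "((\<lambda>y. snd c (act 1 (cinv c y))) has_derivative (\<lambda>y. y)) (at (snd c p))"
    by (rule has_derivative_transform_within_open[OF has_derivative_ident])
  then show ?thesis unfolding tact_def id_def by (rule frechet_derivative_at[symmetric])
qed

lemma smooth_into_orbit:
  assumes q: "q \<in> topspace X" and f: "\<And>x. smooth_at f x"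
  shows "smooth_into (\<lambda>x. act (torus_exp (f x)) q)"
  unfolding smooth_into_def
proof (intro conjI allI ballI impI)
  show "act (torus_exp (f x)) q \<in> topspace X" for x by (simp add: act_closed q)
  obtain c where c: "c \<in> charts" "q \<in> fst c" using ex_chart_A[OF q] by blast
  have sm: "smooth_at (\<lambda>x. (f x, snd c q)) x" for x
    by (intro smooth_at_Pair smooth_at_const f)
  show "smooth_at (\<lambda>x. snd d (act (torus_exp (f x)) q)) x"
    if d: "d \<in> charts" "act (torus_exp (f x)) q \<in> fst d" for x d
    using smooth_at_compose[OF sm smooth_act[OF c(1) d(1) c(2) d(2)]] c by simp
  show "\<forall>\<^sub>F y in nhds x. act (torus_exp (f y)) q \<in> W"
    if W: "openin X W" "act (torus_exp (f x)) q \<in> W" for x W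
  proof -
    have "\<forall>\<^sub>F y in nhds x. snd (f y, snd c q) \<in> snd c ` fst c \<and> act (torus_exp (fst (f y, snd c q))) (cinv c (snd (f y, snd c q))) \<in> W"
      using eventually_compose_isCont[where f = "\<lambda>x. (f x, snd c q)", OF eventually_act[OF c W] smooth_at_isCont[OF sm]] .
    then show ?thesis using c by (auto elim: eventually_mono)
  qed
qed

section \<open>Adapted charts and orbits of dimension at most one\<close>

lemma open_chart_image:
  assumes c: "c \<in> charts" and W: "openin X W" "W \<subseteq> fst c"
  shows "open (snd c ` W)"
  unfolding open_subopen[of "snd c ` W"]
proof
  fix y assume "y \<in> snd c ` W"
  then obtain p where p: "p \<in> W" "y = snd c p" by blast
  obtain S where S: "open S" "y \<in> S" "\<And>z. z \<in> S \<Longrightarrow> z \<in> snd c ` fst c \<and> cinv c z \<in> W"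
    using eventually_chart[OF c _ W(1) p(1)] W(2) p unfolding eventually_nhds by blast
  have "S \<subseteq> snd c ` W"
  proof
    fix z assume "z \<in> S"
    then show "z \<in> snd c ` W" using S(3)[of z] chart_cinv(1)[of z c] by (metis image_eqI)
  qed
  then show "\<exists>T. open T \<and> y \<in> T \<and> T \<subseteq> snd c ` W" using S by blast
qed

text \<open>Produces the charts that \<open>embedded_submanifold\<close> asks for, by composing a
  chart of \<open>A\<close> with a local diffeomorphism \<open>\<Phi>\<close>. Openness of images
  comes from invariance of domain.\<close>

lemma smooth_atlas_insert:
  fixes \<Phi> \<Psi> :: "real^'m \<Rightarrow> real^'m"
  assumes c: "c \<in> A" and U: "openin X U" "U \<subseteq> fst c"
    and \<Phi>: "\<And>p. p \<in> U \<Longrightarrow> smooth_at \<Phi> (snd c p)" and \<Psi>: "\<And>p. p \<in> U \<Longrightarrow> smooth_at \<Psi> (\<Phi> (snd c p))"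
    and inv: "\<And>p. p \<in> U \<Longrightarrow> \<Psi> (\<Phi> (snd c p)) = snd c p"
  shows "smooth_atlas X (insert (U, \<lambda>p. \<Phi> (snd c p)) A)"
proof -
  let ?x = "\<lambda>p. \<Phi> (snd c p)" and ?g = "\<lambda>z. cinv c (\<Psi> z)"
  have cc: "c \<in> charts" using c by simp
  have g: "?g (?x p) = p" if "p \<in> U" for p
    using inv[OF that] cc U(2) that by auto
  have inj: "inj_on ?x U" by (rule inj_on_inverseI[where g = ?g]) (rule g)
  have op: "open (?x ` W)" if W: "openin X W" "W \<subseteq> U" for W
  proof -
    have "open (\<Phi> ` snd c ` W)"
    proof (rule invariance_of_domain)
      show "continuous_on (snd c ` W) \<Phi>"
        using \<Phi> W(2) by (intro continuous_at_imp_continuous_on) (auto intro: smooth_at_isCont)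
      show "open (snd c ` W)" using open_chart_image[OF cc W(1)] W(2) U(2) by blast
      show "inj_on \<Phi> (snd c ` W)" by (rule inj_on_inverseI[where g = \<Psi>]) (use inv W(2) in auto)
    qed
    then show ?thesis by (simp add: image_image)
  qed
  have topU: "topspace (subtopology X U) = U" using openin_subset[OF U(1)] by auto
  have homeo: "homeomorphic_maps (subtopology X U) (top_of_set (?x ` U)) ?x ?g"
    unfolding homeomorphic_maps_def
  proof (intro conjI ballI)
    have 1: "continuous_map (subtopology X U) (top_of_set (snd c ` U)) (snd c)"
      using continuous_map_from_subtopology_mono[OF chart_continuous[OF cc] U(2)]
      by (auto simp: continuous_map_in_subtopology topU)
    have "continuous_map (top_of_set (snd c ` U)) euclidean \<Phi>"
      using \<Phi> by (auto intro!: continuous_at_imp_continuous_on smooth_at_isCont)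
    from continuous_map_compose[OF 1 this]
    show "continuous_map (subtopology X U) (top_of_set (?x ` U)) ?x"
      by (auto simp: continuous_map_in_subtopology o_def topU)
    have "continuous_on (?x ` U) \<Psi>"
      using \<Psi> by (auto intro!: continuous_at_imp_continuous_on smooth_at_isCont)
    then have "continuous_map (top_of_set (?x ` U)) (top_of_set (snd c ` fst c)) \<Psi>"
      using inv U(2) by (auto simp: continuous_map_in_subtopology)
    from continuous_map_compose[OF this cinv_continuous[OF cc]]
    show "continuous_map (top_of_set (?x ` U)) (subtopology X U) ?g"
      using g by (auto simp: o_def continuous_map_in_subtopology)
  qed (use g topU in auto)
  have new_chart: "is_chart X (U, ?x)"
    using U(1) op[OF U(1)] homeo homeomorphic_map_maps by (auto simp: is_chart_def)
  have inv_x: "inv_into U ?x z = ?g z" if z: "z \<in> ?x ` U" for z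
  proof -
    obtain p where p: "p \<in> U" "z = ?x p" using z by blast
    show ?thesis unfolding p(2) g[OF p(1)] by (rule inv_into_f_f[OF inj p(1)])
  qed
  have from_new: "smooth_on (?x ` (U \<inter> fst d)) (snd d \<circ> inv_into U ?x)" if d: "d \<in> A" for d
  proof (rule smooth_on_if_smooth_at)
    have dc: "d \<in> charts" using d by simp
    show opd: "open (?x ` (U \<inter> fst d))" by (rule op) (use U(1) chart_open[OF dc] in auto)
    fix z assume z: "z \<in> ?x ` (U \<inter> fst d)"
    then obtain p where p: "p \<in> U" "p \<in> fst d" "z = ?x p" by blast
    have "smooth_at (\<lambda>z. snd d (cinv c (\<Psi> z))) z"
      by (rule smooth_at_compose) (use p \<Psi> inv smooth_transition[OF cc dc _ p(2)] U(2) in auto)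
    moreover have "\<forall>\<^sub>F z in nhds z. snd d (cinv c (\<Psi> z)) = (snd d \<circ> inv_into U ?x) z"
      using eventually_nhds_in_open[OF opd z] by eventually_elim (use inv_x in auto)
    ultimately show "smooth_at (snd d \<circ> inv_into U ?x) z" by (rule smooth_at_cong)
  qed
  have to_new: "smooth_on (snd d ` (fst d \<inter> U)) (?x \<circ> inv_into (fst d) (snd d))" if d: "d \<in> A" for d
  proof (rule smooth_on_if_smooth_at)
    have dc: "d \<in> charts" using d by simp
    show "open (snd d ` (fst d \<inter> U))"
      by (rule open_chart_image[OF dc]) (use U(1) chart_open[OF dc] in auto)
    fix y assume "y \<in> snd d ` (fst d \<inter> U)"
    then obtain p where p: "p \<in> U" "p \<in> fst d" "y = snd d p" by blast
    have "smooth_at (\<lambda>z. \<Phi> (snd c (cinv d z))) y"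
      by (rule smooth_at_compose) (use p \<Phi> dc smooth_transition[OF dc cc p(2)] U(2) in auto)
    then show "smooth_at (?x \<circ> inv_into (fst d) (snd d)) y" by (simp add: o_def cinv_def)
  qed
  have new_new: "smooth_on (?x ` U) (?x \<circ> inv_into U ?x)"
  proof (rule smooth_on_if_smooth_at)
    show opU: "open (?x ` U)" by (rule op) (use U in auto)
    fix z assume z: "z \<in> ?x ` U"
    have "\<forall>\<^sub>F z in nhds z. z = (?x \<circ> inv_into U ?x) z"
      using eventually_nhds_in_open[OF opU z]
      by eventually_elim (simp add: f_inv_into_f[where f = ?x and A = U])
    then show "smooth_at (?x \<circ> inv_into U ?x) z" by (rule smooth_at_cong[OF smooth_at_ident])
  qed
  show ?thesis
    using atlas_A new_chart from_new to_new new_new openin_subset[OF U(1)]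
    unfolding smooth_atlas_def transition_def by auto
qed


text \<open>A shear along the tangent \<open>b\<close> of the curve at \<open>\<kappa> 0\<close> straightens it; only the inverse of the real function
  \<open>s \<mapsto> snd c (\<kappa> s) \<bullet> b\<close> is needed. Removing the compact set \<open>C\<close> leaves one branch of the curve.\<close>

lemma periodic_curve_submanifold_chart:
  fixes \<kappa> :: "real \<Rightarrow> 'a"
  assumes \<kappa>: "smooth_into \<kappa>" and per: "\<And>s. \<kappa> (s + 2 * pi) = \<kappa> s"
    and hom: "\<And>s s' r. \<kappa> s = \<kappa> s' \<Longrightarrow> \<kappa> (s + r) = \<kappa> (s' + r)"
    and c: "c \<in> A" "\<kappa> 0 \<in> fst c" and nz: "dchart c \<kappa> 0 1 \<noteq> 0"
  shows "\<exists>U x V. \<kappa> 0 \<in> U \<and> smooth_atlas X (insert (U, x) A) \<and> subspace V \<and> dim V = 1 \<and>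
    x ` (range \<kappa> \<inter> U) = x ` U \<inter> V"
proof -
  have cc: "c \<in> charts" using c by simp
  define g where "g = (\<lambda>s. snd c (\<kappa> s))"
  define v where "v = dchart c \<kappa> 0 1"
  define b where "b = (1 / norm v) *\<^sub>R v"
  have v: "v \<noteq> 0" using nz by (simp add: v_def)
  have b: "b \<bullet> b = 1" using v by (simp add: b_def dot_square_norm power2_eq_square)
  define f where "f = (\<lambda>s. g s \<bullet> b)"
  have g: "smooth_at g s" if "\<kappa> s \<in> fst c" for s
    unfolding g_def using smooth_intoD(3)[OF \<kappa> cc that] .
  have f: "smooth_at f s" if "\<kappa> s \<in> fst c" for s
    unfolding f_def by (rule smooth_at_linear_image[OF bounded_linear_inner_left g[OF that]])
  have "((\<lambda>s. g s \<bullet> b) has_derivative (\<lambda>s. dchart c \<kappa> 0 s \<bullet> b)) (at 0)"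
    unfolding g_def by (intro has_derivative_inner_left smooth_intoD(5)[OF \<kappa> cc c(2)])
  then have "frechet_derivative f (at 0) = (\<lambda>s. dchart c \<kappa> 0 s \<bullet> b)"
    unfolding f_def by (rule frechet_derivative_at[symmetric])
  then have pos: "frechet_derivative f (at 0) 1 > 0"
    using v by (simp add: v_def[symmetric] b_def)
  obtain \<delta> where \<delta>: "\<delta> > 0" "\<And>s. \<bar>s\<bar> < \<delta> \<Longrightarrow> \<kappa> s \<in> fst c"
    using smooth_intoD(2)[OF \<kappa> chart_open[OF cc] c(2)] unfolding eventually_nhds_metric
    by (auto simp: dist_real_def)
  obtain \<epsilon> \<tau> where \<epsilon>: "0 < \<epsilon>" "\<epsilon> \<le> \<delta>" and opJ: "open (f ` {-\<epsilon><..<\<epsilon>})"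
    and \<tau>: "\<And>s. s \<in> {-\<epsilon><..<\<epsilon>} \<Longrightarrow> \<tau> (f s) = s" and sm\<tau>: "smooth_on (f ` {-\<epsilon><..<\<epsilon>}) \<tau>"
    using smooth_inverse_real[OF f[OF c(2)] pos \<delta>(1)] by blast
  define I where "I = {-\<epsilon><..<\<epsilon>}"
  define J where "J = f ` I"
  have I: "open I" "0 \<in> I" "\<And>s. s \<in> I \<Longrightarrow> \<kappa> s \<in> fst c"
    using \<epsilon> \<delta> by (auto simp: I_def)
  \<comment> \<open>Near \<open>\<kappa> 0\<close> the curve is a graph over the line of
    \<open>b\<close>: its point with coordinate \<open>r\<close> along \<open>b\<close> is
    \<open>r *\<^sub>R b + h r\<close>, with \<open>h r\<close> orthogonal to
    \<open>b\<close>.\<close>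
  define h where "h = (\<lambda>r. g (\<tau> r) - r *\<^sub>R b)"
  have smh: "smooth_at h r" if r: "r \<in> J" for r
  proof -
    obtain s where s: "s \<in> I" "r = f s" using r by (auto simp: J_def)
    have "smooth_at \<tau> r"
      using sm\<tau> opJ r by (intro smooth_atI) (auto simp: J_def I_def)
    then have "smooth_at (\<lambda>r. g (\<tau> r)) r"
      by (rule smooth_at_compose) (use s \<tau> g I in \<open>auto simp: I_def\<close>)
    then show ?thesis unfolding h_def
      by (rule smooth_at_diff) (rule smooth_at_linear[OF bounded_linear_scaleR_left])
  qed
  have hb: "h r \<bullet> b = 0" if r: "r \<in> J" for r
    using r \<tau> b by (auto simp: J_def I_def h_def f_def inner_diff_left)
  define \<Phi> where "\<Phi> = (\<lambda>y. y - h (y \<bullet> b))"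
  define \<Psi> where "\<Psi> = (\<lambda>y. y + h (y \<bullet> b))"
  have \<Phi>b: "\<Phi> y \<bullet> b = y \<bullet> b" if "y \<bullet> b \<in> J" for y
    using hb[OF that] by (simp add: \<Phi>_def inner_diff_left)
  have \<Psi>\<Phi>: "\<Psi> (\<Phi> y) = y" if "y \<bullet> b \<in> J" for y
    unfolding \<Psi>_def \<Phi>b[OF that] by (simp add: \<Phi>_def)
  have smhb: "smooth_at (\<lambda>y. h (y \<bullet> b)) y" if "y \<bullet> b \<in> J" for y
    by (rule smooth_at_compose[OF smooth_at_linear[OF bounded_linear_inner_left]]) (rule smh[OF that])
  have sm\<Phi>: "smooth_at \<Phi> y" and sm\<Psi>: "smooth_at \<Psi> y" if "y \<bullet> b \<in> J" for y
    unfolding \<Phi>_def \<Psi>_def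
    by (intro smooth_at_diff smooth_at_add smooth_at_ident smhb[OF that])+
  \<comment> \<open>The parameters whose points lie on the chosen branch. By \<open>hom\<close>, a
    coincidence of two points persists when both parameters are moved by the same amount, so
    \<open>Z\<close> is open and the rest of a period is compact.\<close>
  define Z where "Z = {s. \<exists>s'\<in>I. \<kappa> s = \<kappa> s'}"
  have "open Z"
    unfolding open_dist
  proof
    fix s assume "s \<in> Z"
    then obtain s' where s': "s' \<in> I" "\<kappa> s = \<kappa> s'" by (auto simp: Z_def)
    obtain e where e: "e > 0" "\<And>x. dist x s' < e \<Longrightarrow> x \<in> I"
      using I(1) s'(1) unfolding open_dist by blast
    show "\<exists>e>0. \<forall>x. dist x s < e \<longrightarrow> x \<in> Z"
    proof (intro exI conjI allI impI)
      fix x assume "dist x s < e"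
      then have "s' + (x - s) \<in> I" by (intro e(2)) (simp add: dist_norm)
      moreover have "\<kappa> x = \<kappa> (s' + (x - s))" using hom[OF s'(2), of "x - s"] by simp
      ultimately show "x \<in> Z" by (auto simp: Z_def)
    qed fact
  qed
  define C where "C = \<kappa> ` ({0..2 * pi} - Z)"
  have "compactin X C"
    unfolding C_def
  proof (rule image_compactin[OF _ smooth_into_continuous_map[OF \<kappa>]])
    show "compactin euclidean ({0..2 * pi} - Z)"
      using \<open>open Z\<close> by (auto simp: Diff_eq intro: compact_Int_closed)
  qed
  then have "closedin X C" using compactin_imp_closedin[OF hausdorff] by blast
  define U where "U = {p \<in> fst c. snd c p \<in> {y. y \<bullet> b \<in> J}} - C"
  have "open {y. y \<bullet> b \<in> J}"
    using open_vimage[of J "\<lambda>y. y \<bullet> b"] opJ continuous_on_inner[OF continuous_on_id continuous_on_const]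
    by (auto simp: J_def I_def vimage_def)
  then have openU: "openin X U"
    unfolding U_def using openin_chart_preimage[OF cc] \<open>closedin X C\<close> by blast
  have Usub: "U \<subseteq> fst c" by (auto simp: U_def)
  have UJ: "snd c p \<bullet> b \<in> J" if "p \<in> U" for p using that by (simp add: U_def)
  have "\<kappa> 0 \<notin> C" using I(2) by (auto simp: C_def Z_def intro: bexI[of _ 0])
  then have pU: "\<kappa> 0 \<in> U" using c(2) I(2) by (auto simp: U_def J_def f_def g_def)
  have rep: "\<exists>s\<in>I. p = \<kappa> s" if p: "p \<in> range \<kappa> \<inter> U" for p
  proof -
    obtain s where s: "p = \<kappa> s" using p by blast
    define s0 where "s0 = s - of_int \<lfloor>s / (2 * pi)\<rfloor> * (2 * pi)"
    have per': "\<kappa> (x + of_int n * (2 * pi)) = \<kappa> x" for x and n :: int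
    proof (induction n rule: int_induct[where k = 0])
      case (step1 n)
      then show ?case using per[of "x + of_int n * (2 * pi)"] by (simp add: algebra_simps)
    next
      case (step2 n)
      then show ?case using per[of "x + of_int (n - 1) * (2 * pi)"] by (simp add: algebra_simps)
    qed simp
    have "\<kappa> s0 = p" using per'[of s0 "\<lfloor>s / (2 * pi)\<rfloor>"] by (simp add: s0_def s)
    moreover have "s0 \<in> {0..2 * pi}"
    proof -
      have "of_int \<lfloor>s / (2 * pi)\<rfloor> * (2 * pi) \<le> s" "s \<le> (of_int \<lfloor>s / (2 * pi)\<rfloor> + 1) * (2 * pi)"
        using floor_divide_lower[of "2 * pi" s] floor_divide_upper[of "2 * pi" s] by simp_all
      then show ?thesis by (simp add: s0_def algebra_simps)
    qed
    ultimately have "s0 \<in> Z" using p by (auto simp: U_def C_def)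
    then show ?thesis using \<open>\<kappa> s0 = p\<close> by (auto simp: Z_def)
  qed
  let ?x = "\<lambda>p. \<Phi> (snd c p)"
  have "?x ` (range \<kappa> \<inter> U) = ?x ` U \<inter> span {b}"
  proof (intro equalityI subsetI)
    fix z assume "z \<in> ?x ` (range \<kappa> \<inter> U)"
    then obtain p where p: "p \<in> range \<kappa> \<inter> U" "z = ?x p" by blast
    obtain s where s: "s \<in> I" "p = \<kappa> s" using rep[OF p(1)] by blast
    have "z = f s *\<^sub>R b"
      using p(2) s \<tau>[of s] by (simp add: \<Phi>_def h_def g_def f_def I_def)
    then have "z \<in> span {b}" by (simp add: span_scale span_base)
    moreover have "z \<in> ?x ` U" using p by blast
    ultimately show "z \<in> ?x ` U \<inter> span {b}" by blast
  next
    fix z assume "z \<in> ?x ` U \<inter> span {b}"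
    then obtain p where "p \<in> U" "z = ?x p" by blast
    moreover obtain r where "z = r *\<^sub>R b" using \<open>z \<in> ?x ` U \<inter> span {b}\<close> by (auto simp: span_singleton)
    ultimately have p: "p \<in> U" "z = ?x p" "z = r *\<^sub>R b" by auto
    have "r = snd c p \<bullet> b" 
      using \<Phi>b[OF UJ[OF p(1)]] b unfolding p(2)[symmetric] p(3) by simp
    then obtain s where s: "s \<in> I" "r = f s" using UJ[OF p(1)] by (auto simp: J_def)
    have "snd c p = \<Psi> z" using \<Psi>\<Phi>[OF UJ[OF p(1)]] p(2) by simp
    also have "\<dots> = g s" using s \<tau>[of s] b p(3) by (simp add: \<Psi>_def h_def I_def)
    finally have "snd c p = snd c (\<kappa> s)" by (simp add: g_def)
    then have "p = \<kappa> s"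
      using inj_onD[OF chart_inj[OF cc]] Usub p(1) I(3)[OF s(1)] by blast
    then show "z \<in> ?x ` (range \<kappa> \<inter> U)" using p by blast
  qed
  moreover have "smooth_atlas X (insert (U, ?x) A)"
    by (rule smooth_atlas_insert[OF c(1) openU Usub, where \<Psi> = \<Psi>])
       (use UJ sm\<Phi> sm\<Psi> \<Psi>\<Phi> \<Phi>b in auto)
  moreover have "dim (span {b}) = 1" using b by (auto simp: dim_singleton)
  ultimately show ?thesis using pU subspace_span by blast
qed

text \<open>The orbit is the image of \<open>s \<mapsto> exp (s e_i) q\<close>. This curve is
  homogeneous, so its velocity vanishes either everywhere or nowhere. In the first case the orbit is
  a point; in the second, \<open>periodic_curve_submanifold_chart\<close> applies at each of its
  points after a translation.\<close>

lemma orbit_one_skeleton: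
  assumes q: "q \<in> topspace X"
    and orb: "\<And>t. t \<in> carrier torus \<Longrightarrow> \<exists>s. act t q = act (torus_exp (s *\<^sub>R axis i 1)) q"
  shows "q \<in> one_skeleton X A act"
proof -
  let ?e = "axis i 1 :: real^'k"
  define \<gamma> where "\<gamma> = (\<lambda>s. act (torus_exp (s *\<^sub>R ?e)) q)"
  have \<gamma>: "smooth_into \<gamma>"
    unfolding \<gamma>_def
    by (rule smooth_into_orbit[OF q]) (rule smooth_at_linear[OF bounded_linear_scaleR_left])
  have S: "orbit torus act q = range \<gamma>"
    using orb by (fastforce simp: orbit_def \<gamma>_def)
  have \<gamma>0: "\<gamma> 0 = q" by (simp add: \<gamma>_def act_one q)
  have shift: "act (torus_exp (r *\<^sub>R ?e)) (\<gamma> s) = \<gamma> (r + s)" for r s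
    by (simp add: \<gamma>_def scaleR_add_left torus_exp_add act_mult q)
  have zero: "dchart d (\<lambda>x. act t (\<kappa> x)) x v = 0"
    if "smooth_into \<kappa>" "t \<in> carrier torus" "c \<in> charts" "\<kappa> x \<in> fst c" "dchart c \<kappa> x v = 0"
      "d \<in> charts" "act t (\<kappa> x) \<in> fst d" for \<kappa> :: "real \<Rightarrow> 'a" and c d t x v
    using act_smooth_into(2)[OF that(1,2,3,4,6,7)] linear_0[OF tact_linear[OF that(3,6,4,7,2)]] that(5) by simp
  have sub: "orbit torus act q \<subseteq> topspace X" unfolding S using smooth_intoD(1)[OF \<gamma>] by blast
  obtain c0 where c0: "c0 \<in> A" "q \<in> fst c0" using ex_chart_A[OF q] by blast
  then have c0c: "c0 \<in> charts" by simp
  show ?thesis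
  proof (cases "dchart c0 \<gamma> 0 1 = 0")
    case True
    have d0: "((\<lambda>s. snd d (\<gamma> s)) has_derivative (\<lambda>_. 0)) (at r)" if d: "d \<in> charts" "\<gamma> r \<in> fst d" for d r
    proof -
      let ?\<kappa> = "\<lambda>s. act (torus_exp (r *\<^sub>R ?e)) (\<gamma> s)"
      have \<kappa>: "smooth_into ?\<kappa>" by (rule act_smooth_into(1)[OF \<gamma>]) simp
      have r: "?\<kappa> 0 \<in> fst d" using d(2) by (simp add: shift)
      have "dchart d ?\<kappa> 0 1 = 0" by (rule zero[OF \<gamma> _ c0c]) (use \<gamma>0 c0 True d r in auto)
      then have "dchart d ?\<kappa> 0 = (\<lambda>_. 0)"
        using linear_cmul[OF smooth_intoD(4)[OF \<kappa> d(1) r], of _ 1] by (auto simp: fun_eq_iff)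
      then have "((\<lambda>s. snd d (\<gamma> (r + s))) has_derivative (\<lambda>_. 0)) (at (r - r))"
        using smooth_intoD(5)[OF \<kappa> d(1) r] by (simp add: shift)
      have "((\<lambda>s. s - r) has_derivative (\<lambda>s. s)) (at r)" by (auto intro!: derivative_eq_intros)
      from has_derivative_compose[OF this \<open>(_ has_derivative _) (at (r - r))\<close>] show ?thesis by simp
    qed
    have const: "\<gamma> r = \<gamma> 0" for r
    proof (rule connected_equivalence_relation[where R = "\<lambda>x y. \<gamma> x = \<gamma> y" and S = UNIV])
      fix x :: real
      obtain d where d: "d \<in> charts" "\<gamma> x \<in> fst d" using ex_chart_A[OF smooth_intoD(1)[OF \<gamma>]] by blast
      obtain e where e: "e > 0" "\<And>y. dist y x < e \<Longrightarrow> \<gamma> y \<in> fst d"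
        using smooth_intoD(2)[OF \<gamma> chart_open[OF d(1)] d(2)] unfolding eventually_nhds_metric by blast
      have "\<gamma> x = \<gamma> y" if y: "y \<in> ball x e" for y
      proof -
        have "\<exists>k. \<forall>y\<in>ball x e. snd d (\<gamma> y) = k"
          by (rule has_derivative_zero_constant)
             (use e(2) d0[OF d(1)] in \<open>auto simp: dist_commute intro: has_derivative_at_withinI\<close>)
        then have "snd d (\<gamma> x) = snd d (\<gamma> y)" using y e(1) by (metis centre_in_ball)
        then show ?thesis
          using inj_onD[OF chart_inj[OF d(1)]] d(2) e(2)[of y] y by (simp add: dist_commute)
      qed
      then show "\<exists>T. openin (top_of_set UNIV) T \<and> x \<in> T \<and> (\<forall>y\<in>T. \<gamma> x = \<gamma> y)"
        using e(1) by (intro exI[of _ "ball x e"]) (auto simp: openin_open_eq)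
    qed auto
    then have orb_q: "orbit torus act q = {q}" unfolding S using \<gamma>0 by auto
    have "embedded_submanifold X A (orbit torus act q) 0"
      unfolding embedded_submanifold_def orb_q
    proof (intro conjI ballI)
      fix p assume "p \<in> {q}"
      let ?x = "\<lambda>p. snd c0 p - snd c0 q"
      have "smooth_atlas X (insert (fst c0, ?x) A)"
        by (rule smooth_atlas_insert[OF c0(1), where \<Phi> = "\<lambda>y. y - snd c0 q" and \<Psi> = "\<lambda>y. y + snd c0 q"])
           (auto intro!: chart_open[OF c0c] smooth_at_diff smooth_at_add smooth_at_ident smooth_at_const)
      then show "\<exists>U x V. p \<in> U \<and> smooth_atlas X (insert (U, x) A) \<and> subspace V \<and> dim V = 0 \<and> x ` ({q} \<inter> U) = x ` U \<inter> V"
        using c0(2) \<open>p \<in> {q}\<close> by (intro exI[of _ "fst c0"] exI[of _ ?x] exI[of _ "{0}"]) (auto simp: image_iff)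
    qed (use q in auto)
    then show ?thesis using q unfolding one_skeleton_def by blast
  next
    case False
    have "embedded_submanifold X A (orbit torus act q) 1"
      unfolding embedded_submanifold_def
    proof (intro conjI ballI sub)
      fix p assume "p \<in> orbit torus act q"
      then obtain r where r: "p = \<gamma> r" unfolding S by blast
      let ?\<kappa> = "\<lambda>s. act (torus_exp (r *\<^sub>R ?e)) (\<gamma> s)"
      have \<kappa>: "smooth_into ?\<kappa>" by (rule act_smooth_into(1)[OF \<gamma>]) simp
      obtain c where c: "c \<in> A" "p \<in> fst c" using ex_chart_A sub \<open>p \<in> orbit torus act q\<close> by blast
      have p: "?\<kappa> 0 = p" by (simp add: shift r)
      have return: "act (torus_exp ((- r) *\<^sub>R ?e)) (?\<kappa> s) = \<gamma> s" for s by (simp only: shift) simp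
      have ran: "range ?\<kappa> = orbit torus act q"
        unfolding S shift by (metis surj_plus range_composition comp_def image_image)
      have nz: "dchart c ?\<kappa> 0 1 \<noteq> 0"
      proof
        assume "dchart c ?\<kappa> 0 1 = 0"
        then have "dchart c0 (\<lambda>s. act (torus_exp ((- r) *\<^sub>R ?e)) (?\<kappa> s)) 0 1 = 0"
          by (intro zero[OF \<kappa>, of _ c]) (use c p c0c return \<gamma>0 c0 in auto)
        then show False using False return by simp
      qed
      have per: "?\<kappa> (s + 2 * pi) = ?\<kappa> s" for s
      proof -
        have "torus_exp ((2 * pi) *\<^sub>R ?e) = 1" by (simp add: vec_eq_iff axis_def)
        then show ?thesis using shift[of "2 * pi" "r + s"] act_one[OF smooth_intoD(1)[OF \<gamma>]]
          by (simp add: shift add_ac)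
      qed
      have hom: "?\<kappa> (s + x) = ?\<kappa> (s' + x)" if "?\<kappa> s = ?\<kappa> s'" for s s' x
        using arg_cong[OF that, of "act (torus_exp (x *\<^sub>R ?e))"] by (simp add: shift add_ac)
      have "?\<kappa> 0 \<in> fst c" using c(2) p by simp
      from periodic_curve_submanifold_chart[OF \<kappa> per hom c(1) this nz]
      show "\<exists>U x V. p \<in> U \<and> smooth_atlas X (insert (U, x) A) \<and> subspace V \<and> dim V = 1 \<and>
          x ` (orbit torus act q \<inter> U) = x ` U \<inter> V"
        unfolding p ran .
    qed
    then show ?thesis using q unfolding one_skeleton_def by blast
  qed
qed

end

lemma linear_basis_expansion:
  "linear L \<Longrightarrow> L x = (\<Sum>b\<in>Basis. (x \<bullet> b) *\<^sub>R L b)" for L :: "'a::euclidean_space \<Rightarrow> 'b::real_vector"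
  using linear_sum[of L "\<lambda>b. (x \<bullet> b) *\<^sub>R b" Basis]
  by (simp add: euclidean_representation linear_cmul)

lemma continuous_on_linear_family:
  fixes L :: "'z::topological_space \<Rightarrow> 'a::euclidean_space \<Rightarrow> 'b::real_normed_vector"
  assumes "\<And>z. z \<in> S \<Longrightarrow> linear (L z)" "\<And>u. continuous_on S (\<lambda>z. L z u)" "continuous_on S w"
  shows "continuous_on S (\<lambda>z. L z (w z))"
proof -
  have "continuous_on S (\<lambda>z. \<Sum>b\<in>Basis. (w z \<bullet> b) *\<^sub>R L z b)"
    by (intro continuous_intros assms)
  moreover have "(\<Sum>b\<in>Basis. (w z \<bullet> b) *\<^sub>R L z b) = L z (w z)" if "z \<in> S" for z
    using linear_basis_expansion[OF assms(1)[OF that], of "w z"] by simp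
  ultimately show ?thesis by (rule continuous_on_eq)
qed

lemma torus_exp_eq_minus: "torus_exp x = torus_exp y \<Longrightarrow> torus_exp (- x) = torus_exp (- y)"
  by (simp add: vec_eq_iff flip: cis_inverse)

lemma torus_exp_box:
  assumes "t \<in> carrier torus"
  shows "\<exists>\<theta>\<in>cbox 0 (\<chi> j. 2 * pi). t = torus_exp \<theta>"
proof -
  obtain \<theta> where "t = torus_exp \<theta>" "\<And>i. 0 \<le> \<theta>$i" "\<And>i. \<theta>$i \<le> 2 * pi"
    using torus_exp_surj[OF assms] by blast
  then show ?thesis by (intro bexI[of _ \<theta>]) (auto simp: mem_box_cart)
qed

context oriented_torus_manifold
begin

text \<open>As a partial derivative of the joint map in angle and point, the differential inherits
  continuity in the torus element.\<close>

lemma tact_partial: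
  assumes c: "c \<in> charts" "p \<in> fst c" and d: "d \<in> charts" "act (torus_exp \<theta>) p \<in> fst d"
  shows "tact c d (torus_exp \<theta>) p u =
    frechet_derivative (\<lambda>z. snd d (act (torus_exp (fst z)) (cinv c (snd z)))) (at (\<theta>, snd c p)) (0, u)"
proof -
  let ?H = "\<lambda>z. snd d (act (torus_exp (fst z)) (cinv c (snd z)))"
  have "((\<lambda>y. (\<theta>, y)) has_derivative (\<lambda>u. (0, u))) (at (snd c p))"
    by (auto intro!: derivative_eq_intros)
  from has_derivative_compose[OF this smooth_at_has_derivative[OF smooth_act[OF c(1) d(1) c(2) d(2)]]]
  have "((\<lambda>y. snd d (act (torus_exp \<theta>) (cinv c y))) has_derivative
      (\<lambda>u. frechet_derivative ?H (at (\<theta>, snd c p)) (0, u))) (at (snd c p))" by simp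
  from frechet_derivative_at[OF this] show ?thesis by (simp add: tact_def fun_eq_iff)
qed

lemma isCont_tact_torus:
  assumes c: "c \<in> charts" "p \<in> fst c" and d: "d \<in> charts" "act (torus_exp \<theta>) p \<in> fst d"
  shows "isCont (\<lambda>\<theta>. tact c d (torus_exp \<theta>) p u) \<theta>"
proof -
  let ?H = "\<lambda>z. snd d (act (torus_exp (fst z)) (cinv c (snd z)))"
  have pair: "smooth_at (\<lambda>\<theta>. (\<theta>, snd c p)) \<theta>"
    by (intro smooth_at_Pair smooth_at_const smooth_at_ident)
  have "smooth_at (\<lambda>\<theta>. frechet_derivative ?H (at (\<theta>, snd c p)) (0, u)) \<theta>"
    by (rule smooth_at_compose[OF pair smooth_at_deriv[OF smooth_act[OF c(1) d(1) c(2) d(2)]]])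
  moreover have "\<forall>\<^sub>F \<theta> in nhds \<theta>. frechet_derivative ?H (at (\<theta>, snd c p)) (0, u) = tact c d (torus_exp \<theta>) p u"
  proof -
    have "\<forall>\<^sub>F z in nhds (\<theta>, snd c p). snd z \<in> snd c ` fst c \<and> act (torus_exp (fst z)) (cinv c (snd z)) \<in> fst d"
      using eventually_act[OF c chart_open[OF d(1)] d(2)] .
    then have "\<forall>\<^sub>F \<theta> in nhds \<theta>. snd (\<theta>, snd c p) \<in> snd c ` fst c \<and>
        act (torus_exp (fst (\<theta>, snd c p))) (cinv c (snd (\<theta>, snd c p))) \<in> fst d"
      by (rule eventually_compose_isCont) (intro continuous_intros)
    then show ?thesis
      by eventually_elim (simp add: tact_partial[OF c d(1)] cinv_chart[OF c])
  qed
  ultimately show ?thesis by (intro smooth_at_isCont) (rule smooth_at_cong)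
qed

lemma isCont_tact_param:
  fixes \<kappa> :: "'z::euclidean_space \<Rightarrow> 'a"
  assumes \<kappa>: "smooth_into \<kappa>" and c: "c \<in> charts" "\<kappa> x \<in> fst c" and d: "d \<in> charts" "act t (\<kappa> x) \<in> fst d"
    and t: "t \<in> carrier torus"
  shows "isCont (\<lambda>x. tact c d t (\<kappa> x) u) x"
  unfolding tact_def
  by (rule smooth_at_isCont, rule smooth_at_compose[OF smooth_intoD(3)[OF \<kappa> c]])
     (rule smooth_at_deriv[OF smooth_act_at[OF c(1) d(1) c(2) d(2) t]])

lemma fixed_pointD:
  assumes "v \<in> fixed_points X act"
  shows "v \<in> topspace X" "t \<in> carrier torus \<Longrightarrow> act t v = v"
  using assms by (auto simp: fixed_points_def)

section \<open>The isotropy representation and linearization near a fixed point\<close>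

context
  fixes v c
  assumes v: "v \<in> fixed_points X act" and c: "c \<in> charts" "v \<in> fst c"
begin

lemma isotropy_linear: "t \<in> carrier torus \<Longrightarrow> linear (tact c c t v)"
  using tact_linear[OF c(1) c(1) c(2)] c(2) fixed_pointD[OF v] by simp

lemma isotropy_mult:
  "s \<in> carrier torus \<Longrightarrow> t \<in> carrier torus \<Longrightarrow> tact c c (s * t) v = tact c c s v \<circ> tact c c t v"
  using tact_chain[OF c _ c(1) _ _ c(1), of t s] c(2) fixed_pointD[OF v] by simp

lemma isotropy_one: "tact c c 1 v = id"
  by (rule tact_id[OF c])

lemma isotropy_continuous: "continuous_on S (\<lambda>\<theta>. tact c c (torus_exp \<theta>) v u)"
  using isCont_tact_torus[OF c c(1)] c(2) fixed_pointD[OF v] torus_exp_carrier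
  by (auto intro!: continuous_at_imp_continuous_on)

text \<open>Compactness of the torus. A constant is needed because the isotropy representation need
  not be orthogonal in the given chart.\<close>

lemma isotropy_bound: "\<exists>M>0. \<forall>t\<in>carrier torus. \<forall>u. norm (tact c c t v u) \<le> M * norm u"
proof -
  let ?Q = "cbox 0 (\<chi> j. 2 * pi) :: (real^'k) set"
  let ?f = "\<lambda>\<theta>. \<Sum>b\<in>Basis. norm (tact c c (torus_exp \<theta>) v b)"
  have "continuous_on ?Q ?f" by (intro continuous_intros isotropy_continuous)
  then have "bounded (?f ` ?Q)"
    by (intro compact_imp_bounded compact_continuous_image) auto
  then obtain M where M: "M > 0" "\<And>\<theta>. \<theta> \<in> ?Q \<Longrightarrow> \<bar>?f \<theta>\<bar> \<le> M"
    unfolding bounded_pos by (auto simp: image_iff)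
  have "norm (tact c c t v u) \<le> M * norm u" if t: "t \<in> carrier torus" for t u
  proof -
    obtain \<theta> where \<theta>: "t = torus_exp \<theta>" "\<theta> \<in> ?Q"
      using torus_exp_box[OF t] by blast
    have "norm (tact c c t v u) = norm (\<Sum>b\<in>Basis. (u \<bullet> b) *\<^sub>R tact c c t v b)"
      using linear_basis_expansion[OF isotropy_linear[OF t], of u] by simp
    also have "\<dots> \<le> (\<Sum>b\<in>Basis. norm u * norm (tact c c t v b))"
      by (intro sum_norm_le) (auto intro!: mult_right_mono Basis_le_norm)
    also have "\<dots> = norm u * ?f \<theta>" by (simp add: sum_distrib_left \<theta>(1))
    also have "\<dots> \<le> norm u * M" using M(2)[OF \<theta>(2)] by (intro mult_left_mono) auto
    finally show ?thesis by (simp add: mult.commute)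
  qed
  then show ?thesis using M(1) by blast
qed

text \<open>Strict differentiability in the point, uniformly in the torus element. Half of
  \<open>e\<close> is spent on the strict estimate for the joint map at \<open>\<theta>0\<close>,
  the other half on replacing its derivative at \<open>\<theta>0\<close> by the one at
  \<open>\<theta>\<close>.\<close>

lemma uniform_strict:
  assumes "e > 0"
  shows "\<exists>d>0. \<forall>\<theta>\<in>cbox 0 (\<chi> j. 2 * pi). \<forall>y\<in>ball (snd c v) d. \<forall>z\<in>ball (snd c v) d.
    norm (snd c (act (torus_exp \<theta>) (cinv c y)) - snd c (act (torus_exp \<theta>) (cinv c z))
      - tact c c (torus_exp \<theta>) v (y - z)) \<le> e * norm (y - z)"
proof (rule compact_uniform_radius)
  let ?H = "\<lambda>z. snd c (act (torus_exp (fst z)) (cinv c (snd z)))"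
  fix \<theta>0 :: "real^'k"
  have fix_exp: "act (torus_exp \<theta>) v \<in> fst c" for \<theta> using fixed_pointD[OF v] c by simp
  have H: "smooth_at ?H (\<theta>0, snd c v)" by (rule smooth_act[OF c(1) c(1) c(2) fix_exp])
  obtain d1 where d1: "d1 > 0" "\<And>x y. x \<in> ball (\<theta>0, snd c v) d1 \<Longrightarrow> y \<in> ball (\<theta>0, snd c v) d1 \<Longrightarrow>
      norm (?H x - ?H y - frechet_derivative ?H (at (\<theta>0, snd c v)) (x - y)) \<le> e / 2 * norm (x - y)"
    using smooth_at_strict[OF H half_gt_zero[OF assms]] by blast
  obtain d2 where d2: "d2 > 0" "\<And>x. dist x (\<theta>0, snd c v) < d2 \<Longrightarrow>
      smooth_at ?H x \<and> onorm (\<lambda>w. frechet_derivative ?H (at x) w - frechet_derivative ?H (at (\<theta>0, snd c v)) w) \<le> e / 2"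
    using eventually_conj[OF smooth_at_eventually[OF H] smooth_at_deriv_onorm[OF H half_gt_zero[OF assms]]]
    unfolding eventually_nhds_metric by blast
  define d where "d = min d1 d2 / 2"
  have d: "d > 0" "2 * d \<le> d1" "d < d2" using d1(1) d2(1) by (auto simp: d_def)
  show "\<exists>d>0. \<forall>\<theta>\<in>ball \<theta>0 d. \<forall>y\<in>ball (snd c v) d. \<forall>z\<in>ball (snd c v) d.
    norm (snd c (act (torus_exp \<theta>) (cinv c y)) - snd c (act (torus_exp \<theta>) (cinv c z))
      - tact c c (torus_exp \<theta>) v (y - z)) \<le> e * norm (y - z)"
  proof (intro exI conjI ballI)
    fix \<theta> y z assume \<theta>: "\<theta> \<in> ball \<theta>0 d" and yz: "y \<in> ball (snd c v) d" "z \<in> ball (snd c v) d"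
    have near: "(\<theta>, y) \<in> ball (\<theta>0, snd c v) d1" if "y \<in> ball (snd c v) d" for y
    proof -
      have "dist (\<theta>0, snd c v) (\<theta>, y) \<le> dist \<theta>0 \<theta> + dist (snd c v) y"
        unfolding dist_Pair_Pair by (rule sqrt_sum_squares_le_sum) auto
      then show ?thesis using that \<theta> d(2) by simp
    qed
    let ?w = "(0, y - z) :: (real^'k) \<times> (real^'m)"
    let ?D = "\<lambda>x. frechet_derivative ?H (at x)"
    have "norm (?H (\<theta>, y) - ?H (\<theta>, z) - ?D (\<theta>0, snd c v) ?w) \<le> e / 2 * norm (y - z)"
      using d1(2)[OF near[OF yz(1)] near[OF yz(2)]] by (simp add: norm_Pair)
    moreover have "norm (?D (\<theta>, snd c v) ?w - ?D (\<theta>0, snd c v) ?w) \<le> e / 2 * norm (y - z)"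
    proof -
      have *: "dist (\<theta>, snd c v) (\<theta>0, snd c v) < d2"
        using \<theta> d(3) by (simp add: dist_Pair_Pair dist_commute)
      have "bounded_linear (\<lambda>w. ?D (\<theta>, snd c v) w - ?D (\<theta>0, snd c v) w)"
        using smooth_at_linear_deriv[of ?H] d2(2)[OF *] H
        by (intro linear_conv_bounded_linear[THEN iffD1] linear_compose_sub) auto
      then have "norm (?D (\<theta>, snd c v) ?w - ?D (\<theta>0, snd c v) ?w)
          \<le> onorm (\<lambda>w. ?D (\<theta>, snd c v) w - ?D (\<theta>0, snd c v) w) * norm ?w"
        by (rule onorm)
      also have "\<dots> \<le> e / 2 * norm ?w"
        using d2(2)[OF *] by (intro mult_right_mono) auto
      finally show ?thesis by (simp add: norm_Pair)
    qed
    moreover have "?D (\<theta>, snd c v) ?w = tact c c (torus_exp \<theta>) v (y - z)"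
      by (rule tact_partial[OF c c(1) fix_exp, symmetric])
    moreover have "norm (a - b - x) \<le> norm (a - b - x0) + norm (x - x0)" for a b x x0 :: "real^'m"
    proof -
      have "a - b - x = (a - b - x0) - (x - x0)" by simp
      then show ?thesis by (metis norm_triangle_ineq4)
    qed
    from this[of "?H (\<theta>, y)" "?H (\<theta>, z)" "tact c c (torus_exp \<theta>) v (y - z)" "?D (\<theta>0, snd c v) ?w"]
    have "norm (?H (\<theta>, y) - ?H (\<theta>, z) - tact c c (torus_exp \<theta>) v (y - z))
      \<le> norm (?H (\<theta>, y) - ?H (\<theta>, z) - ?D (\<theta>0, snd c v) ?w)
        + norm (tact c c (torus_exp \<theta>) v (y - z) - ?D (\<theta>0, snd c v) ?w)" .
    ultimately show "norm (snd c (act (torus_exp \<theta>) (cinv c y)) - snd c (act (torus_exp \<theta>) (cinv c z))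
      - tact c c (torus_exp \<theta>) v (y - z)) \<le> e * norm (y - z)" by simp
  qed (rule d)
qed auto

text \<open>The tube lemma for the compact torus: orbits of points close to \<open>v\<close> stay in
  \<open>W\<close> as a whole.\<close>

lemma uniform_tube:
  assumes W: "openin X W" "v \<in> W"
  shows "\<exists>d>0. \<forall>t\<in>carrier torus. \<forall>y\<in>ball (snd c v) d. y \<in> snd c ` fst c \<and> act t (cinv c y) \<in> W"
proof -
  have "\<exists>d>0. \<forall>\<theta>\<in>cbox 0 (\<chi> j. 2 * pi). \<forall>y\<in>ball (snd c v) d.
    y \<in> snd c ` fst c \<and> act (torus_exp \<theta>) (cinv c y) \<in> W"
  proof (rule compact_uniform_radius)
    fix \<theta>0 :: "real^'k"
    have "act (torus_exp \<theta>0) v \<in> W" using fixed_pointD[OF v] W(2) by simp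
    from eventually_act[OF c W(1) this]
    obtain d where d: "d > 0" "\<And>z. dist z (\<theta>0, snd c v) < d \<Longrightarrow> snd z \<in> snd c ` fst c \<and> act (torus_exp (fst z)) (cinv c (snd z)) \<in> W"
      unfolding eventually_nhds_metric by blast
    show "\<exists>d>0. \<forall>\<theta>\<in>ball \<theta>0 d. \<forall>y\<in>ball (snd c v) d. y \<in> snd c ` fst c \<and> act (torus_exp \<theta>) (cinv c y) \<in> W"
    proof (intro exI[of _ "d/2"] conjI ballI)
      fix \<theta> y assume \<theta>: "\<theta> \<in> ball \<theta>0 (d/2)" and y: "y \<in> ball (snd c v) (d/2)"
      have "dist (\<theta>, y) (\<theta>0, snd c v) \<le> dist \<theta> \<theta>0 + dist y (snd c v)"
        unfolding dist_Pair_Pair by (rule sqrt_sum_squares_le_sum) auto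
      also have "\<dots> < d" using \<theta> y by (simp add: dist_commute)
      finally show "y \<in> snd c ` fst c" "act (torus_exp \<theta>) (cinv c y) \<in> W" using d(2)[of "(\<theta>, y)"] by auto
    qed (use d in auto)
  qed auto
  then obtain d where d: "d > 0" "\<And>\<theta> y. \<theta> \<in> cbox 0 (\<chi> j. 2 * pi) \<Longrightarrow> y \<in> ball (snd c v) d \<Longrightarrow>
    y \<in> snd c ` fst c \<and> act (torus_exp \<theta>) (cinv c y) \<in> W" by blast
  then show ?thesis using torus_exp_box by metis
qed

text \<open>Bochner linearization: averaging \<open>t\<^sup>-\<^sup>1 \<cdot> (t \<cdot> y)\<close> over the torus gives an equivariant
  perturbation of the identity, so that a fixed direction \<open>u\<close> of the isotropy representation
  is tangent to points with the same stabilizer.\<close>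

lemma fixed_direction_approx:
  assumes \<epsilon>: "\<epsilon> > 0" and r: "r > 0"
  shows "\<exists>s q. 0 < s \<and> s < r \<and> q \<in> fst c \<and> norm (snd c q - snd c v - s *\<^sub>R u) \<le> \<epsilon> * s \<and>
    (\<forall>t\<in>carrier torus. tact c c t v u = u \<longrightarrow> act t q = q)"
proof -
  let ?Q = "cbox 0 (\<chi> j. 2 * pi) :: (real^'k) set"
  let ?L = "\<lambda>t. tact c c t v"
  define y0 where "y0 = snd c v"
  define H where "H = (\<lambda>\<theta> y. snd c (act (torus_exp \<theta>) (cinv c y)))"
  obtain M where M: "M > 0" "\<And>t u. t \<in> carrier torus \<Longrightarrow> norm (?L t u) \<le> M * norm u"
    using isotropy_bound by blast
  \<comment> \<open>The bound 1/2 makes \<open>\<phi>\<close> a perturbation of the identity and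
    gives \<open>norm (z - y0) \<le> 2 * s * norm u\<close> below; the other bound then turns the
    error \<open>e * norm (z - y0)\<close> into \<open>\<epsilon> * s\<close>.\<close>
  define e where "e = min (1/2) (\<epsilon> / (2 * (norm u + 1)))"
  have nu: "0 < 2 * (norm u + 1)" by (simp add: add_nonneg_pos)
  have e: "e > 0" "e \<le> 1/2" "e * (2 * norm u) \<le> \<epsilon>"
  proof -
    show "e > 0" using \<epsilon> nu by (auto simp: e_def)
    show "e \<le> 1/2" unfolding e_def by (rule min.cobounded1)
    have "e * (2 * norm u) \<le> \<epsilon> / (2 * (norm u + 1)) * (2 * (norm u + 1))"
      using \<epsilon> nu by (intro mult_mono) (auto simp: e_def)
    then show "e * (2 * norm u) \<le> \<epsilon>" using nu by simp
  qed
  obtain d1 where d1: "d1 > 0" "\<And>\<theta> y z. \<theta> \<in> ?Q \<Longrightarrow> y \<in> ball y0 d1 \<Longrightarrow> z \<in> ball y0 d1 \<Longrightarrow>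
      norm (H \<theta> y - H \<theta> z - ?L (torus_exp \<theta>) (y - z)) \<le> e / M * norm (y - z)"
    using uniform_strict[of "e / M"] e(1) M(1) unfolding H_def y0_def by fastforce
  obtain d2 where d2: "d2 > 0" "\<And>t y. t \<in> carrier torus \<Longrightarrow> y \<in> ball y0 d2 \<Longrightarrow> y \<in> snd c ` fst c \<and> act t (cinv c y) \<in> fst c"
    using uniform_tube[OF chart_open[OF c(1)] c(2)] unfolding y0_def by blast
  \<comment> \<open>The estimate for \<open>\<phi>\<close> holds on the ball of radius
    \<open>min d1 d2\<close> and is used both at \<open>z\<close> and at its translate by
    \<open>t\<close>. Hence the smaller ball of radius \<open>d3\<close>, whose points have orbits
    inside \<open>W\<close>.\<close>
  define W where "W = {p \<in> fst c. snd c p \<in> ball y0 (min d1 d2)}"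
  have W: "openin X W" unfolding W_def by (rule openin_chart_preimage[OF c(1)]) auto
  have vW: "v \<in> W" using c(2) d1(1) d2(1) by (simp add: W_def y0_def)
  obtain d3 where d3: "d3 > 0" "\<And>t y. t \<in> carrier torus \<Longrightarrow> y \<in> ball y0 d3 \<Longrightarrow> act t (cinv c y) \<in> W"
    using uniform_tube[OF W vW] unfolding y0_def by blast
  define vol where "vol = measure lborel ?Q"
  have "box 0 (\<chi> j. 2 * pi) \<noteq> ({} :: (real^'k) set)"
    by (auto simp: box_ne_empty inner_axis Basis_vec_def)
  then have vol: "vol > 0" unfolding vol_def by (simp add: content_pos_lt_eq box_ne_empty)
  define G where "G = (\<lambda>y \<theta>. ?L (torus_exp (- \<theta>)) (H \<theta> y - y0))"
  define \<phi> where "\<phi> = (\<lambda>y. (1 / vol) *\<^sub>R integral ?Q (G y))"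
  have contG: "continuous_on UNIV (G y)" if y: "y \<in> ball y0 d2" for y
    unfolding G_def
  proof (rule continuous_on_linear_family[where L = "\<lambda>\<theta>. ?L (torus_exp (- \<theta>))" and w = "\<lambda>\<theta>. H \<theta> y - y0"])
    show "linear (?L (torus_exp (- \<theta>)))" for \<theta> by (simp add: isotropy_linear)
    show "continuous_on UNIV (\<lambda>\<theta>. ?L (torus_exp (- \<theta>)) w)" for w
      by (rule continuous_on_compose2[OF isotropy_continuous[of UNIV w], of _ uminus]) (auto intro: continuous_intros)
    have "isCont (\<lambda>\<theta>. H \<theta> y) \<theta>" for \<theta>
    proof -
      have q: "cinv c y \<in> fst c" "snd c (cinv c y) = y" "act (torus_exp \<theta>) (cinv c y) \<in> fst c"
        using d2(2)[OF _ y, of "torus_exp \<theta>"] chart_cinv[of y c] by auto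
      have "smooth_at (\<lambda>z. snd c (act (torus_exp (fst z)) (cinv c (snd z)))) (\<theta>, y)"
        using smooth_act[OF c(1) c(1) q(1,3)] q(2) by simp
      then have "smooth_at (\<lambda>\<theta>. H \<theta> y) \<theta>"
        using smooth_at_compose[OF smooth_at_Pair[OF smooth_at_ident smooth_at_const]] unfolding H_def by fastforce
      then show ?thesis by (rule smooth_at_isCont)
    qed
    then show "continuous_on UNIV (\<lambda>\<theta>. H \<theta> y - y0)"
      by (intro continuous_intros continuous_at_imp_continuous_on) auto
  qed
  have intG: "G y integrable_on ?Q" if "y \<in> ball y0 d2" for y
    using contG[OF that] continuous_on_subset integrable_continuous by blast
  have lip: "norm (\<phi> y - \<phi> z - (y - z)) \<le> e * norm (y - z)"
    if y: "y \<in> ball y0 (min d1 d2)" and z: "z \<in> ball y0 (min d1 d2)" for y z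
  proof -
    have yz: "y \<in> ball y0 d1" "y \<in> ball y0 d2" "z \<in> ball y0 d1" "z \<in> ball y0 d2" using y z by auto
    have "norm (integral ?Q (\<lambda>\<theta>. G y \<theta> - G z \<theta> - (y - z))) \<le> (e * norm (y - z)) * measure lborel ?Q"
    proof (rule integrable_bound)
      show "0 \<le> e * norm (y - z)" using e by simp
      show "(\<lambda>\<theta>. G y \<theta> - G z \<theta> - (y - z)) integrable_on ?Q"
        by (intro integrable_diff intG yz integrable_const)
      fix \<theta> assume \<theta>: "\<theta> \<in> ?Q"
      have "?L (torus_exp (- \<theta>)) (?L (torus_exp \<theta>) w) = w" for w
        using isotropy_mult[of "torus_exp (- \<theta>)" "torus_exp \<theta>"] isotropy_one
        by (simp add: torus_exp_minus fun_eq_iff)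
      moreover have "H \<theta> y - H \<theta> z - ?L (torus_exp \<theta>) (y - z)
          = (H \<theta> y - y0) - (H \<theta> z - y0) - ?L (torus_exp \<theta>) (y - z)" by simp
      ultimately have "G y \<theta> - G z \<theta> - (y - z) = ?L (torus_exp (- \<theta>)) (H \<theta> y - H \<theta> z - ?L (torus_exp \<theta>) (y - z))"
        by (simp only: G_def linear_diff[OF isotropy_linear[OF torus_exp_carrier]])
      then have "norm (G y \<theta> - G z \<theta> - (y - z)) \<le> M * norm (H \<theta> y - H \<theta> z - ?L (torus_exp \<theta>) (y - z))"
        using M(2)[of "torus_exp (- \<theta>)"] by simp
      also have "\<dots> \<le> M * (e / M * norm (y - z))"
        using d1(2)[OF \<theta> yz(1,3)] M(1) by (intro mult_left_mono) auto
      finally show "norm (G y \<theta> - G z \<theta> - (y - z)) \<le> e * norm (y - z)" using M(1) by simp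
    qed
    moreover have "integral ?Q (\<lambda>\<theta>. G y \<theta> - G z \<theta> - (y - z)) = integral ?Q (G y) - integral ?Q (G z) - vol *\<^sub>R (y - z)"
      by (subst integral_diff[OF integrable_diff[OF intG[OF yz(2)] intG[OF yz(4)]] integrable_const])
         (simp add: integral_diff[OF intG[OF yz(2)] intG[OF yz(4)]] vol_def)
    moreover have "\<phi> y - \<phi> z - (y - z) = (1 / vol) *\<^sub>R (integral ?Q (G y) - integral ?Q (G z) - vol *\<^sub>R (y - z))"
      using vol by (simp add: \<phi>_def algebra_simps)
    ultimately have "norm (\<phi> y - \<phi> z - (y - z)) \<le> (1 / vol) * (e * norm (y - z) * vol)"
      using vol unfolding vol_def[symmetric] by (simp add: pos_divide_le_eq)
    then show ?thesis using vol by simp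
  qed
  have "H \<theta> y0 = y0" for \<theta>
    unfolding H_def y0_def using c fixed_pointD[OF v] cinv_chart[OF c] by simp
  then have \<phi>0: "\<phi> y0 = 0" by (simp add: \<phi>_def G_def linear_0 isotropy_linear)
  define d where "d = min (min d1 d2) d3 / 2"
  have d: "d > 0" "d < min d1 d2" "d < d3" using d1(1) d2(1) d3(1) by (auto simp: d_def)
  \<comment> \<open>Ensures \<open>norm (s *\<^sub>R u) \<le> d / 2\<close>, which is at most
    \<open>(1 - e) * d\<close>, the range reached by \<open>perturbed_identity_surj\<close>.\<close>
  define s where "s = min (r / 2) (d / (2 * (norm u + 1)))"
  have s: "s > 0" "s < r" "norm (s *\<^sub>R u) \<le> (1 - e) * d"
  proof -
    show "s > 0" "s < r" using r d(1) nu by (auto simp: s_def)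
    have "norm (s *\<^sub>R u) \<le> d / (2 * (norm u + 1)) * (norm u + 1)"
      unfolding norm_scaleR using \<open>s > 0\<close> nu d(1) by (intro mult_mono) (auto simp: s_def)
    also have "\<dots> = (1/2) * d"
      using nu by (simp add: field_simps)
    also have "\<dots> \<le> (1 - e) * d" using e(2) d(1) by (intro mult_right_mono) auto
    finally show "norm (s *\<^sub>R u) \<le> (1 - e) * d" .
  qed
  have sub: "cball y0 d \<subseteq> ball y0 (min d1 d2)" "cball y0 d \<subseteq> ball y0 d3" using d by auto
  obtain z where z: "z \<in> cball y0 d" "\<phi> z = \<phi> y0 + s *\<^sub>R u"
    using perturbed_identity_surj[of e d y0 \<phi> "s *\<^sub>R u"] lip sub(1) e d s(3) by fastforce
  have zb: "z \<in> ball y0 (min d1 d2)" "z \<in> ball y0 d2" "z \<in> ball y0 d3" "y0 \<in> ball y0 (min d1 d2)"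
    using z(1) sub d by auto
  define q where "q = cinv c z"
  have q: "q \<in> fst c" "snd c q = z"
    using d2(2)[OF torus_one_closed zb(2)] chart_cinv[of z c] by (auto simp: q_def)
  have qX: "q \<in> topspace X" by (rule chart_subset[OF c(1) q(1)])
  show ?thesis
  proof (intro exI conjI ballI impI)
    show "0 < s" "s < r" "q \<in> fst c" using s q by auto
    have l: "norm (s *\<^sub>R u - (z - y0)) \<le> e * norm (z - y0)"
      using lip[OF zb(1,4)] z(2) by simp
    have "norm (z - y0) \<le> norm (s *\<^sub>R u) + norm (s *\<^sub>R u - (z - y0))"
      using norm_triangle_ineq4[of "s *\<^sub>R u" "s *\<^sub>R u - (z - y0)"] by simp
    also have "\<dots> \<le> s * norm u + 1/2 * norm (z - y0)"
      using l mult_right_mono[OF e(2) norm_ge_zero[of "z - y0"]] s(1) by simp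
    finally have "norm (z - y0) \<le> s * (2 * norm u)" by simp
    then have "e * norm (z - y0) \<le> s * (e * (2 * norm u))"
      using mult_left_mono[of _ _ e] e(1) by (simp add: mult.left_commute)
    also have "\<dots> \<le> s * \<epsilon>" using e(3) s(1) by (intro mult_left_mono) auto
    finally have "norm (s *\<^sub>R u - (z - y0)) \<le> \<epsilon> * s" using l by (simp add: mult.commute)
    then show "norm (snd c q - snd c v - s *\<^sub>R u) \<le> \<epsilon> * s"
      unfolding q(2) y0_def[symmetric] by (simp add: norm_minus_commute)
    fix t assume t: "t \<in> carrier torus" and fixu: "?L t u = u"
    obtain \<eta> where \<eta>: "t = torus_exp \<eta>" using torus_exp_surj[OF t] by blast
    have tW: "act t q \<in> W" using d3(2)[OF t zb(3)] by (simp add: q_def)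
    define z' where "z' = snd c (act t q)"
    have z': "z' \<in> ball y0 (min d1 d2)" "cinv c z' = act t q" "act t q \<in> fst c"
      using tW cinv_chart[OF c(1), of "act t q"] by (auto simp: W_def z'_def)
    \<comment> \<open>Substituting \<open>\<theta> + \<eta>\<close> gives equivariance of
      \<open>\<phi>\<close> at \<open>z\<close>. As \<open>t\<close> fixes \<open>u\<close>, the
      values of \<open>\<phi>\<close> at \<open>z\<close> and \<open>z'\<close> agree, and
      \<open>e < 1\<close> makes \<open>\<phi>\<close> injective there.\<close>
    have "G z' \<theta> = ?L t (G z (\<theta> + \<eta>))" for \<theta>
    proof -
      have H: "H \<theta> z' = H (\<theta> + \<eta>) z"
        unfolding H_def z'(2) torus_exp_add q_def[symmetric] \<eta>[symmetric] by (simp add: act_mult t qX)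
      have "torus_exp (- \<theta>) = t * torus_exp (- (\<theta> + \<eta>))"
        unfolding \<eta> torus_exp_add[symmetric] by simp
      then have "?L (torus_exp (- \<theta>)) = ?L t \<circ> ?L (torus_exp (- (\<theta> + \<eta>)))"
        using isotropy_mult[OF t] by simp
      then show ?thesis by (simp add: G_def H)
    qed
    then have "G z' = ?L t \<circ> (\<lambda>\<theta>. G z (\<theta> + \<eta>))" by (simp add: fun_eq_iff)
    then have "\<phi> z' = (1 / vol) *\<^sub>R integral ?Q (?L t \<circ> (\<lambda>\<theta>. G z (\<theta> + \<eta>)))"
      unfolding \<phi>_def by simp
    also have "integral ?Q (?L t \<circ> (\<lambda>\<theta>. G z (\<theta> + \<eta>))) = ?L t (integral ?Q (\<lambda>\<theta>. G z (\<theta> + \<eta>)))"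
    proof (rule integral_linear)
      have "continuous_on UNIV (\<lambda>\<theta>. G z (\<theta> + \<eta>))"
        by (rule continuous_on_compose2[OF contG[OF zb(2)]]) (auto intro: continuous_intros)
      then show "(\<lambda>\<theta>. G z (\<theta> + \<eta>)) integrable_on ?Q"
        using continuous_on_subset integrable_continuous by blast
      show "bounded_linear (?L t)" using isotropy_linear[OF t] linear_conv_bounded_linear by blast
    qed
    also have "integral ?Q (\<lambda>\<theta>. G z (\<theta> + \<eta>)) = integral ?Q (G z)"
    proof (rule torus_integral_shift[OF contG[OF zb(2)]])
      fix x y :: "real^'k" assume "torus_exp x = torus_exp y"
      then show "G z x = G z y" using torus_exp_eq_minus[of x y] by (simp add: G_def H_def)
    qed
    also have "(1 / vol) *\<^sub>R ?L t (integral ?Q (G z)) = ?L t (\<phi> z)"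
      by (simp add: \<phi>_def linear_cmul[OF isotropy_linear[OF t]])
    also have "\<dots> = \<phi> z" using z(2) \<phi>0 fixu by (simp add: linear_cmul[OF isotropy_linear[OF t]])
    finally have "norm (z' - z) \<le> e * norm (z' - z)" 
      using lip[OF z'(1) zb(1)] by (simp add: norm_minus_commute)
    then have "(1 - e) * norm (z' - z) \<le> 0" by (simp add: algebra_simps)
    then have "z' = z" using e(2) by (simp add: mult_le_0_iff)
    then show "act t q = q" using inj_onD[OF chart_inj[OF c(1)] _ z'(3) q(1)] q(2) by (simp add: z'_def)
  qed
qed

end

end

section \<open>Invariant spheres\<close>

text \<open>Inverse of the stereographic projection, centred at the pole \<open>(0, \<epsilon>)\<close>.\<close>

definition stereo :: "real \<Rightarrow> complex \<Rightarrow> complex \<times> real" where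
  "stereo \<epsilon> \<zeta> = ((2 / (1 + (cmod \<zeta>)\<^sup>2)) *\<^sub>R \<zeta>, \<epsilon> * (1 - (cmod \<zeta>)\<^sup>2) / (1 + (cmod \<zeta>)\<^sup>2))"

definition stereo_chart :: "real \<Rightarrow> (complex \<times> real, complex) chart" where
  "stereo_chart \<epsilon> = (S2 - {(0, - \<epsilon>)}, \<lambda>(z, h). z / of_real (1 + \<epsilon> * h))"

lemma stereo_chart_atlas: "\<epsilon> \<in> {1, -1} \<Longrightarrow> stereo_chart \<epsilon> \<in> S2_atlas"
  by (auto simp: stereo_chart_def S2_atlas_def)

lemma S2_iff: "(z, h) \<in> S2 \<longleftrightarrow> (cmod z)\<^sup>2 + h\<^sup>2 = 1"
  by (simp add: S2_def norm_Pair real_sqrt_eq_1_iff)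

lemma stereo_denom: "1 + (cmod \<zeta>)\<^sup>2 > 0"
  by (simp add: add_pos_nonneg)

lemma stereo_in_S2:
  assumes "\<epsilon> \<in> {1, -1}"
  shows "stereo \<epsilon> \<zeta> \<in> S2 - {(0, - \<epsilon>)}"
proof -
  define r where "r = (cmod \<zeta>)\<^sup>2"
  have r: "r \<ge> 0" by (simp add: r_def)
  have e2: "\<epsilon>\<^sup>2 = 1" using assms by auto
  have "(2 / (1 + r) * cmod \<zeta>)\<^sup>2 + (\<epsilon> * (1 - r) / (1 + r))\<^sup>2 = (4 * r + (1 - r)\<^sup>2) / (1 + r)\<^sup>2"
    by (simp add: power_mult_distrib power_divide e2 r_def[symmetric] add_divide_distrib)
  also have "4 * r + (1 - r)\<^sup>2 = (1 + r)\<^sup>2" by (simp add: power2_eq_square algebra_simps)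
  finally have "(2 / (1 + r) * cmod \<zeta>)\<^sup>2 + (\<epsilon> * (1 - r) / (1 + r))\<^sup>2 = 1" using r by simp
  then have "stereo \<epsilon> \<zeta> \<in> S2"
    using r by (simp add: stereo_def S2_iff r_def[symmetric])
  moreover have "stereo \<epsilon> \<zeta> \<noteq> (0, - \<epsilon>)"
  proof
    assume "stereo \<epsilon> \<zeta> = (0, - \<epsilon>)"
    then have "(2 / (1 + r)) *\<^sub>R \<zeta> = 0" "\<epsilon> * (1 - r) / (1 + r) = - \<epsilon>"
      unfolding stereo_def r_def[symmetric] by simp_all
    then have "\<zeta> = 0" "\<epsilon> * (1 - r) / (1 + r) = - \<epsilon>" using r by auto
    then show False using assms by (auto simp: r_def)
  qed
  ultimately show ?thesis by blast
qed

lemma stereo_chart_stereo: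
  assumes "\<epsilon> \<in> {1, -1}"
  shows "snd (stereo_chart \<epsilon>) (stereo \<epsilon> \<zeta>) = \<zeta>"
proof -
  have "1 + \<epsilon> * (\<epsilon> * (1 - (cmod \<zeta>)\<^sup>2) / (1 + (cmod \<zeta>)\<^sup>2)) = 2 / (1 + (cmod \<zeta>)\<^sup>2)"
    using assms stereo_denom[of \<zeta>] by (auto simp: field_simps)
  then show ?thesis using stereo_denom[of \<zeta>]
    by (simp add: stereo_chart_def stereo_def scaleR_conv_of_real del: of_real_add of_real_divide of_real_power)
qed

lemma stereo_stereo_chart:
  assumes e: "\<epsilon> \<in> {1, -1}" and p: "p \<in> S2 - {(0, - \<epsilon>)}"
  shows "stereo \<epsilon> (snd (stereo_chart \<epsilon>) p) = p"
proof -
  obtain z h where zh: "p = (z, h)" by (cases p)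
  have S: "(cmod z)\<^sup>2 + h\<^sup>2 = 1" using p by (simp add: zh S2_iff)
  have nz: "1 + \<epsilon> * h \<noteq> 0"
  proof
    assume *: "1 + \<epsilon> * h = 0"
    then have "h = - \<epsilon>" using e by auto
    then have "cmod z = 0" using S e by auto
    then show False using \<open>h = - \<epsilon>\<close> p zh by simp
  qed
  have e2: "\<epsilon> * \<epsilon> = 1" using e by auto
  define \<zeta> where "\<zeta> = z / of_real (1 + \<epsilon> * h)"
  have "(cmod \<zeta>)\<^sup>2 = (cmod z)\<^sup>2 / (1 + \<epsilon> * h)\<^sup>2"
    by (simp only: \<zeta>_def norm_divide power_divide norm_of_real power2_abs)
  also have "(cmod z)\<^sup>2 = (1 - \<epsilon> * h) * (1 + \<epsilon> * h)"
  proof -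
    have "(1 - \<epsilon> * h) * (1 + \<epsilon> * h) = 1 - (\<epsilon> * \<epsilon>) * h\<^sup>2" by (simp add: power2_eq_square algebra_simps)
    then show ?thesis using S e2 by simp
  qed
  finally have r: "(cmod \<zeta>)\<^sup>2 = (1 - \<epsilon> * h) / (1 + \<epsilon> * h)" using nz by (simp add: power2_eq_square)
  have d: "1 + (cmod \<zeta>)\<^sup>2 = 2 / (1 + \<epsilon> * h)" "1 - (cmod \<zeta>)\<^sup>2 = 2 * (\<epsilon> * h) / (1 + \<epsilon> * h)"
    using nz by (simp_all add: r field_simps)
  have "(2 / (1 + (cmod \<zeta>)\<^sup>2)) *\<^sub>R \<zeta> = z"
  proof -
    have "2 / (1 + (cmod \<zeta>)\<^sup>2) = 1 + \<epsilon> * h" using nz by (simp add: d)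
    then show ?thesis using nz
      by (simp only: scaleR_conv_of_real \<zeta>_def times_divide_eq_right nonzero_mult_div_cancel_left of_real_eq_0_iff not_False_eq_True)
  qed
  moreover have "\<epsilon> * (1 - (cmod \<zeta>)\<^sup>2) / (1 + (cmod \<zeta>)\<^sup>2) = h"
    unfolding d using nz e2 by (simp add: mult.assoc[symmetric])
  ultimately show ?thesis 
    unfolding zh stereo_chart_def snd_conv case_prod_conv \<zeta>_def[symmetric] stereo_def by (rule arg_cong2)
qed

lemma stereo_chart_image: "\<epsilon> \<in> {1, -1} \<Longrightarrow> inj_on (snd (stereo_chart \<epsilon>)) (fst (stereo_chart \<epsilon>))"
  by (rule inj_on_inverseI[where g = "stereo \<epsilon>"]) (simp add: stereo_stereo_chart stereo_chart_def[of \<epsilon>, THEN arg_cong[of _ _ fst]])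

lemma stereo_chart_inv:
  assumes "\<epsilon> \<in> {1, -1}"
  shows "inv_into (fst (stereo_chart \<epsilon>)) (snd (stereo_chart \<epsilon>)) \<zeta> = stereo \<epsilon> \<zeta>"
proof -
  have "stereo \<epsilon> \<zeta> \<in> fst (stereo_chart \<epsilon>)" using stereo_in_S2[OF assms] by (simp add: stereo_chart_def)
  from inv_into_f_f[OF stereo_chart_image[OF assms] this] show ?thesis
    by (simp add: stereo_chart_stereo[OF assms])
qed

lemma inj_stereo: "\<epsilon> \<in> {1, -1} \<Longrightarrow> inj (stereo \<epsilon>)"
  by (rule inj_on_inverseI) (rule stereo_chart_stereo)

lemma stereo_0: "stereo \<epsilon> 0 = (0, \<epsilon>)"
  by (simp add: stereo_def)

lemma rotation_stereo: "cmod s = 1 \<Longrightarrow> rotation s (stereo \<epsilon> \<zeta>) = stereo \<epsilon> (s * \<zeta>)"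
  by (simp add: rotation_def stereo_def norm_mult)

text \<open>The transition between the two stereographic charts is inversion in the unit circle. It
  reverses orientation, which is the origin of the sign contributed by the plane of an edge.\<close>

lemma stereo_antipole:
  assumes "\<zeta> \<noteq> 0"
  shows "stereo (- \<epsilon>) (1 / cnj \<zeta>) = stereo \<epsilon> \<zeta>"
proof -
  define r where "r = (cmod \<zeta>)\<^sup>2"
  have r: "r > 0" using assms by (simp add: r_def)
  have "1 / cnj \<zeta> = (1 / r) *\<^sub>R \<zeta>"
  proof -
    have "complex_of_real r = \<zeta> * cnj \<zeta>" by (simp only: r_def complex_norm_square)
    then show ?thesis using assms by (simp add: scaleR_conv_of_real)
  qed
  moreover have "(cmod (1 / cnj \<zeta>))\<^sup>2 = 1 / r" by (simp add: r_def norm_divide power_divide)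
  moreover have "1 - 1 / r = - ((1 - r) / r)" "1 + 1 / r = (1 + r) / r"
    using r by (simp_all add: field_simps)
  ultimately show ?thesis
    using r unfolding stereo_def r_def[symmetric] by simp
qed

lemma continuous_stereo: "continuous_on S (stereo \<epsilon>)"
  unfolding stereo_def using stereo_denom by (intro continuous_intros) (auto simp: less_imp_neq[symmetric])

lemma open_stereo_image:
  assumes e: "\<epsilon> \<in> {1, -1}" and S: "open S"
  shows "openin (top_of_set S2) (stereo \<epsilon> ` S)"
proof -
  let ?Y = "S2 - {(0, - \<epsilon>)}" and ?f = "snd (stereo_chart \<epsilon>)"
  have cont: "continuous_on ?Y ?f"
  proof -
    have "1 + \<epsilon> * snd p \<noteq> 0" if p: "p \<in> ?Y" for p
    proof
      assume *: "1 + \<epsilon> * snd p = 0"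
      obtain \<zeta> where "p = stereo \<epsilon> \<zeta>" using stereo_stereo_chart[OF e p] by metis
      then have "1 + \<epsilon> * snd p = 2 / (1 + (cmod \<zeta>)\<^sup>2)"
        using e stereo_denom[of \<zeta>] by (auto simp: stereo_def field_simps)
      then show False using * stereo_denom[of \<zeta>] by simp
    qed
    then have "\<forall>p\<in>?Y. complex_of_real (1 + \<epsilon> * snd p) \<noteq> 0" unfolding of_real_eq_0_iff by blast
    then show ?thesis unfolding stereo_chart_def case_prod_unfold snd_conv
      by (intro continuous_intros)
  qed
  have "stereo \<epsilon> ` S = ?Y \<inter> ?f -` S"
  proof (intro equalityI subsetI)
    fix p assume "p \<in> stereo \<epsilon> ` S"
    then obtain \<zeta> where "p = stereo \<epsilon> \<zeta>" "\<zeta> \<in> S" by blast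
    then show "p \<in> ?Y \<inter> ?f -` S" using stereo_in_S2[OF e, of \<zeta>] stereo_chart_stereo[OF e, of \<zeta>] by simp
  next
    fix p assume "p \<in> ?Y \<inter> ?f -` S"
    then show "p \<in> stereo \<epsilon> ` S"
      using stereo_stereo_chart[OF e, of p] by (intro image_eqI[of _ _ "?f p"]) auto
  qed
  also have "openin (top_of_set ?Y) \<dots>" by (rule continuous_openin_preimage_gen[OF cont S])
  finally have "openin (top_of_set ?Y) (stereo \<epsilon> ` S)" .
  moreover have "openin (top_of_set S2) ?Y" by (simp add: openin_delete)
  ultimately show ?thesis by (rule openin_trans)
qed

context oriented_torus_manifold
begin

lemma smooth_intoI_A:
  assumes "\<And>x. \<kappa> x \<in> topspace X" "\<And>W x. openin X W \<Longrightarrow> \<kappa> x \<in> W \<Longrightarrow> \<forall>\<^sub>F y in nhds x. \<kappa> y \<in> W"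
    and sm: "\<And>x c. c \<in> A \<Longrightarrow> \<kappa> x \<in> fst c \<Longrightarrow> smooth_at (\<lambda>x. snd c (\<kappa> x)) x"
  shows "smooth_into \<kappa>"
  unfolding smooth_into_def
proof (intro conjI allI ballI impI assms(1))
  fix x d assume d: "d \<in> charts" "\<kappa> x \<in> fst d"
  obtain c where c: "c \<in> A" "\<kappa> x \<in> fst c" using ex_chart_A[OF assms(1)] by blast
  then have cc: "c \<in> charts" by simp
  have "smooth_at (\<lambda>x. snd d (cinv c (snd c (\<kappa> x)))) x"
    by (rule smooth_at_compose[OF sm[OF c] smooth_transition[OF cc d(1) c(2) d(2)]])
  moreover have "\<forall>\<^sub>F x in nhds x. snd d (cinv c (snd c (\<kappa> x))) = snd d (\<kappa> x)"
    using assms(2)[OF chart_open[OF cc] c(2)] by eventually_elim (simp add: cinv_chart[OF cc])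
  ultimately show "smooth_at (\<lambda>x. snd d (\<kappa> x)) x" by (rule smooth_at_cong)
qed (use assms(2) in blast)

lemma tact_left_inverse:
  assumes c: "c \<in> charts" "p \<in> fst c" and d: "d \<in> charts" "act t p \<in> fst d"
    and t: "t \<in> carrier torus" "s \<in> carrier torus" "s * t = 1"
  shows "tact d c s (act t p) (tact c d t p u) = u"
proof -
  have "act s (act t p) = p"
    using act_mult[OF t(2,1)] t(3) act_one chart_subset[OF c] by metis
  then have "tact c c 1 p = tact d c s (act t p) \<circ> tact c d t p"
    using tact_chain[OF c t(1) d t(2) c(1)] c(2) t(3) by simp
  then show ?thesis using tact_id[OF c] by (simp add: fun_eq_iff)
qed

lemma tact_inj:
  assumes c: "c \<in> charts" "p \<in> fst c" and d: "d \<in> charts" "act t p \<in> fst d" and t: "t \<in> carrier torus"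
  shows "inj (tact c d t p)"
proof -
  obtain \<theta> where \<theta>: "t = torus_exp \<theta>" using torus_exp_surj[OF t] by blast
  show ?thesis
    by (rule inj_on_inverseI[where g = "tact d c (torus_exp (- \<theta>)) (act t p)"],
        rule tact_left_inverse[OF c d t torus_exp_carrier])
       (simp add: \<theta> torus_exp_minus)
qed

text \<open>The data of an equivariant embedding of the sphere: \<open>\<kappa> \<epsilon>\<close>
  maps the complex plane onto \<open>N\<close> without one pole and sends 0 to the other pole. The
  last clause says that points of \<open>N\<close> close to
  \<open>\<kappa> \<epsilon> \<zeta>\<close> in \<open>X\<close> have parameters close to
  \<open>\<zeta>\<close>.\<close>

definition rotation_param :: "'a set \<Rightarrow> int^'k \<Rightarrow> (real \<Rightarrow> complex \<Rightarrow> 'a) \<Rightarrow> bool" where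
  "rotation_param N a \<kappa> \<longleftrightarrow> compactin X N \<and> connectedin X N \<and>
    (\<forall>\<epsilon>\<in>{1,-1}. smooth_into (\<kappa> \<epsilon>) \<and>
      (\<forall>\<zeta>. \<forall>c\<in>charts. \<kappa> \<epsilon> \<zeta> \<in> fst c \<longrightarrow> inj (dchart c (\<kappa> \<epsilon>) \<zeta>)) \<and>
      inj (\<kappa> \<epsilon>) \<and>
      (\<forall>t\<in>carrier torus. \<forall>\<zeta>. act t (\<kappa> \<epsilon> \<zeta>) = \<kappa> \<epsilon> (character a t * \<zeta>)) \<and>
      N = insert (\<kappa> (- \<epsilon>) 0) (range (\<kappa> \<epsilon>)) \<and> \<kappa> (- \<epsilon>) 0 \<notin> range (\<kappa> \<epsilon>) \<and>
      (\<forall>\<zeta>. \<zeta> \<noteq> 0 \<longrightarrow> \<kappa> (- \<epsilon>) (1 / cnj \<zeta>) = \<kappa> \<epsilon> \<zeta>) \<and>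
      (\<forall>\<zeta>. \<forall>r>0. \<exists>W. openin X W \<and> \<kappa> \<epsilon> \<zeta> \<in> W \<and> N \<inter> W \<subseteq> \<kappa> \<epsilon> ` ball \<zeta> r))"

lemma character_norm: "t \<in> carrier torus \<Longrightarrow> cmod (character a t) = 1"
  by (erule torus_exp_surj) (simp add: character_exp)

lemma rotation_param_exists:
  assumes "has_rotation_label X A act N a"
  shows "\<exists>\<kappa>. rotation_param N a \<kappa>"
proof -
  obtain \<iota> where emb: "smooth_embedding (top_of_set S2) S2_atlas X A \<iota>" and N: "N = \<iota> ` S2"
    and rot: "\<And>t z. t \<in> carrier torus \<Longrightarrow> z \<in> S2 \<Longrightarrow> \<iota> (rotation (character a t) z) = act t (\<iota> z)"
    using assms unfolding has_rotation_label_def by blast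
  have cont: "continuous_map (top_of_set S2) X \<iota>"
    and smooth: "\<And>c d. c \<in> S2_atlas \<Longrightarrow> d \<in> A \<Longrightarrow> smooth_on (local_domain c d \<iota>) (local_map c d \<iota>)"
    and embm: "embedding_map (top_of_set S2) X \<iota>"
    and immersion: "\<And>c d y. c \<in> S2_atlas \<Longrightarrow> d \<in> A \<Longrightarrow> y \<in> local_domain c d \<iota> \<Longrightarrow>
      inj (frechet_derivative (local_map c d \<iota>) (at y))"
    using emb unfolding smooth_embedding_def smooth_map_def by blast+
  have homeo: "homeomorphic_map (top_of_set S2) (subtopology X N) \<iota>"
    using embm by (simp add: embedding_map_def N)
  have inj\<iota>: "inj_on \<iota> S2" using homeomorphic_imp_injective_map[OF homeo] by simp
  define \<kappa> where "\<kappa> = (\<lambda>\<epsilon> \<zeta>. \<iota> (stereo \<epsilon> \<zeta>))"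
  have S2: "stereo \<epsilon> \<zeta> \<in> S2" if "\<epsilon> \<in> {1, -1}" for \<epsilon> \<zeta> using stereo_in_S2[OF that] by blast
  have contk: "continuous_map euclidean X (\<kappa> \<epsilon>)" if "\<epsilon> \<in> {1, -1}" for \<epsilon>
    using continuous_map_compose[OF _ cont, of euclidean "stereo \<epsilon>"] S2[OF that] continuous_stereo
    by (auto simp: \<kappa>_def o_def continuous_map_in_subtopology)
  have ev: "\<forall>\<^sub>F y in nhds x. \<kappa> \<epsilon> y \<in> W" if "\<epsilon> \<in> {1, -1}" "openin X W" "\<kappa> \<epsilon> x \<in> W" for \<epsilon> W x
    using openin_continuous_map_preimage[OF contk[OF that(1)] that(2)] that(3)
    by (auto simp: eventually_nhds intro!: exI[of _ "{x. \<kappa> \<epsilon> x \<in> W}"])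
  have top: "\<kappa> \<epsilon> x \<in> topspace X" if "\<epsilon> \<in> {1, -1}" for \<epsilon> x
    using continuous_map_image_subset_topspace[OF contk[OF that]] by auto
  have lmap: "local_map (stereo_chart \<epsilon>) d \<iota> = (\<lambda>\<zeta>. snd d (\<kappa> \<epsilon> \<zeta>))" if "\<epsilon> \<in> {1, -1}" for \<epsilon> d
    by (auto simp: local_map_def fun_eq_iff stereo_chart_inv[OF that] \<kappa>_def)
  have ldom: "\<zeta> \<in> local_domain (stereo_chart \<epsilon>) d \<iota>" if "\<epsilon> \<in> {1, -1}" "\<kappa> \<epsilon> \<zeta> \<in> fst d" for \<epsilon> d \<zeta>
    unfolding local_domain_def
    using that stereo_in_S2[OF that(1)] stereo_chart_stereo[OF that(1)]
    by (intro image_eqI[of _ _ "stereo \<epsilon> \<zeta>"]) (auto simp: \<kappa>_def stereo_chart_def)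
  have into: "smooth_into (\<kappa> \<epsilon>)" if e: "\<epsilon> \<in> {1, -1}" for \<epsilon>
  proof (rule smooth_intoI_A[OF top[OF e] ev[OF e]])
    fix x d assume d: "d \<in> A" "\<kappa> \<epsilon> x \<in> fst d"
    obtain S where S: "open S" "x \<in> S" "\<And>y. y \<in> S \<Longrightarrow> \<kappa> \<epsilon> y \<in> fst d"
      using ev[OF e chart_open[OF UnI1[OF d(1)]] d(2)] unfolding eventually_nhds by blast
    have sub: "S \<subseteq> local_domain (stereo_chart \<epsilon>) d \<iota>" using ldom[OF e] S(3) by blast
    show "smooth_at (\<lambda>x. snd d (\<kappa> \<epsilon> x)) x"
      using smooth_atI[OF smooth[OF stereo_chart_atlas[OF e] d(1)] S(1) sub S(2)] by (simp add: lmap[OF e])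
  qed
  have imm: "inj (dchart d (\<kappa> \<epsilon>) \<zeta>)" if e: "\<epsilon> \<in> {1, -1}" and d: "d \<in> charts" "\<kappa> \<epsilon> \<zeta> \<in> fst d" for \<epsilon> d \<zeta>
  proof -
    obtain c where c: "c \<in> A" "\<kappa> \<epsilon> \<zeta> \<in> fst c" using ex_chart_A[OF top[OF e]] by blast
    then have cc: "c \<in> charts" by simp
    have "inj (dchart c (\<kappa> \<epsilon>) \<zeta>)"
      using immersion[OF stereo_chart_atlas[OF e] c(1) ldom[OF e c(2)]] by (simp add: lmap[OF e] dchart_def)
    moreover have "act 1 (\<kappa> \<epsilon> \<zeta>) \<in> fst d" using act_one[OF top[OF e]] d(2) by simp
    ultimately show ?thesis
      unfolding dchart_change[OF into[OF e] cc c(2) d]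
      by (intro inj_compose tact_inj[OF cc c(2) d(1) _ torus_one_closed])
  qed
  have nb: "\<exists>W. openin X W \<and> \<kappa> \<epsilon> \<zeta> \<in> W \<and> N \<inter> W \<subseteq> \<kappa> \<epsilon> ` ball \<zeta> r" if e: "\<epsilon> \<in> {1, -1}" and r: "r > 0" for \<epsilon> \<zeta> r
  proof -
    have "openin (subtopology X N) (\<iota> ` stereo \<epsilon> ` ball \<zeta> r)"
      using homeomorphic_imp_open_map[OF homeo] open_stereo_image[OF e open_ball] unfolding open_map_def by blast
    then obtain W where W: "openin X W" "\<iota> ` stereo \<epsilon> ` ball \<zeta> r = W \<inter> N"
      unfolding openin_subtopology by blast
    have "\<kappa> \<epsilon> \<zeta> \<in> \<iota> ` stereo \<epsilon> ` ball \<zeta> r" using r by (auto simp: \<kappa>_def)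
    then show ?thesis using W by (intro exI[of _ W]) (auto simp: \<kappa>_def image_image)
  qed
  have whole: "N = insert (\<kappa> (- \<epsilon>) 0) (range (\<kappa> \<epsilon>))" "\<kappa> (- \<epsilon>) 0 \<notin> range (\<kappa> \<epsilon>)" if e: "\<epsilon> \<in> {1, -1}" for \<epsilon>
  proof -
    have "range (stereo \<epsilon>) = S2 - {(0, - \<epsilon>)}"
    proof (intro equalityI subsetI)
      fix p assume "p \<in> S2 - {(0, - \<epsilon>)}"
      from stereo_stereo_chart[OF e this] show "p \<in> range (stereo \<epsilon>)" by (metis rangeI)
    next
      fix p assume "p \<in> range (stereo \<epsilon>)"
      then obtain \<zeta> where "p = stereo \<epsilon> \<zeta>" by blast
      then show "p \<in> S2 - {(0, - \<epsilon>)}" using stereo_in_S2[OF e] by simp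
    qed
    moreover have "(0, - \<epsilon>) \<in> S2" using e by (auto simp: S2_iff)
    ultimately have eq: "S2 = insert (stereo (- \<epsilon>) 0) (range (stereo \<epsilon>))" and nin: "stereo (- \<epsilon>) 0 \<notin> range (stereo \<epsilon>)"
      by (auto simp: stereo_0)
    have "N = \<iota> ` insert (stereo (- \<epsilon>) 0) (range (stereo \<epsilon>))" unfolding N by (rule arg_cong[OF eq])
    then show "N = insert (\<kappa> (- \<epsilon>) 0) (range (\<kappa> \<epsilon>))" by (simp add: \<kappa>_def image_image)
    show "\<kappa> (- \<epsilon>) 0 \<notin> range (\<kappa> \<epsilon>)"
    proof
      assume "\<kappa> (- \<epsilon>) 0 \<in> range (\<kappa> \<epsilon>)"
      then obtain \<zeta> where "\<iota> (stereo (- \<epsilon>) 0) = \<iota> (stereo \<epsilon> \<zeta>)" by (auto simp: \<kappa>_def)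
      moreover have "stereo (- \<epsilon>) 0 \<in> S2" "stereo \<epsilon> \<zeta> \<in> S2" using S2 e by auto
      ultimately have "stereo (- \<epsilon>) 0 = stereo \<epsilon> \<zeta>" using inj_onD[OF inj\<iota>] by blast
      then show False using nin by simp
    qed
  qed
  have cmpt: "compactin X N" unfolding N
    by (rule image_compactin[OF _ cont]) (simp add: compactin_subtopology S2_def)
  have conn: "connectedin X N" unfolding N
    by (rule connectedin_continuous_map_image[OF cont]) (simp add: connectedin_subtopology S2_def connected_sphere)
  have injk: "inj (\<kappa> \<epsilon>)" if e: "\<epsilon> \<in> {1, -1}" for \<epsilon>
    using inj_stereo[OF e] inj\<iota> S2[OF e] unfolding \<kappa>_def inj_on_def by blast
  have actk: "act t (\<kappa> \<epsilon> \<zeta>) = \<kappa> \<epsilon> (character a t * \<zeta>)" if e: "\<epsilon> \<in> {1, -1}" and t: "t \<in> carrier torus" for \<epsilon> t \<zeta>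
    using rot[OF t S2[OF e]] rotation_stereo[OF character_norm[OF t]] by (simp add: \<kappa>_def)
  have anti: "\<kappa> (- \<epsilon>) (1 / cnj \<zeta>) = \<kappa> \<epsilon> \<zeta>" if "\<zeta> \<noteq> 0" for \<epsilon> \<zeta>
    using stereo_antipole[OF that] by (simp add: \<kappa>_def)
  show ?thesis
    unfolding rotation_param_def
    by (intro exI[of _ \<kappa>] conjI ballI allI impI)
       (assumption | rule cmpt conn into imm injk actk whole anti nb)+
qed

lemma rotation_paramD:
  assumes rp: "rotation_param N a \<kappa>" and e: "\<epsilon> \<in> {1, -1}"
  shows "smooth_into (\<kappa> \<epsilon>)"
    and "c \<in> charts \<Longrightarrow> \<kappa> \<epsilon> \<zeta> \<in> fst c \<Longrightarrow> inj (dchart c (\<kappa> \<epsilon>) \<zeta>)"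
    and "inj (\<kappa> \<epsilon>)"
    and "t \<in> carrier torus \<Longrightarrow> act t (\<kappa> \<epsilon> \<zeta>) = \<kappa> \<epsilon> (character a t * \<zeta>)"
    and "N = insert (\<kappa> (- \<epsilon>) 0) (range (\<kappa> \<epsilon>))"
    and "\<kappa> (- \<epsilon>) 0 \<notin> range (\<kappa> \<epsilon>)"
    and "\<zeta> \<noteq> 0 \<Longrightarrow> \<kappa> (- \<epsilon>) (1 / cnj \<zeta>) = \<kappa> \<epsilon> \<zeta>"
    and "r > 0 \<Longrightarrow> \<exists>W. openin X W \<and> \<kappa> \<epsilon> \<zeta> \<in> W \<and> N \<inter> W \<subseteq> \<kappa> \<epsilon> ` ball \<zeta> r"
proof -
  note all = bspec[OF conjunct2[OF conjunct2[OF rp[unfolded rotation_param_def]]] e]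
  note r1 = conjunct2[OF all] note r2 = conjunct2[OF r1] note r3 = conjunct2[OF r2]
  note r4 = conjunct2[OF r3] note r5 = conjunct2[OF r4] note r6 = conjunct2[OF r5]
  show "smooth_into (\<kappa> \<epsilon>)" by (rule conjunct1[OF all])
  show "c \<in> charts \<Longrightarrow> \<kappa> \<epsilon> \<zeta> \<in> fst c \<Longrightarrow> inj (dchart c (\<kappa> \<epsilon>) \<zeta>)"
    by (rule conjunct1[OF r1, rule_format])
  show "inj (\<kappa> \<epsilon>)" by (rule conjunct1[OF r2])
  show "t \<in> carrier torus \<Longrightarrow> act t (\<kappa> \<epsilon> \<zeta>) = \<kappa> \<epsilon> (character a t * \<zeta>)"
    by (rule conjunct1[OF r3, rule_format])
  show "N = insert (\<kappa> (- \<epsilon>) 0) (range (\<kappa> \<epsilon>))" by (rule conjunct1[OF r4])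
  show "\<kappa> (- \<epsilon>) 0 \<notin> range (\<kappa> \<epsilon>)" by (rule conjunct1[OF r5])
  show "\<zeta> \<noteq> 0 \<Longrightarrow> \<kappa> (- \<epsilon>) (1 / cnj \<zeta>) = \<kappa> \<epsilon> \<zeta>"
    by (rule conjunct1[OF r6, rule_format])
  show "r > 0 \<Longrightarrow> \<exists>W. openin X W \<and> \<kappa> \<epsilon> \<zeta> \<in> W \<and> N \<inter> W \<subseteq> \<kappa> \<epsilon> ` ball \<zeta> r"
    by (rule conjunct2[OF r6, rule_format])
qed

text \<open>Points of \<open>N\<close> in the direction \<open>u\<close> have small parameters
  \<open>\<zeta>\<close>, because \<open>N\<close> carries the subspace topology. The immersion
  bounds \<open>\<zeta>\<close> by a multiple of \<open>s\<close>, so \<open>?D\<close> comes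
  arbitrarily close to \<open>u\<close> at \<open>\<zeta> / s\<close>; the range of
  \<open>?D\<close> is closed.\<close>

lemma tangent_cone:
  assumes rp: "rotation_param N a \<kappa>" and e: "\<epsilon> \<in> {1, -1}" and c: "c \<in> charts" "\<kappa> \<epsilon> 0 \<in> fst c"
    and cone: "\<And>\<eta>. \<eta> > 0 \<Longrightarrow> \<exists>s q. 0 < s \<and> s < \<eta> \<and> q \<in> N \<and> q \<in> fst c \<and>
      norm (snd c q - snd c (\<kappa> \<epsilon> 0) - s *\<^sub>R u) \<le> \<eta> * s"
  shows "u \<in> range (dchart c (\<kappa> \<epsilon>) 0)"
proof -
  let ?D = "dchart c (\<kappa> \<epsilon>) 0" and ?y0 = "snd c (\<kappa> \<epsilon> 0)"
  note into = rotation_paramD(1)[OF rp e] and inj = rotation_paramD(2)[OF rp e c]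
    and nb = rotation_paramD(8)[OF rp e]
  have lin: "linear ?D" by (rule smooth_intoD(4)[OF into c])
  obtain b where b: "b > 0" "\<And>x. norm (?D x) \<ge> b * norm x"
    using linear_inj_bounded_below_pos[OF lin inj] by blast
  have "u \<in> closure (range ?D)"
    unfolding closure_approachable
  proof (intro allI impI)
    fix d :: real assume d: "d > 0"
    have nu: "norm u + 1 > 0" by (simp add: add_nonneg_pos)
    \<comment> \<open>The bound \<open>b / 2\<close> makes \<open>norm \<zeta>\<close> at most a
      multiple of \<open>s\<close>; the second bound then keeps the linearization error below
      \<open>d / 4 * s\<close>.\<close>
    define e1 where "e1 = min (b / 2) (d * b / (8 * (norm u + 1)))"
    have e1: "e1 > 0" "e1 \<le> b / 2" "e1 \<le> d * b / (8 * (norm u + 1))"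
      unfolding e1_def by (use b(1) d nu in \<open>simp_all only: min.cobounded1 min.cobounded2 min_less_iff_conj half_gt_zero_iff\<close>) simp
    obtain \<delta> where \<delta>: "\<delta> > 0" "\<And>\<zeta>. norm \<zeta> < \<delta> \<Longrightarrow> norm (snd c (\<kappa> \<epsilon> \<zeta>) - ?y0 - ?D \<zeta>) \<le> e1 * norm \<zeta>"
      using smooth_intoD(5)[OF into c, unfolded has_derivative_at_alt] e1(1) by (auto simp: linear_0[OF lin])
    obtain W where W: "openin X W" "\<kappa> \<epsilon> 0 \<in> W" "N \<inter> W \<subseteq> \<kappa> \<epsilon> ` ball 0 \<delta>" using nb[OF \<delta>(1)] by blast
    obtain \<rho> where \<rho>: "\<rho> > 0" "\<And>y. dist y ?y0 < \<rho> \<Longrightarrow> cinv c y \<in> W"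
      using eventually_chart[OF c W(1,2)] unfolding eventually_nhds_metric by blast
    \<comment> \<open>The bounds 1 and \<open>\<rho> / (norm u + 1)\<close> keep \<open>q\<close>
      inside \<open>W\<close>; \<open>d / 4\<close> is the share of the error that comes from the
      cone condition.\<close>
    define \<eta> where "\<eta> = min 1 (min (d / 4) (\<rho> / (norm u + 1)))"
    have \<eta>: "\<eta> > 0" "\<eta> \<le> 1" "\<eta> \<le> d / 4" "\<eta> \<le> \<rho> / (norm u + 1)"
    proof -
      have "\<eta> \<le> min (d / 4) (\<rho> / (norm u + 1))" unfolding \<eta>_def by (rule min.cobounded2)
      then show "\<eta> \<le> d / 4" "\<eta> \<le> \<rho> / (norm u + 1)" by (simp_all only: min.bounded_iff)
      show "\<eta> \<le> 1" unfolding \<eta>_def by (rule min.cobounded1)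
      show "\<eta> > 0" using d \<rho>(1) nu by (simp add: \<eta>_def)
    qed
    obtain s q where s: "0 < s" "s < \<eta>" and q: "q \<in> N" "q \<in> fst c" "norm (snd c q - ?y0 - s *\<^sub>R u) \<le> \<eta> * s"
      using cone[OF \<eta>(1)] by blast
    have "norm (snd c q - ?y0) \<le> norm (s *\<^sub>R u) + \<eta> * s"
      using norm_triangle_ineq[of "snd c q - ?y0 - s *\<^sub>R u" "s *\<^sub>R u"] q(3) by simp
    also have "\<dots> \<le> s * (norm u + 1)"
      using s(1) \<eta>(2) mult_right_mono[OF \<eta>(2), of s] by (simp add: algebra_simps)
    also have "\<dots> < \<rho>" using s(2) \<eta>(4) nu by (simp add: pos_le_divide_eq) (smt (verit) mult_less_cancel_right)
    finally have "q \<in> W" using \<rho>(2)[of "snd c q"] cinv_chart[OF c(1) q(2)] by (simp add: dist_norm)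
    then obtain \<zeta> where \<zeta>: "q = \<kappa> \<epsilon> \<zeta>" "norm \<zeta> < \<delta>" using W(3) q(1) by auto
    have diff: "norm (?D \<zeta> - s *\<^sub>R u) \<le> e1 * norm \<zeta> + \<eta> * s"
      using norm_triangle_ineq4[of "snd c q - ?y0 - s *\<^sub>R u" "snd c q - ?y0 - ?D \<zeta>"] q(3) \<delta>(2)[OF \<zeta>(2)] \<zeta>(1) by simp
    have "b * norm \<zeta> \<le> norm (s *\<^sub>R u) + (e1 * norm \<zeta> + \<eta> * s)"
      using b(2)[of \<zeta>] norm_triangle_ineq[of "s *\<^sub>R u" "?D \<zeta> - s *\<^sub>R u"] diff by simp
    also have "\<dots> \<le> s * norm u + (b / 2 * norm \<zeta> + 1 * s)"
      using s(1) e1(2) \<eta>(2) by (intro add_mono mult_right_mono) auto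
    finally have z: "b / 2 * norm \<zeta> \<le> s * (norm u + 1)" by (simp add: algebra_simps)
    have "e1 * norm \<zeta> \<le> d * b / (8 * (norm u + 1)) * norm \<zeta>" using e1(3) by (intro mult_right_mono) auto
    also have "\<dots> = d / (4 * (norm u + 1)) * (b / 2 * norm \<zeta>)" by simp
    also have "\<dots> \<le> d / (4 * (norm u + 1)) * (s * (norm u + 1))" using z d nu by (intro mult_left_mono) auto
    also have "\<dots> = d / 4 * s" using nu by (simp add: field_simps)
    finally have "norm (?D \<zeta> - s *\<^sub>R u) \<le> (d / 4 + \<eta>) * s" using diff by (simp add: algebra_simps)
    also have "\<dots> \<le> (d / 2) * s" using \<eta>(3) s(1) by (intro mult_right_mono) auto
    finally have "norm (?D \<zeta> - s *\<^sub>R u) / s \<le> d / 2" using s(1) by (simp add: pos_divide_le_eq)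
    moreover have "?D ((1/s) *\<^sub>R \<zeta>) - u = (1/s) *\<^sub>R (?D \<zeta> - s *\<^sub>R u)"
      using s(1) by (simp add: linear_cmul[OF lin] algebra_simps)
    then have "norm (?D ((1/s) *\<^sub>R \<zeta>) - u) = norm (?D \<zeta> - s *\<^sub>R u) / s" using s(1) by simp
    ultimately have "dist (?D ((1/s) *\<^sub>R \<zeta>)) u < d" using d unfolding dist_norm by linarith
    then show "\<exists>y\<in>range ?D. dist y u < d" by blast
  qed
  moreover have "closed (range ?D)" by (intro closed_subspace linear_subspace_image[OF lin subspace_UNIV])
  ultimately show ?thesis by (simp add: closure_closed)
qed

end

section \<open>Transport along invariant spheres\<close>

context oriented_torus_manifold
begin

text \<open>An orientation preserving isomorphism of representations of the group of
  \<open>g\<close> between the tangent spaces at \<open>p\<close> and \<open>p'\<close>, carrying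
  the parametrized plane \<open>D\<close> to \<open>D'\<close>. Tangent spaces are read in charts of
  \<open>B\<close>, where the sign of a determinant has a meaning.\<close>

definition transports :: "complex^'k \<Rightarrow> 'a \<Rightarrow> (('a, real^'m) chart \<Rightarrow> complex \<Rightarrow> real^'m) \<Rightarrow>
    'a \<Rightarrow> (('a, real^'m) chart \<Rightarrow> complex \<Rightarrow> real^'m) \<Rightarrow> bool" where
  "transports g p D p' D' \<longleftrightarrow> (\<forall>c\<in>B. \<forall>c'\<in>B. p \<in> fst c \<longrightarrow> p' \<in> fst c' \<longrightarrow>
    (\<exists>\<Psi>. linear \<Psi> \<and> det (matrix \<Psi>) > 0 \<and> (\<forall>u. \<Psi> (tact c c g p u) = tact c' c' g p' (\<Psi> u)) \<and>
      (\<forall>x. \<Psi> (D c x) = D' c' x)))"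

lemma transports_trans:
  assumes "transports g p D p' D'" "transports g p' D' p'' D''" "p' \<in> topspace X"
  shows "transports g p D p'' D''"
  unfolding transports_def
proof (intro ballI impI)
  fix c c'' assume c: "c \<in> B" "p \<in> fst c" and c'': "c'' \<in> B" "p'' \<in> fst c''"
  obtain c' where c': "c' \<in> B" "p' \<in> fst c'" using ex_chart_B[OF assms(3)] by blast
  obtain \<Psi> where \<Psi>: "linear \<Psi>" "det (matrix \<Psi>) > 0" "\<And>u. \<Psi> (tact c c g p u) = tact c' c' g p' (\<Psi> u)"
    "\<And>x. \<Psi> (D c x) = D' c' x"
    using assms(1) c c' unfolding transports_def by blast
  obtain \<Psi>' where \<Psi>': "linear \<Psi>'" "det (matrix \<Psi>') > 0" "\<And>u. \<Psi>' (tact c' c' g p' u) = tact c'' c'' g p'' (\<Psi>' u)"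
    "\<And>x. \<Psi>' (D' c' x) = D'' c'' x"
    using assms(2) c' c'' unfolding transports_def by blast
  show "\<exists>\<Psi>. linear \<Psi> \<and> det (matrix \<Psi>) > 0 \<and> (\<forall>u. \<Psi> (tact c c g p u) = tact c'' c'' g p'' (\<Psi> u)) \<and>
      (\<forall>x. \<Psi> (D c x) = D'' c'' x)"
    by (intro exI[of _ "\<Psi>' \<circ> \<Psi>"])
       (use \<Psi> \<Psi>' in \<open>simp add: linear_compose matrix_compose det_mul\<close>)
qed

lemma transports_sym:
  assumes "transports g p D p' D'"
  shows "transports g p' D' p D"
  unfolding transports_def
proof (intro ballI impI)
  fix c' c assume c: "c \<in> B" "p \<in> fst c" and c': "c' \<in> B" "p' \<in> fst c'"
  obtain \<Psi> where \<Psi>: "linear \<Psi>" "det (matrix \<Psi>) > 0" "\<And>u. \<Psi> (tact c c g p u) = tact c' c' g p' (\<Psi> u)"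
    "\<And>x. \<Psi> (D c x) = D' c' x"
    using assms c c' unfolding transports_def by blast
  have "invertible (matrix \<Psi>)" using \<Psi>(2) by (simp add: invertible_det_nz)
  then obtain \<Phi> where \<Phi>: "linear \<Phi>" "\<Psi> \<circ> \<Phi> = id" "\<Phi> \<circ> \<Psi> = id"
    using matrix_invertible[OF \<Psi>(1)] by blast
  have "matrix \<Psi> ** matrix \<Phi> = mat 1"
    using matrix_compose[OF \<Phi>(1) \<Psi>(1)] \<Phi>(2) by (simp add: matrix_id_mat_1)
  from arg_cong[OF this, of det] have "det (matrix \<Psi>) * det (matrix \<Phi>) = 1"
    by (simp only: det_mul det_I)
  then have "det (matrix \<Phi>) > 0" using \<Psi>(2) by (metis zero_less_mult_pos zero_less_one)
  moreover have inv: "\<Phi> (\<Psi> u) = u" "\<Psi> (\<Phi> u) = u" for u using \<Phi>(2,3) by (auto simp: fun_eq_iff)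
  moreover have "\<Phi> (tact c' c' g p' u) = tact c c g p (\<Phi> u)" for u
    using inv(1)[of "tact c c g p (\<Phi> u)"] \<Psi>(3)[of "\<Phi> u"] inv(2)[of u] by simp
  moreover have "\<Phi> (D' c' x) = D c x" for x using inv(1)[of "D c x"] \<Psi>(4) by simp
  ultimately show "\<exists>\<Psi>. linear \<Psi> \<and> det (matrix \<Psi>) > 0 \<and> (\<forall>u. \<Psi> (tact c' c' g p' u) = tact c c g p (\<Psi> u)) \<and>
      (\<forall>x. \<Psi> (D' c' x) = D c x)"
    using \<Phi>(1) by blast
qed

lemma transports_precompose:
  "transports g p D p' D' \<Longrightarrow> transports g p (\<lambda>c x. D c (\<phi> x)) p' (\<lambda>c x. D' c (\<phi> x))"
  unfolding transports_def by blast

lemma det_chart_change: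
  assumes "c \<in> B" "d \<in> B" "p \<in> fst c" "p \<in> fst d"
  shows "det (matrix (tact c d 1 p)) > 0"
proof -
  have c: "c \<in> charts" "d \<in> charts" using assms by auto
  have D: "((\<lambda>y. snd d (act 1 (cinv c y))) has_derivative tact c d 1 p) (at (snd c p))"
    unfolding tact_def
    by (rule smooth_at_has_derivative, rule smooth_act_at[OF c assms(3) _ torus_one_closed])
       (use act_one[OF chart_subset[OF c(1) assms(3)]] assms(4) in simp)
  have "\<forall>\<^sub>F y in nhds (snd c p). snd d (act 1 (cinv c y)) = transition c d y"
    using eventually_chart[OF c(1) assms(3) chart_open[OF c(1)] assms(3)]
    by eventually_elim (use act_one[OF chart_subset[OF c(1)]] in \<open>simp add: transition_def cinv_def\<close>)
  then obtain S where S: "open S" "snd c p \<in> S" "\<And>y. y \<in> S \<Longrightarrow> snd d (act 1 (cinv c y)) = transition c d y"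
    unfolding eventually_nhds by blast
  have "(transition c d has_derivative tact c d 1 p) (at (snd c p))"
    by (rule has_derivative_transform_within_open[OF D S])
  from frechet_derivative_at[OF this]
  have "tact c d 1 p = frechet_derivative (transition c d) (at (snd c p))" .
  then show ?thesis using oriented[OF assms(1,2), of "snd c p"] assms(3,4) by simp
qed

text \<open>Reflexivity. The two charts at \<open>p\<close> may differ, and then the change of
  charts, which commutes with the differential of \<open>g\<close>, is the isomorphism.\<close>

lemma transports_chart_change:
  assumes g: "g \<in> carrier torus" "act g p = p" and p: "p \<in> topspace X"
    and D: "\<And>c d x. c \<in> B \<Longrightarrow> d \<in> B \<Longrightarrow> p \<in> fst c \<Longrightarrow> p \<in> fst d \<Longrightarrow> D d x = tact c d 1 p (D c x)"
  shows "transports g p D p D"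
  unfolding transports_def
proof (intro ballI impI)
  fix c d assume c: "c \<in> B" "p \<in> fst c" and d: "d \<in> B" "p \<in> fst d"
  have cc: "c \<in> charts" "d \<in> charts" using c d by auto
  note one = torus_one_closed act_one[OF p]
  have "tact c d g p = tact c d 1 p \<circ> tact c c g p"
    using tact_chain[OF cc(1) c(2) g(1) cc(1) _ one(1) cc(2)] g(2) c(2) d(2) one(2) by simp
  moreover have "tact c d g p = tact d d g p \<circ> tact c d 1 p"
    using tact_chain[OF cc(1) c(2) one(1) cc(2) _ g(1) cc(2)] g(2) c(2) d(2) one(2) by simp
  ultimately have "tact c d 1 p (tact c c g p u) = tact d d g p (tact c d 1 p u)" for u
    by (metis comp_apply)
  moreover have "linear (tact c d 1 p)"
    using tact_linear[OF cc c(2) _ one(1)] d(2) one(2) by simp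
  ultimately show "\<exists>\<Psi>. linear \<Psi> \<and> det (matrix \<Psi>) > 0 \<and> (\<forall>u. \<Psi> (tact c c g p u) = tact d d g p (\<Psi> u)) \<and>
      (\<forall>x. \<Psi> (D c x) = D d x)"
    using det_chart_change[OF c(1) d(1) c(2) d(2)] D[OF c(1) d(1) c(2) d(2)] by (intro exI[of _ "tact c d 1 p"]) simp
qed

lemma tact_funpow:
  assumes g: "g \<in> carrier torus" "act g p = p" and c: "c \<in> charts" "p \<in> fst c"
  shows "(tact c c g p ^^ n) = tact c c (g ^ n) p"
proof (induction n)
  case 0
  then show ?case using tact_id[OF c] by simp
next
  case (Suc n)
  have "p \<in> topspace X" by (rule chart_subset[OF c])
  then have "act (g ^ n) p = p" by (rule act_power[OF g(1) _ g(2)])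
  then show ?case using tact_chain[OF c torus_power_closed[OF g(1)] c(1) _ g(1) c(1), of n] c(2) g(2) Suc by simp
qed

lemma param_fixed_derivative:
  fixes \<kappa> :: "complex \<Rightarrow> 'a"
  assumes \<kappa>: "smooth_into \<kappa>" and g: "g \<in> carrier torus" "\<And>\<zeta>. act g (\<kappa> \<zeta>) = \<kappa> \<zeta>"
    and c: "c \<in> charts" "\<kappa> \<zeta> \<in> fst c"
  shows "tact c c g (\<kappa> \<zeta>) (dchart c \<kappa> \<zeta> x) = dchart c \<kappa> \<zeta> x"
  using act_smooth_into(2)[OF \<kappa> g(1) c c(1)] c(2) g(2) by (simp add: fun_eq_iff)

text \<open>The relation between parameters is an equivalence relation whose classes are open by
  \<open>local_intertwiner\<close>, and the complex plane is connected.\<close>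

lemma param_transports:
  fixes \<kappa> :: "complex \<Rightarrow> 'a"
  assumes \<kappa>: "smooth_into \<kappa>" and inj: "\<And>c \<zeta>. c \<in> charts \<Longrightarrow> \<kappa> \<zeta> \<in> fst c \<Longrightarrow> inj (dchart c \<kappa> \<zeta>)"
    and g: "g \<in> carrier torus" "\<And>\<zeta>. act g (\<kappa> \<zeta>) = \<kappa> \<zeta>" and n: "n > 0" "g ^ n = 1"
  shows "transports g (\<kappa> \<zeta>) (\<lambda>c. dchart c \<kappa> \<zeta>) (\<kappa> \<zeta>') (\<lambda>c. dchart c \<kappa> \<zeta>')"
proof (rule connected_equivalence_relation[where S = UNIV and a = \<zeta> and b = \<zeta>'])
  fix \<zeta> :: complex
  have top: "\<kappa> \<zeta> \<in> topspace X" for \<zeta> by (rule smooth_intoD(1)[OF \<kappa>])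
  obtain c where c: "c \<in> B" "\<kappa> \<zeta> \<in> fst c" using ex_chart_B[OF top] by blast
  have cc: "c \<in> charts" using c by simp
  have self: "transports g (\<kappa> \<zeta>) (\<lambda>c. dchart c \<kappa> \<zeta>) (\<kappa> \<zeta>) (\<lambda>c. dchart c \<kappa> \<zeta>)" for \<zeta>
  proof (rule transports_chart_change[OF g top])
    fix c d x assume "c \<in> B" "d \<in> B" "\<kappa> \<zeta> \<in> fst c" "\<kappa> \<zeta> \<in> fst d"
    then show "dchart d \<kappa> \<zeta> x = tact c d 1 (\<kappa> \<zeta>) (dchart c \<kappa> \<zeta> x)"
      using dchart_change[OF \<kappa>, of c \<zeta> d] by simp
  qed
  have ev: "\<forall>\<^sub>F z in nhds \<zeta>. \<kappa> z \<in> fst c" by (rule smooth_intoD(2)[OF \<kappa> chart_open[OF cc] c(2)])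
  have "\<forall>\<^sub>F z in nhds \<zeta>. \<exists>\<Psi>. linear \<Psi> \<and> det (matrix \<Psi>) > 0 \<and>
    (\<forall>u. \<Psi> (tact c c g (\<kappa> \<zeta>) u) = tact c c g (\<kappa> z) (\<Psi> u)) \<and> (\<forall>x. \<Psi> (dchart c \<kappa> \<zeta> x) = dchart c \<kappa> z x)"
  proof (rule local_intertwiner[OF n(1)])
    show "\<forall>\<^sub>F z in nhds \<zeta>. linear (tact c c g (\<kappa> z)) \<and> (\<forall>u. (tact c c g (\<kappa> z) ^^ n) u = u) \<and>
        linear (dchart c \<kappa> z) \<and> (\<forall>x. tact c c g (\<kappa> z) (dchart c \<kappa> z x) = dchart c \<kappa> z x)"
      using ev
    proof eventually_elim
      case (elim z)
      have "tact c c g (\<kappa> z) ^^ n = id"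
        using tact_funpow[OF g cc elim] n(2) tact_id[OF cc elim] by simp
      then show ?case
        using tact_linear[OF cc cc elim _ g(1)] g(2) elim smooth_intoD(4)[OF \<kappa> cc elim]
          param_fixed_derivative[OF \<kappa> g cc elim] by simp
    qed
    show "((\<lambda>z. tact c c g (\<kappa> z) u) \<longlongrightarrow> tact c c g (\<kappa> \<zeta>) u) (nhds \<zeta>)" for u
      by (rule isCont_nhds, rule isCont_tact_param[OF \<kappa> cc c(2) cc _ g(1)]) (use c g in simp)
    show "((\<lambda>z. dchart c \<kappa> z x) \<longlongrightarrow> dchart c \<kappa> \<zeta> x) (nhds \<zeta>)" for x
      unfolding dchart_def
      by (rule isCont_nhds, rule smooth_at_isCont, rule smooth_at_deriv, rule smooth_intoD(3)[OF \<kappa> cc c(2)])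
    show "inj (dchart c \<kappa> \<zeta>)" by (rule inj[OF cc c(2)])
  qed
  with ev have "\<forall>\<^sub>F z in nhds \<zeta>. transports g (\<kappa> \<zeta>) (\<lambda>c. dchart c \<kappa> \<zeta>) (\<kappa> z) (\<lambda>c. dchart c \<kappa> z)"
  proof eventually_elim
    case (elim z)
    show ?case
      unfolding transports_def
    proof (intro ballI impI)
      fix d d' assume d: "d \<in> B" "\<kappa> \<zeta> \<in> fst d" and d': "d' \<in> B" "\<kappa> z \<in> fst d'"
      obtain \<Psi> where \<Psi>: "linear \<Psi>" "det (matrix \<Psi>) > 0" "\<And>u. \<Psi> (tact c c g (\<kappa> \<zeta>) u) = tact c c g (\<kappa> z) (\<Psi> u)"
        "\<And>x. \<Psi> (dchart c \<kappa> \<zeta> x) = dchart c \<kappa> z x" using elim(2) by blast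
      obtain \<Psi>1 where \<Psi>1: "linear \<Psi>1" "det (matrix \<Psi>1) > 0"
        "\<And>u. \<Psi>1 (tact d d g (\<kappa> \<zeta>) u) = tact c c g (\<kappa> \<zeta>) (\<Psi>1 u)" "\<And>x. \<Psi>1 (dchart d \<kappa> \<zeta> x) = dchart c \<kappa> \<zeta> x"
        using self[of \<zeta>] d c unfolding transports_def by blast
      obtain \<Psi>2 where \<Psi>2: "linear \<Psi>2" "det (matrix \<Psi>2) > 0"
        "\<And>u. \<Psi>2 (tact c c g (\<kappa> z) u) = tact d' d' g (\<kappa> z) (\<Psi>2 u)" "\<And>x. \<Psi>2 (dchart c \<kappa> z x) = dchart d' \<kappa> z x"
        using self[of z] d' c(1) elim(1) unfolding transports_def by blast
      show "\<exists>\<Psi>. linear \<Psi> \<and> det (matrix \<Psi>) > 0 \<and> (\<forall>u. \<Psi> (tact d d g (\<kappa> \<zeta>) u) = tact d' d' g (\<kappa> z) (\<Psi> u)) \<and>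
          (\<forall>x. \<Psi> (dchart d \<kappa> \<zeta> x) = dchart d' \<kappa> z x)"
        by (intro exI[of _ "\<Psi>2 \<circ> (\<Psi> \<circ> \<Psi>1)"])
           (use \<Psi> \<Psi>1 \<Psi>2 in \<open>simp add: linear_compose matrix_compose det_mul\<close>)
    qed
  qed
  then show "\<exists>T. openin (top_of_set UNIV) T \<and> \<zeta> \<in> T \<and>
      (\<forall>z\<in>T. transports g (\<kappa> \<zeta>) (\<lambda>c. dchart c \<kappa> \<zeta>) (\<kappa> z) (\<lambda>c. dchart c \<kappa> z))"
    unfolding eventually_nhds by (simp add: subtopology_UNIV)
next
  fix x y z
  show "transports g (\<kappa> x) (\<lambda>c. dchart c \<kappa> x) (\<kappa> y) (\<lambda>c. dchart c \<kappa> y) \<Longrightarrow>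
      transports g (\<kappa> y) (\<lambda>c. dchart c \<kappa> y) (\<kappa> x) (\<lambda>c. dchart c \<kappa> x)"
    by (rule transports_sym)
  show "transports g (\<kappa> x) (\<lambda>c. dchart c \<kappa> x) (\<kappa> y) (\<lambda>c. dchart c \<kappa> y) \<Longrightarrow>
      transports g (\<kappa> y) (\<lambda>c. dchart c \<kappa> y) (\<kappa> z) (\<lambda>c. dchart c \<kappa> z) \<Longrightarrow>
      transports g (\<kappa> x) (\<lambda>c. dchart c \<kappa> x) (\<kappa> z) (\<lambda>c. dchart c \<kappa> z)"
    by (rule transports_trans[OF _ _ smooth_intoD(1)[OF \<kappa>]])
qed (simp_all add: connected_UNIV)

text \<open>The parametrizations of the two hemispheres meet at the parameter 1, a fixed point of
  \<open>\<zeta> \<mapsto> 1 / cnj \<zeta>\<close>, where the derivative of this map is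
  \<open>x \<mapsto> - cnj x\<close>.\<close>

lemma antipodal_derivative:
  assumes rp: "rotation_param N a \<kappa>" and e: "\<epsilon> \<in> {1, -1}" and c: "c \<in> charts" "\<kappa> \<epsilon> 1 \<in> fst c"
  shows "\<kappa> (- \<epsilon>) 1 = \<kappa> \<epsilon> 1" and "dchart c (\<kappa> \<epsilon>) 1 x = dchart c (\<kappa> (- \<epsilon>)) 1 (- cnj x)"
proof -
  have e': "- \<epsilon> \<in> {1, -1}" using e by auto
  have anti: "\<kappa> (- \<epsilon>) (1 / cnj \<zeta>) = \<kappa> \<epsilon> \<zeta>" if "\<zeta> \<noteq> 0" for \<zeta> by (rule rotation_paramD(7)[OF rp e that])
  show eq: "\<kappa> (- \<epsilon>) 1 = \<kappa> \<epsilon> 1" using anti[of 1] by simp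
  have inv: "((\<lambda>\<zeta>. 1 / cnj \<zeta>) has_derivative (\<lambda>x. - cnj x)) (at 1)"
    by (auto intro!: derivative_eq_intros has_derivative_cnj simp: divide_inverse)
  have D: "((\<lambda>\<zeta>. snd c (\<kappa> (- \<epsilon>) \<zeta>)) has_derivative dchart c (\<kappa> (- \<epsilon>)) 1) (at (1 / cnj 1))"
    using smooth_intoD(5)[OF rotation_paramD(1)[OF rp e'] c(1), of 1] c(2) eq by simp
  have "((\<lambda>\<zeta>. snd c (\<kappa> (- \<epsilon>) (1 / cnj \<zeta>))) has_derivative (\<lambda>x. dchart c (\<kappa> (- \<epsilon>)) 1 (- cnj x))) (at 1)"
    by (rule has_derivative_compose[OF inv D])
  then have "((\<lambda>\<zeta>. snd c (\<kappa> \<epsilon> \<zeta>)) has_derivative (\<lambda>x. dchart c (\<kappa> (- \<epsilon>)) 1 (- cnj x))) (at 1)"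
    by (rule has_derivative_transform_within_open[of _ _ _ _ "- {0}"]) (auto simp: anti)
  from frechet_derivative_at[OF this] show "dchart c (\<kappa> \<epsilon>) 1 x = dchart c (\<kappa> (- \<epsilon>)) 1 (- cnj x)"
    by (simp add: dchart_def fun_eq_iff)
qed

text \<open>The two stereographic parametrizations induce opposite orientations of the sphere.\<close>

lemma pole_transports:
  assumes rp: "rotation_param N a \<kappa>" and e: "\<epsilon> \<in> {1, -1}"
    and g: "g \<in> carrier torus" "character a g = 1" and n: "n > 0" "g ^ n = 1"
  shows "transports g (\<kappa> \<epsilon> 0) (\<lambda>c. dchart c (\<kappa> \<epsilon>) 0) (\<kappa> (- \<epsilon>) 0) (\<lambda>c x. dchart c (\<kappa> (- \<epsilon>)) 0 (- cnj x))"
proof -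
  have e': "- \<epsilon> \<in> {1, -1}" using e by auto
  have gk: "act g (\<kappa> \<epsilon> \<zeta>) = \<kappa> \<epsilon> \<zeta>" if "\<epsilon> \<in> {1, -1}" for \<epsilon> \<zeta>
    using rotation_paramD(4)[OF rp that g(1)] g(2) by simp
  have tr: "transports g (\<kappa> \<epsilon> \<zeta>) (\<lambda>c. dchart c (\<kappa> \<epsilon>) \<zeta>) (\<kappa> \<epsilon> \<zeta>') (\<lambda>c. dchart c (\<kappa> \<epsilon>) \<zeta>')"
    if e: "\<epsilon> \<in> {1, -1}" for \<epsilon> \<zeta> \<zeta>'
    by (rule param_transports[OF rotation_paramD(1)[OF rp e] rotation_paramD(2)[OF rp e] g(1) gk[OF e] n])
  have top: "\<kappa> \<epsilon> 1 \<in> topspace X" by (rule smooth_intoD(1)[OF rotation_paramD(1)[OF rp e]])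
  obtain c where "c \<in> charts" "\<kappa> \<epsilon> 1 \<in> fst c" using ex_chart_A[OF top] by blast
  note eq = antipodal_derivative(1)[OF rp e this]
  \<comment> \<open>The path runs from one pole to the common point with parameter 1, changes the
    parametrization there, and continues to the other pole.\<close>
  have "transports g (\<kappa> \<epsilon> 0) (\<lambda>c. dchart c (\<kappa> \<epsilon>) 0) (\<kappa> \<epsilon> 1) (\<lambda>c. dchart c (\<kappa> \<epsilon>) 1)"
    by (rule tr[OF e])
  then have "transports g (\<kappa> \<epsilon> 0) (\<lambda>c. dchart c (\<kappa> \<epsilon>) 0) (\<kappa> (- \<epsilon>) 1) (\<lambda>c x. dchart c (\<kappa> (- \<epsilon>)) 1 (- cnj x))"
    unfolding transports_def eq using antipodal_derivative(2)[OF rp e] by auto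
  moreover have "transports g (\<kappa> (- \<epsilon>) 1) (\<lambda>c x. dchart c (\<kappa> (- \<epsilon>)) 1 (- cnj x))
      (\<kappa> (- \<epsilon>) 0) (\<lambda>c x. dchart c (\<kappa> (- \<epsilon>)) 0 (- cnj x))"
    by (rule transports_precompose[OF tr[OF e']])
  ultimately show ?thesis using transports_trans top unfolding eq by blast
qed

text \<open>A fixed point \<open>q\<close> of \<open>g\<close> near \<open>p\<close> is determined by \<open>\<Lambda> q\<close>, since \<open>\<delta> = dg \<delta> + o(\<delta>)\<close> for a difference \<open>\<delta>\<close>
  of such points. Invariance of domain then lets the two spheres cover the same points.\<close>

lemma spheres_agree_locally:
  assumes rp1: "rotation_param N1 a1 \<kappa>1" and rp2: "rotation_param N2 a2 \<kappa>2"
    and p: "p \<in> N1" "p \<in> N2" and c: "c \<in> charts" "p \<in> fst c"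
    and g: "g \<in> carrier torus" "character a1 g = 1" "character a2 g = 1"
    and \<Lambda>: "linear (\<Lambda> :: real^'m \<Rightarrow> complex)" "\<And>u. tact c c g p u = u \<Longrightarrow> \<Lambda> u = 0 \<Longrightarrow> u = 0"
  shows "\<exists>W. openin X W \<and> p \<in> W \<and> N1 \<inter> W \<subseteq> N2"
proof -
  have rep: "\<exists>\<epsilon>\<in>{1,-1}. \<exists>\<zeta>. p = \<kappa> \<epsilon> \<zeta>" if "rotation_param N a \<kappa>" "p \<in> N" for N a \<kappa>
    using rotation_paramD(5)[OF that(1), of 1] that(2) by fastforce
  obtain \<epsilon>1 \<zeta>1 where 1: "\<epsilon>1 \<in> {1,-1}" "p = \<kappa>1 \<epsilon>1 \<zeta>1" using rep[OF rp1 p(1)] by blast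
  obtain \<epsilon>2 \<zeta>2 where 2: "\<epsilon>2 \<in> {1,-1}" "p = \<kappa>2 \<epsilon>2 \<zeta>2" using rep[OF rp2 p(2)] by blast
  note into1 = rotation_paramD(1)[OF rp1 1(1)] and into2 = rotation_paramD(1)[OF rp2 2(1)]
  have fix1: "act g (\<kappa>1 \<epsilon>1 \<zeta>) = \<kappa>1 \<epsilon>1 \<zeta>" for \<zeta> using rotation_paramD(4)[OF rp1 1(1) g(1)] g(2) by simp
  have fix2: "act g (\<kappa>2 \<epsilon>2 \<zeta>) = \<kappa>2 \<epsilon>2 \<zeta>" for \<zeta> using rotation_paramD(4)[OF rp2 2(1) g(1)] g(3) by simp
  have gp: "act g p = p" using fix1 1(2) by simp
  let ?R = "tact c c g p" and ?G = "\<lambda>y. snd c (act g (cinv c y))"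
  have R: "linear ?R" using tact_linear[OF c(1) c(1) c(2) _ g(1)] gp c(2) by simp
  \<comment> \<open>Injectivity of \<open>T\<close> expresses that \<open>\<Lambda>\<close>
    separates the vectors fixed by the differential of \<open>g\<close>; the constant
    \<open>b\<close> is a quantitative form that survives the strict estimate.\<close>
  define T where "T = (\<lambda>u. (\<Lambda> u, u - ?R u))"
  have linT: "linear T"
    unfolding T_def by (rule linearI) (simp_all add: linear_add[OF R] linear_add[OF \<Lambda>(1)] linear_cmul[OF R] linear_cmul[OF \<Lambda>(1)] algebra_simps)
  have "inj T"
    unfolding linear_injective_0[OF linT] using \<Lambda>(2) by (auto simp: T_def zero_prod_def)
  then obtain b where b: "b > 0" "\<And>u. norm (T u) \<ge> b * norm u"
    using linear_inj_bounded_below_pos[OF linT] by blast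
  have "smooth_at ?G (snd c p)"
    by (rule smooth_act_at[OF c(1) c(1) c(2) _ g(1)]) (use gp c in simp)
  then obtain d where d: "d > 0" "\<And>y z. y \<in> ball (snd c p) d \<Longrightarrow> z \<in> ball (snd c p) d \<Longrightarrow>
      norm (?G y - ?G z - ?R (y - z)) \<le> b / 2 * norm (y - z)"
    using smooth_at_strict[OF _ half_gt_zero[OF b(1)], of ?G "snd c p"] unfolding tact_def[symmetric] by blast
  define W0 where "W0 = {q \<in> fst c. snd c q \<in> ball (snd c p) d}"
  have W0: "openin X W0" "p \<in> W0"
    unfolding W0_def using openin_chart_preimage[OF c(1) open_ball] c(2) d(1) by auto
  have inj: "q = q'" if q: "q \<in> W0" "act g q = q" and q': "q' \<in> W0" "act g q' = q'"
    and eq: "\<Lambda> (snd c q) = \<Lambda> (snd c q')" for q q'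
  proof -
    have c': "q \<in> fst c" "q' \<in> fst c" using q q' by (auto simp: W0_def)
    define \<delta> where "\<delta> = snd c q - snd c q'"
    have "norm (\<delta> - ?R \<delta>) \<le> b / 2 * norm \<delta>"
      using d(2)[of "snd c q" "snd c q'"] q q' cinv_chart[OF c(1) c'(1)] cinv_chart[OF c(1) c'(2)]
      by (simp add: W0_def \<delta>_def)
    moreover have "\<Lambda> \<delta> = 0" using eq by (simp add: \<delta>_def linear_diff[OF \<Lambda>(1)])
    ultimately have "b * norm \<delta> \<le> b / 2 * norm \<delta>"
      using b(2)[of \<delta>] by (simp add: T_def norm_Pair)
    then have "\<delta> = 0" using b(1) by (simp add: mult_le_cancel_right)
    then show ?thesis using inj_onD[OF chart_inj[OF c(1)] _ c'] by (simp add: \<delta>_def)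
  qed
  define f1 where "f1 = (\<lambda>\<zeta>. \<Lambda> (snd c (\<kappa>1 \<epsilon>1 \<zeta>)))"
  define f2 where "f2 = (\<lambda>\<zeta>. \<Lambda> (snd c (\<kappa>2 \<epsilon>2 \<zeta>)))"
  define S2 where "S2 = {\<zeta>. \<kappa>2 \<epsilon>2 \<zeta> \<in> W0}"
  have cont: "isCont (\<lambda>\<zeta>. \<Lambda> (snd c (\<kappa> \<zeta>))) \<zeta>" if "smooth_into \<kappa>" "\<kappa> \<zeta> \<in> fst c" for \<kappa> :: "complex \<Rightarrow> 'a" and \<zeta>
    using smooth_at_isCont[OF smooth_at_linear_image[OF _ smooth_intoD(3)[OF that(1) c(1) that(2)]]]
      \<Lambda>(1) linear_conv_bounded_linear by blast
  have "open (f2 ` S2)"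
  proof (rule invariance_of_domain)
    show "continuous_on S2 f2"
      unfolding f2_def using cont[OF into2] by (intro continuous_at_imp_continuous_on) (auto simp: S2_def W0_def)
    show "open S2"
      using openin_continuous_map_preimage[OF smooth_into_continuous_map[OF into2] W0(1)] by (simp add: S2_def)
    show "inj_on f2 S2"
    proof (rule inj_onI)
      fix x y assume "x \<in> S2" "y \<in> S2" "f2 x = f2 y"
      then have "\<kappa>2 \<epsilon>2 x = \<kappa>2 \<epsilon>2 y"
        using inj[OF _ fix2[of x] _ fix2[of y]] unfolding S2_def f2_def by blast
      then show "x = y" using rotation_paramD(3)[OF rp2 2(1)] by (simp add: inj_eq)
    qed
  qed
  moreover have "f1 \<zeta>1 \<in> f2 ` S2"
    using 1(2) 2(2) W0(2) by (intro image_eqI[of _ _ \<zeta>2]) (auto simp: f1_def f2_def S2_def)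
  moreover have "isCont f1 \<zeta>1" unfolding f1_def using cont[OF into1] 1(2) c(2) by blast
  ultimately have "\<forall>\<^sub>F \<zeta> in nhds \<zeta>1. f1 \<zeta> \<in> f2 ` S2"
    using eventually_compose_isCont[of "\<lambda>y. y \<in> f2 ` S2" f1 \<zeta>1] eventually_nhds_in_open by blast
  moreover have "\<forall>\<^sub>F \<zeta> in nhds \<zeta>1. \<kappa>1 \<epsilon>1 \<zeta> \<in> W0"
    by (rule smooth_intoD(2)[OF into1 W0(1)]) (use 1(2) W0(2) in simp)
  ultimately have "\<forall>\<^sub>F \<zeta> in nhds \<zeta>1. \<kappa>1 \<epsilon>1 \<zeta> \<in> N2"
  proof eventually_elim
    case (elim \<zeta>)
    then obtain \<zeta>' where \<zeta>': "\<zeta>' \<in> S2" "f1 \<zeta> = f2 \<zeta>'" by blast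
    then have "\<kappa>1 \<epsilon>1 \<zeta> = \<kappa>2 \<epsilon>2 \<zeta>'"
      using inj[OF elim(2) fix1[of \<zeta>] _ fix2[of \<zeta>']] unfolding S2_def f1_def f2_def by blast
    then show ?case using rotation_paramD(5)[OF rp2 2(1)] by blast
  qed
  then obtain r where r: "r > 0" "\<And>\<zeta>. dist \<zeta> \<zeta>1 < r \<Longrightarrow> \<kappa>1 \<epsilon>1 \<zeta> \<in> N2"
    unfolding eventually_nhds_metric by blast
  obtain W where W: "openin X W" "\<kappa>1 \<epsilon>1 \<zeta>1 \<in> W" "N1 \<inter> W \<subseteq> \<kappa>1 \<epsilon>1 ` ball \<zeta>1 r"
    using rotation_paramD(8)[OF rp1 1(1) r(1)] by blast
  have "N1 \<inter> W \<subseteq> N2" using W(3) r(2) by (auto simp: dist_commute)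
  then show ?thesis using W 1(2) by blast
qed

end

section \<open>Tangent planes at the fixed points\<close>

text \<open>The torus is a quotient of a compact cube: the preimage of a closed set under
  \<open>f\<close> is the image of a compact set of angles.\<close>

lemma continuous_on_torus_descend:
  fixes f :: "complex^'k \<Rightarrow> 'b::topological_space"
  assumes "continuous_on UNIV (\<lambda>\<theta>. f (torus_exp \<theta>))"
  shows "continuous_on (carrier torus) f"
  unfolding continuous_on_closed_vimage[OF compact_imp_closed[OF compact_torus]]
proof (intro allI impI)
  fix C :: "'b set" assume C: "closed C"
  let ?Q = "cbox 0 (\<chi> j. 2 * pi) :: (real^'k) set"
  have "f -` C \<inter> carrier torus = torus_exp ` (?Q \<inter> (\<lambda>\<theta>. f (torus_exp \<theta>)) -` C)"
  proof (intro equalityI subsetI)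
    fix t assume t: "t \<in> f -` C \<inter> carrier torus"
    then obtain \<theta> where "\<theta> \<in> ?Q" "t = torus_exp \<theta>" using torus_exp_box[of t] by blast
    then show "t \<in> torus_exp ` (?Q \<inter> (\<lambda>\<theta>. f (torus_exp \<theta>)) -` C)" using t by blast
  qed auto
  moreover have "closed ((\<lambda>\<theta>. f (torus_exp \<theta>)) -` C)"
    using assms C continuous_on_closed_vimage[OF closed_UNIV, of "\<lambda>\<theta>. f (torus_exp \<theta>)"] by simp
  then have "compact (torus_exp ` (?Q \<inter> (\<lambda>\<theta>. f (torus_exp \<theta>)) -` C))"
    by (intro compact_continuous_image continuous_on_torus_exp compact_Int_closed compact_cbox)
  ultimately show "closed (f -` C \<inter> carrier torus)" by (simp add: compact_imp_closed)
qed

text \<open>At the angle \<open>pi / a $ i\<close> on the \<open>i\<close>-th axis, a nonzero entry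
  \<open>a $ i\<close> produces the value -1.\<close>

lemma character_eq_one_imp:
  assumes "\<And>t. t \<in> carrier torus \<Longrightarrow> character a t = 1"
  shows "a = 0"
proof -
  have "a $ i = 0" for i
  proof (rule ccontr)
    assume "a $ i \<noteq> 0"
    then have "angle a (axis i (pi / of_int (a $ i))) = pi" by (simp add: angle_axis)
    then have "character a (torus_exp (axis i (pi / of_int (a $ i)))) = - 1" by (simp add: character_exp)
    then show False using assms[OF torus_exp_carrier, of "axis i (pi / of_int (a $ i))"] by simp
  qed
  then show ?thesis by (simp add: vec_eq_iff)
qed

lemma sum_roots_of_unity:
  fixes z :: complex
  assumes "z ^ n = 1" "z \<noteq> 1"
  shows "(\<Sum>j<n. z ^ j) = 0"
  using assms by (simp add: geometric_sum)

lemma character_power: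
  assumes "t \<in> carrier torus"
  shows "character a (t ^ n) = character a t ^ n"
proof -
  obtain \<theta> where \<theta>: "t = torus_exp \<theta>" using torus_exp_surj[OF assms] by blast
  have "t ^ n = torus_exp (real n *\<^sub>R \<theta>)"
    unfolding \<theta> by (induction n) (simp_all add: torus_exp_add[symmetric] algebra_simps)
  then show ?thesis by (simp add: \<theta> character_exp angle_scaleR Complex.DeMoivre)
qed

lemma proportional_refl: "proportional a a"
  unfolding proportional_def by (intro exI[of _ 1]) simp

text \<open>\<open>E\<close> is to be the set of edges, and \<open>F\<close> a finite family of
  spheres that covers the one-skeleton. That both have the same members at a fixed point is only
  proved in \<open>E_at_eq\<close>.\<close>

locale gkm_setting = oriented_torus_manifold X A B act
  for X :: "'a topology" and A B :: "('a, real^'m) chart set" and act :: "complex^'k \<Rightarrow> 'a \<Rightarrow> 'a" +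
  fixes E F :: "'a set set" and lab :: "'a set \<Rightarrow> int^'k" and \<kappa> :: "'a set \<Rightarrow> real \<Rightarrow> complex \<Rightarrow> 'a"
  assumes finite_fixed: "finite (fixed_points X act)"
    and finite_F: "finite F" and F_sub: "F \<subseteq> E" and skeleton: "one_skeleton X A act = \<Union>F"
    and param: "N \<in> E \<Longrightarrow> rotation_param N (lab N) (\<kappa> N)"
begin

abbreviation "fix_pts \<equiv> fixed_points X act"

text \<open>A sphere with label zero would consist of fixed points, of which there are finitely
  many.\<close>

lemma label_nonzero:
  assumes "N \<in> E"
  shows "lab N \<noteq> 0"
proof
  assume "lab N = 0"
  then have "act t (\<kappa> N 1 \<zeta>) = \<kappa> N 1 \<zeta>" if "t \<in> carrier torus" for t \<zeta>
    using rotation_paramD(4)[OF param[OF assms], of 1 t \<zeta>] that by (simp add: character_def)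
  then have "range (\<kappa> N 1) \<subseteq> fix_pts"
    using smooth_intoD(1)[OF rotation_paramD(1)[OF param[OF assms], of 1]] by (auto simp: fixed_points_def)
  then have "finite (range (\<kappa> N 1))" using finite_fixed finite_subset by blast
  then show False
    using finite_imageD[OF _ rotation_paramD(3)[OF param[OF assms], of 1]] infinite_UNIV_char_0 by blast
qed

lemma poles:
  assumes "N \<in> E"
  shows "N \<inter> fix_pts = {\<kappa> N 1 0, \<kappa> N (-1) 0}" "\<kappa> N (-1) 0 \<noteq> \<kappa> N 1 0"
proof -
  note rp = param[OF assms]
  have fixed: "\<kappa> N \<epsilon> 0 \<in> fix_pts" if e: "\<epsilon> \<in> {1, -1}" for \<epsilon>
    using rotation_paramD(4)[OF rp e] smooth_intoD(1)[OF rotation_paramD(1)[OF rp e]] by (auto simp: fixed_points_def)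
  have N: "N = insert (\<kappa> N (- 1) 0) (range (\<kappa> N 1))" using rotation_paramD(5)[OF rp, of 1] by simp
  have zero: "\<zeta> = 0" if z: "\<kappa> N 1 \<zeta> \<in> fix_pts" for \<zeta>
  proof (rule ccontr)
    assume "\<zeta> \<noteq> 0"
    have "character (lab N) t = 1" if t: "t \<in> carrier torus" for t
    proof -
      have "\<kappa> N 1 (character (lab N) t * \<zeta>) = \<kappa> N 1 \<zeta>"
        using rotation_paramD(4)[OF rp, of 1 t \<zeta>] t fixed_pointD(2)[OF z t] by simp
      then show ?thesis using injD[OF rotation_paramD(3)[OF rp, of 1]] \<open>\<zeta> \<noteq> 0\<close> by fastforce
    qed
    then show False using character_eq_one_imp label_nonzero[OF assms] by blast
  qed
  show "N \<inter> fix_pts = {\<kappa> N 1 0, \<kappa> N (-1) 0}"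
  proof (intro equalityI subsetI)
    fix p assume p: "p \<in> N \<inter> fix_pts"
    then have "p = \<kappa> N (-1) 0 \<or> (\<exists>\<zeta>. p = \<kappa> N 1 \<zeta>)" using N by blast
    then show "p \<in> {\<kappa> N 1 0, \<kappa> N (-1) 0}" using zero p by auto
  next
    fix p assume "p \<in> {\<kappa> N 1 0, \<kappa> N (-1) 0}"
    then show "p \<in> N \<inter> fix_pts" using fixed[of 1] fixed[of "-1"] N by auto
  qed
  show "\<kappa> N (-1) 0 \<noteq> \<kappa> N 1 0" using rotation_paramD(6)[OF rp, of 1] by auto
qed

definition E_at :: "'a \<Rightarrow> 'a set set" where "E_at v = {N \<in> E. v \<in> N}"

definition F_at :: "'a \<Rightarrow> 'a set set" where "F_at v = {N \<in> F. v \<in> N}"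

lemma F_at_sub: "F_at v \<subseteq> E_at v" and finite_F_at: "finite (F_at v)"
  using F_sub finite_F by (auto simp: F_at_def E_at_def)

definition pole :: "'a set \<Rightarrow> 'a \<Rightarrow> real" where
  "pole N v = (if \<kappa> N 1 0 = v then 1 else -1)"

definition chart_at :: "'a \<Rightarrow> ('a, real^'m) chart" where
  "chart_at v = (SOME c. c \<in> B \<and> v \<in> fst c)"

text \<open>The tangent plane of \<open>N\<close> at \<open>v\<close>, identified with the complex
  numbers in such a way that the torus acts through \<open>character (lab N)\<close> at both poles.
  This is how the sign of a label orients the plane.\<close>

definition tang :: "'a set \<Rightarrow> 'a \<Rightarrow> complex \<Rightarrow> real^'m" where
  "tang N v = dchart (chart_at v) (\<kappa> N (pole N v)) 0"

definition isotropy :: "'a \<Rightarrow> complex^'k \<Rightarrow> real^'m \<Rightarrow> real^'m" where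
  "isotropy v t = tact (chart_at v) (chart_at v) t v"

lemma chart_at:
  assumes "v \<in> fix_pts"
  shows "chart_at v \<in> B" "chart_at v \<in> charts" "v \<in> fst (chart_at v)"
proof -
  have "\<exists>c. c \<in> B \<and> v \<in> fst c" using ex_chart_B[OF fixed_pointD(1)[OF assms]] by blast
  from someI_ex[OF this] show "chart_at v \<in> B" "chart_at v \<in> charts" "v \<in> fst (chart_at v)"
    unfolding chart_at_def by auto
qed

lemma pole: "pole N v \<in> {1, -1}"
  by (simp add: pole_def)

lemma pole_eq: "v \<in> fix_pts \<Longrightarrow> N \<in> E_at v \<Longrightarrow> \<kappa> N (pole N v) 0 = v"
proof -
  assume "v \<in> fix_pts" "N \<in> E_at v"
  then have "N \<in> E" "v \<in> N \<inter> fix_pts" by (auto simp: E_at_def)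
  then show "\<kappa> N (pole N v) 0 = v" using poles(1)[of N] by (auto simp: pole_def)
qed

lemma tang:
  assumes v: "v \<in> fix_pts" and N: "N \<in> E_at v"
  shows "linear (tang N v)" "inj (tang N v)"
    "t \<in> carrier torus \<Longrightarrow> isotropy v t (tang N v x) = tang N v (character (lab N) t * x)"
proof -
  note eq = pole_eq[OF assms] and c = chart_at[OF v]
  have NE: "N \<in> E" using N by (simp add: E_at_def)
  note rp = param[OF NE]
  note into = rotation_paramD(1)[OF rp pole]
  have cN: "\<kappa> N (pole N v) 0 \<in> fst (chart_at v)" using eq c(3) by simp
  show "linear (tang N v)" "inj (tang N v)"
    unfolding tang_def using smooth_intoD(4)[OF into c(2) cN] rotation_paramD(2)[OF rp pole c(2) cN] by auto
  assume t: "t \<in> carrier torus"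
  have fixv: "act t (\<kappa> N (pole N v) 0) \<in> fst (chart_at v)" using fixed_pointD(2)[OF v t] eq c(3) by simp
  have "isotropy v t (tang N v x) = dchart (chart_at v) (\<lambda>\<zeta>. act t (\<kappa> N (pole N v) \<zeta>)) 0 x"
    using act_smooth_into(2)[OF into t c(2) cN c(2) fixv] by (simp add: isotropy_def tang_def eq)
  also have "(\<lambda>\<zeta>. act t (\<kappa> N (pole N v) \<zeta>)) = (\<lambda>\<zeta>. \<kappa> N (pole N v) (character (lab N) t * \<zeta>))"
    using rotation_paramD(4)[OF rp pole t] by simp
  also have "dchart (chart_at v) (\<lambda>\<zeta>. \<kappa> N (pole N v) (character (lab N) t * \<zeta>)) 0 x
      = tang N v (character (lab N) t * x)"
  proof -
    have m: "((\<lambda>\<zeta>. character (lab N) t * \<zeta>) has_derivative (\<lambda>\<zeta>. character (lab N) t * \<zeta>)) (at 0)"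
      by (auto intro!: derivative_eq_intros)
    have "((\<lambda>\<zeta>. snd (chart_at v) (\<kappa> N (pole N v) \<zeta>)) has_derivative tang N v) (at (character (lab N) t * 0))"
      using smooth_intoD(5)[OF into c(2) cN] by (simp add: tang_def)
    from has_derivative_compose[OF m this] have
      "((\<lambda>\<zeta>. snd (chart_at v) (\<kappa> N (pole N v) (character (lab N) t * \<zeta>)))
        has_derivative (\<lambda>x. tang N v (character (lab N) t * x))) (at 0)" .
    from frechet_derivative_at[OF this] show ?thesis by (simp add: dchart_def fun_eq_iff)
  qed
  finally show "isotropy v t (tang N v x) = tang N v (character (lab N) t * x)" .
qed

lemma isotropy:
  assumes v: "v \<in> fix_pts"
  shows "t \<in> carrier torus \<Longrightarrow> linear (isotropy v t)"
    "s \<in> carrier torus \<Longrightarrow> t \<in> carrier torus \<Longrightarrow> isotropy v (s * t) u = isotropy v s (isotropy v t u)"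
    "isotropy v 1 u = u"
    "continuous_on S (\<lambda>\<theta>. isotropy v (torus_exp \<theta>) u)"
    "t \<in> carrier torus \<Longrightarrow> (isotropy v t ^^ n) = isotropy v (t ^ n)"
  unfolding isotropy_def
  using isotropy_linear[OF v chart_at(2,3)[OF v]] isotropy_mult[OF v chart_at(2,3)[OF v]]
    isotropy_one[OF v chart_at(2,3)[OF v]] isotropy_continuous[OF v chart_at(2,3)[OF v]]
    tact_funpow[OF _ fixed_pointD(2)[OF v] chart_at(2,3)[OF v]]
  by simp_all

lemma edge_closed: "N \<in> E \<Longrightarrow> closedin X N"
  using param[of N] compactin_imp_closedin[OF hausdorff] unfolding rotation_param_def by blast

text \<open>The hypothesis says that modulo the stabilizer of \<open>u\<close> every torus element
  lies in the \<open>i\<close>-th coordinate circle, so that points with this stabilizer have small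
  orbits. One sphere of the finite family contains approximating points for infinitely many
  precisions, hence for all, and \<open>tangent_cone\<close> applies to it.\<close>

lemma direction_in_plane:
  assumes v: "v \<in> fix_pts"
    and orb: "\<And>\<eta>. \<exists>s. isotropy v (torus_exp (\<eta> - s *\<^sub>R axis i 1)) u = u"
  shows "\<exists>N\<in>F_at v. u \<in> range (tang N v)"
proof -
  let ?c = "chart_at v"
  note c = chart_at[OF v]
  have "\<exists>s q. 0 < s \<and> s < r \<and> q \<in> fst ?c \<and> norm (snd ?c q - snd ?c v - s *\<^sub>R u) \<le> r * s \<and> q \<in> \<Union>F"
    if r: "r > 0" for r
  proof -
    obtain s q where sq: "0 < s" "s < r" "q \<in> fst ?c" "norm (snd ?c q - snd ?c v - s *\<^sub>R u) \<le> r * s"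
      "\<And>t. t \<in> carrier torus \<Longrightarrow> isotropy v t u = u \<Longrightarrow> act t q = q"
      using fixed_direction_approx[OF v c(2,3) r r, of u] unfolding isotropy_def by blast
    have qX: "q \<in> topspace X" by (rule chart_subset[OF c(2) sq(3)])
    have "q \<in> one_skeleton X A act"
    proof (rule orbit_one_skeleton[OF qX])
      fix t :: "complex^'k" assume "t \<in> carrier torus"
      then obtain \<eta> where \<eta>: "t = torus_exp \<eta>" using torus_exp_surj by blast
      obtain s where s: "isotropy v (torus_exp (\<eta> - s *\<^sub>R axis i 1)) u = u" using orb by blast
      have "t = torus_exp (s *\<^sub>R axis i 1) * torus_exp (\<eta> - s *\<^sub>R axis i 1)"
        unfolding \<eta> torus_exp_add[symmetric] by simp
      then have "act t q = act (torus_exp (s *\<^sub>R axis i 1)) q"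
        using sq(5)[OF torus_exp_carrier s] act_mult[OF torus_exp_carrier torus_exp_carrier qX] by simp
      then show "\<exists>s. act t q = act (torus_exp (s *\<^sub>R axis i 1)) q" by blast
    qed
    then show ?thesis using sq skeleton by blast
  qed
  then have "\<exists>s q. 0 < s \<and> s < inverse (real (Suc n)) \<and> q \<in> fst ?c \<and>
      norm (snd ?c q - snd ?c v - s *\<^sub>R u) \<le> inverse (real (Suc n)) * s \<and> q \<in> \<Union>F" for n
    by simp
  then obtain s q where sq: "\<And>n. 0 < s n" "\<And>n. s n < inverse (real (Suc n))" "\<And>n. q n \<in> fst ?c"
    "\<And>n. norm (snd ?c (q n) - snd ?c v - s n *\<^sub>R u) \<le> inverse (real (Suc n)) * s n" "\<And>n. q n \<in> \<Union>F"
    by metis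
  have "\<exists>N\<in>F. infinite {n \<in> UNIV. q n \<in> N}"
    by (rule pigeonhole_infinite_rel) (use finite_F sq(5) in auto)
  then obtain N where N: "N \<in> F" "infinite {n. q n \<in> N}" by auto
  have NE: "N \<in> E" using N(1) F_sub by blast
  have cone: "\<exists>s q. 0 < s \<and> s < \<eta> \<and> q \<in> N \<and> q \<in> fst ?c \<and> norm (snd ?c q - snd ?c v - s *\<^sub>R u) \<le> \<eta> * s"
    if \<eta>: "\<eta> > 0" for \<eta>
  proof -
    obtain n0 where n0: "inverse (real (Suc n0)) < \<eta>" using reals_Archimedean[OF \<eta>] by blast
    obtain n where n: "n \<ge> n0" "q n \<in> N" using N(2) unfolding infinite_nat_iff_unbounded_le by blast
    have "inverse (real (Suc n)) \<le> inverse (real (Suc n0))" using n(1) by (simp add: le_imp_inverse_le)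
    then have le: "inverse (real (Suc n)) \<le> \<eta>" using n0 by linarith
    have "inverse (real (Suc n)) * s n \<le> \<eta> * s n"
      using le sq(1)[of n] by (intro mult_right_mono) auto
    then have "norm (snd ?c (q n) - snd ?c v - s n *\<^sub>R u) \<le> \<eta> * s n" using sq(4)[of n] by linarith
    moreover have "s n < \<eta>" using sq(2)[of n] le by linarith
    ultimately show ?thesis using sq(1,3) n(2) by blast
  qed
  \<comment> \<open>The approximating points converge to \<open>v\<close>, and \<open>N\<close> is
    closed.\<close>
  have "v \<in> N"
  proof (rule ccontr)
    assume "v \<notin> N"
    have "openin X (topspace X - N)" using edge_closed[OF NE] by blast
    moreover have "v \<in> topspace X - N" using \<open>v \<notin> N\<close> fixed_pointD(1)[OF v] by blast
    ultimately obtain \<rho> where \<rho>: "\<rho> > 0" "\<And>y. dist y (snd ?c v) < \<rho> \<Longrightarrow> cinv ?c y \<in> topspace X - N"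
      using eventually_chart[OF c(2,3)] unfolding eventually_nhds_metric by meson
    define \<eta> where "\<eta> = min 1 (\<rho> / (norm u + 1))"
    have nu: "norm u + 1 > 0" by (simp add: add_nonneg_pos)
    have \<eta>: "\<eta> > 0" "\<eta> \<le> 1" "\<eta> * (norm u + 1) \<le> \<rho>"
      using \<rho>(1) nu by (auto simp: \<eta>_def pos_le_divide_eq[symmetric])
    obtain s q where s: "0 < s" "s < \<eta>" "q \<in> N" "q \<in> fst ?c" "norm (snd ?c q - snd ?c v - s *\<^sub>R u) \<le> \<eta> * s"
      using cone[OF \<eta>(1)] by blast
    have "norm (snd ?c q - snd ?c v) \<le> norm (snd ?c q - snd ?c v - s *\<^sub>R u) + norm (s *\<^sub>R u)"
      using norm_triangle_ineq[of "snd ?c q - snd ?c v - s *\<^sub>R u" "s *\<^sub>R u"] by simp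
    also have "\<dots> \<le> 1 * s + s * norm u"
      using order_trans[OF s(5) mult_right_mono[OF \<eta>(2) less_imp_le[OF s(1)]]] s(1) by simp
    also have "\<dots> = s * (norm u + 1)" by (simp add: algebra_simps)
    also have "\<dots> < \<eta> * (norm u + 1)" using s(2) nu by (rule mult_strict_right_mono)
    finally have "dist (snd ?c q) (snd ?c v) < \<rho>" using \<eta>(3) by (simp add: dist_norm)
    then have "q \<notin> N" using \<rho>(2)[of "snd ?c q"] cinv_chart[OF c(2) s(4)] by auto
    then show False using s(3) by blast
  qed
  then have NF: "N \<in> F_at v" "N \<in> E_at v" using N(1) NE by (auto simp: F_at_def E_at_def)
  have eq: "\<kappa> N (pole N v) 0 = v" by (rule pole_eq[OF v NF(2)])
  have "u \<in> range (dchart ?c (\<kappa> N (pole N v)) 0)"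
    by (rule tangent_cone[OF param[OF NE] pole c(2)]) (use eq c(3) cone in auto)
  then show ?thesis using NF(1) by (auto simp: tang_def)
qed

text \<open>Let \<open>\<psi>\<close> be orthogonal to all planes. Integrating a wave of frequency
  \<open>w\<close> against the orbit of \<open>\<psi>\<close> gives a vector fixed by the kernel of
  \<open>w\<close>, hence one in a plane. So all Fourier coefficients of
  \<open>t \<mapsto> \<psi> \<bullet> isotropy v t \<psi>\<close> vanish, and so does its value at
  1, the squared length of \<open>\<psi>\<close>.\<close>

lemma span_planes:
  assumes v: "v \<in> fix_pts"
  shows "span (\<Union>N\<in>F_at v. range (tang N v)) = UNIV"
proof (rule ccontr)
  let ?S = "\<Union>N\<in>F_at v. range (tang N v)" and ?Q = "cbox 0 (\<chi> j. 2 * pi) :: (real^'k) set"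
  assume "span ?S \<noteq> UNIV"
  then obtain \<psi> where \<psi>: "\<psi> \<noteq> 0" "\<forall>x\<in>span ?S. \<psi> \<bullet> x = 0"
    using span_not_UNIV_orthogonal[of ?S] by blast
  let ?L = "\<lambda>\<theta>. isotropy v (torus_exp \<theta>)"
  have contL: "continuous_on S (\<lambda>\<theta>. ?L \<theta> \<psi>)" for S by (rule isotropy(4)[OF v])
  define f where "f = (\<lambda>t. \<psi> \<bullet> isotropy v t \<psi>)"
  have contf: "continuous_on (carrier torus) f"
    unfolding f_def by (rule continuous_on_torus_descend) (intro continuous_intros contL)
  have f1: "f 1 \<noteq> 0" using \<psi>(1) isotropy(3)[OF v] by (simp add: f_def)
  \<comment> \<open>Used with the cosine and the sine of \<open>angle w\<close> for
    \<open>h\<close>.\<close>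
  have main: "integral ?Q (\<lambda>\<theta>. h \<theta> * f (torus_exp \<theta>)) = 0"
    if h: "continuous_on UNIV h" "\<And>x y. torus_exp x = torus_exp y \<Longrightarrow> h x = h y"
      "\<And>\<theta> \<eta>. angle w \<eta> = 0 \<Longrightarrow> h (\<theta> + \<eta>) = h \<theta>" for h :: "real^'k \<Rightarrow> real" and w
  proof -
    define G where "G = (\<lambda>\<theta>. h \<theta> *\<^sub>R ?L \<theta> \<psi>)"
    have contG: "continuous_on UNIV G" unfolding G_def by (intro continuous_intros h(1) contL)
    have perG: "G x = G y" if "torus_exp x = torus_exp y" for x y
      using h(2)[OF that] that by (simp add: G_def)
    have intG: "G integrable_on ?Q" using contG continuous_on_subset integrable_continuous by blast
    define u where "u = integral ?Q G"
    have inv: "?L \<eta> u = u" if \<eta>: "angle w \<eta> = 0" for \<eta>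
    proof -
      have lin: "linear (?L \<eta>)" by (rule isotropy(1)[OF v torus_exp_carrier])
      have "?L \<eta> u = integral ?Q (?L \<eta> \<circ> G)"
        unfolding u_def using integral_linear[OF intG, of "?L \<eta>"] lin linear_conv_bounded_linear by metis
      also have "?L \<eta> \<circ> G = (\<lambda>\<theta>. G (\<theta> + \<eta>))"
        using h(3)[OF \<eta>] isotropy(2)[OF v torus_exp_carrier torus_exp_carrier, of \<eta>]
        by (simp add: fun_eq_iff G_def linear_cmul[OF lin] torus_exp_add mult.commute[of _ "torus_exp \<eta>"])
      also have "integral ?Q (\<lambda>\<theta>. G (\<theta> + \<eta>)) = u"
        unfolding u_def by (rule torus_integral_shift[OF contG perG])
      finally show ?thesis .
    qed
    \<comment> \<open>An axis on which \<open>w\<close> does not vanish supplements the kernel of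
      \<open>w\<close>; for \<open>w = 0\<close> any axis will do.\<close>
    have "\<exists>i. \<forall>\<eta>. \<exists>s. angle w (\<eta> - s *\<^sub>R axis i 1) = 0"
    proof (cases "w = 0")
      case False
      then obtain i where i: "w $ i \<noteq> 0" by (auto simp: vec_eq_iff)
      have "angle w (\<eta> - (angle w \<eta> / of_int (w $ i)) *\<^sub>R axis i 1) = 0" for \<eta>
        using i by (simp add: angle_diff angle_scaleR angle_axis)
      then show ?thesis by blast
    qed (simp add: angle_def)
    then obtain i where i: "\<And>\<eta>. \<exists>s. angle w (\<eta> - s *\<^sub>R axis i 1) = 0" by blast
    have "\<exists>N\<in>F_at v. u \<in> range (tang N v)"
    proof (rule direction_in_plane[OF v])
      show "\<exists>s. isotropy v (torus_exp (\<eta> - s *\<^sub>R axis i 1)) u = u" for \<eta>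
        using i[of \<eta>] inv by blast
    qed
    then have "u \<in> span ?S" by (meson UN_I span_base)
    then have "\<psi> \<bullet> u = 0" using \<psi>(2) by blast
    moreover have "\<psi> \<bullet> u = integral ?Q (\<lambda>\<theta>. h \<theta> * f (torus_exp \<theta>))"
      unfolding u_def using integral_linear[OF intG bounded_linear_inner_right[of \<psi>]]
      by (simp add: o_def G_def f_def)
    ultimately show ?thesis by simp
  qed
  have per: "cos (angle w x) = cos (angle w y)" "sin (angle w x) = sin (angle w y)"
    if "torus_exp x = torus_exp y" for w x y
    using arg_cong[OF that, of "character w"] by (simp_all add: character_exp complex_eq_iff)
  have "f 1 = 0"
  proof (rule fourier_uniqueness[OF contf])
    fix w
    show "integral ?Q (\<lambda>\<theta>. cos (angle w \<theta>) * f (torus_exp \<theta>)) = 0"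
    proof (rule main[of _ w])
      show "continuous_on UNIV (\<lambda>\<theta>. cos (angle w \<theta>))" by (intro continuous_intros)
      show "cos (angle w x) = cos (angle w y)" if "torus_exp x = torus_exp y" for x y using that by (rule per(1))
      show "cos (angle w (\<theta> + \<eta>)) = cos (angle w \<theta>)" if "angle w \<eta> = 0" for \<theta> \<eta>
        by (simp add: angle_add that)
    qed
    show "integral ?Q (\<lambda>\<theta>. sin (angle w \<theta>) * f (torus_exp \<theta>)) = 0"
    proof (rule main[of _ w])
      show "continuous_on UNIV (\<lambda>\<theta>. sin (angle w \<theta>))" by (intro continuous_intros)
      show "sin (angle w x) = sin (angle w y)" if "torus_exp x = torus_exp y" for x y using that by (rule per(2))
      show "sin (angle w (\<theta> + \<eta>)) = sin (angle w \<theta>)" if "angle w \<eta> = 0" for \<theta> \<eta>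
        by (simp add: angle_add that)
    qed
  qed
  then show False using f1 by blast
qed

end

lemma proportional_angle:
  assumes "proportional a b" "angle a \<eta> = 0"
  shows "angle b \<eta> = 0"
proof -
  obtain r s where rs: "r \<noteq> 0" "r *s b = s *s a" using assms(1) unfolding proportional_def by blast
  have "of_int r * angle b \<eta> = of_int s * angle a \<eta>"
    using arg_cong[OF rs(2), of "\<lambda>a. angle a \<eta>"] by (simp add: angle_cmul_left)
  then show ?thesis using rs(1) assms(2) by simp
qed

lemma connectedin_clopen_subset:
  assumes conn: "connectedin Y S" and "closedin Y T" and v: "v \<in> S" "v \<in> T"
    and loc: "\<And>p. p \<in> S \<Longrightarrow> p \<in> T \<Longrightarrow> \<exists>W. openin Y W \<and> p \<in> W \<and> S \<inter> W \<subseteq> T"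
  shows "S \<subseteq> T"
proof -
  have top: "topspace (subtopology Y S) = S" using conn by (auto simp: connectedin_def)
  have "closedin (subtopology Y S) (S \<inter> T)" using \<open>closedin Y T\<close> closedin_subtopology by blast
  moreover have "openin (subtopology Y S) (S \<inter> T)"
  proof (subst openin_subopen, intro ballI)
    fix p assume "p \<in> S \<inter> T"
    then obtain W where "openin Y W" "p \<in> W" "S \<inter> W \<subseteq> T" using loc by blast
    then show "\<exists>U. openin (subtopology Y S) U \<and> p \<in> U \<and> U \<subseteq> S \<inter> T"
      using \<open>p \<in> S \<inter> T\<close> by (intro exI[of _ "S \<inter> W"]) (auto intro: openin_subtopology_Int2)
  qed
  ultimately have "S \<inter> T = {} \<or> S \<inter> T = S"
    using conn unfolding connectedin_def connected_space_clopen_in top by blast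
  then show ?thesis using v by blast
qed

section \<open>Fixed spaces of torsion elements and independence of the tangent planes\<close>

context gkm_setting
begin

text \<open>For \<open>g ^ n = 1\<close> this is the projection onto the vectors fixed by
  \<open>g\<close>.\<close>

definition avg :: "'a \<Rightarrow> complex^'k \<Rightarrow> nat \<Rightarrow> real^'m \<Rightarrow> real^'m" where
  "avg v g n u = (1 / real n) *\<^sub>R (\<Sum>j<n. isotropy v (g ^ j) u)"

lemma linear_avg: "v \<in> fix_pts \<Longrightarrow> g \<in> carrier torus \<Longrightarrow> linear (avg v g n)"
  unfolding avg_def
  by (intro linear_compose_scale_right linear_compose_sum ballI isotropy(1) torus_power_closed)

lemma avg_fixed:
  assumes "v \<in> fix_pts" "g \<in> carrier torus" "n > 0" "isotropy v g u = u"
  shows "avg v g n u = u"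
proof -
  have "isotropy v (g ^ j) u = u" for j
  proof (induction j)
    case (Suc j)
    then show ?case
      using isotropy(2)[OF assms(1,2) torus_power_closed[OF assms(2)], of j u] assms(4) by simp
  qed (simp add: isotropy(3)[OF assms(1)])
  then show ?thesis using assms(3) by (simp add: avg_def sum_constant_scaleR del: sum_constant)
qed

text \<open>On the plane of \<open>N\<close> the element \<open>g\<close> is multiplication by an
  \<open>n\<close>-th root of unity, whose powers sum to zero unless it is 1.\<close>

lemma avg_tang:
  assumes v: "v \<in> fix_pts" and N: "N \<in> E_at v" and g: "g \<in> carrier torus" "n > 0" "g ^ n = 1"
  shows "avg v g n (tang N v x) = (if character (lab N) g = 1 then tang N v x else 0)"
proof -
  let ?z = "character (lab N) g"
  have lin: "linear (tang N v)" by (rule tang(1)[OF v N])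
  have *: "isotropy v (g ^ j) (tang N v x) = tang N v (?z ^ j * x)" for j
    using tang(3)[OF v N torus_power_closed[OF g(1)]] character_power[OF g(1)] by simp
  have "?z ^ n = 1" using character_power[OF g(1), of "lab N" n] g(3) by (simp add: character_def)
  have "avg v g n (tang N v x) = (1 / real n) *\<^sub>R tang N v (\<Sum>j<n. ?z ^ j * x)"
    unfolding avg_def * by (simp add: linear_sum[OF lin])
  also have "(\<Sum>j<n. ?z ^ j * x) = (\<Sum>j<n. ?z ^ j) * x" by (simp add: sum_distrib_right)
  also have "(1 / real n) *\<^sub>R tang N v ((\<Sum>j<n. ?z ^ j) * x) = (if ?z = 1 then tang N v x else 0)"
  proof (cases "?z = 1")
    case True
    then have "(1 / real n) *\<^sub>R tang N v ((\<Sum>j<n. ?z ^ j) * x) = tang N v ((1 / real n) *\<^sub>R (of_nat n * x))"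
      by (simp add: linear_cmul[OF lin])
    also have "(1 / real n) *\<^sub>R (of_nat n * x) = x" using g(2) by (simp add: scaleR_conv_of_real)
    finally show ?thesis using True by simp
  next
    case False
    then show ?thesis using sum_roots_of_unity[OF \<open>?z ^ n = 1\<close>] linear_0[OF lin] by simp
  qed
  finally show ?thesis .
qed

text \<open>A vector fixed by a generic \<open>g\<close> is fixed by a subgroup of codimension one of the torus, hence lies in
  one of the finitely many planes; a subspace contained in their union is contained in one of them.\<close>

lemma fixed_plane:
  assumes v: "v \<in> fix_pts" and e: "e \<in> E_at v"
  shows "\<exists>g n. g \<in> carrier torus \<and> n > 0 \<and> g ^ n = 1 \<and> (\<forall>b. proportional (lab e) b \<longrightarrow> character b g = 1) \<and>
    {u. isotropy v g u = u} = range (tang e v)"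
proof -
  have eE: "e \<in> E" using e by (simp add: E_at_def)
  define Z where "Z = {z \<in> lab ` F_at v. \<not> proportional (lab e) z}"
  have Z: "finite Z" "\<And>z. z \<in> Z \<Longrightarrow> \<not> proportional (lab e) z" using finite_F_at by (auto simp: Z_def)
  obtain g n where g: "g \<in> carrier torus" "n > 0" "g ^ n = 1"
    "\<And>b. proportional (lab e) b \<Longrightarrow> character b g = 1" "\<And>z. z \<in> Z \<Longrightarrow> Im (character z g) \<noteq> 0"
    using generic_torsion_element[OF Z(1) label_nonzero[OF eE] Z(2)] by blast
  \<comment> \<open>Several spheres with proportional labels are not excluded yet, so
    \<open>?V\<close> collects all planes on which \<open>g\<close> acts trivially.\<close>
  let ?P = "{N \<in> F_at v. proportional (lab e) (lab N)}"
  let ?V = "span (\<Union>N\<in>?P. range (tang N v))"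
  let ?Fix = "{u. isotropy v g u = u}"
  have lin: "linear (isotropy v g)" by (rule isotropy(1)[OF v g(1)])
  \<comment> \<open>By linearity it suffices to look at the spanning planes. A plane that the
    average does not kill has \<open>character (lab N) g = 1\<close>, and the choice of
    \<open>g\<close> then forces its label to be proportional to that of \<open>e\<close>.\<close>
  have avg_in: "avg v g n u \<in> ?V" for u
  proof -
    have "subspace {u. avg v g n u \<in> ?V}"
      using linear_subspace_vimage[OF linear_avg[OF v g(1)] subspace_span, of n "\<Union>N\<in>?P. range (tang N v)"]
      by (simp add: vimage_def)
    moreover have "(\<Union>N\<in>F_at v. range (tang N v)) \<subseteq> {u. avg v g n u \<in> ?V}"
    proof
      fix u assume "u \<in> (\<Union>N\<in>F_at v. range (tang N v))"
      then obtain N x where N: "N \<in> F_at v" "u = tang N v x" by blast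
      have "avg v g n u = (if character (lab N) g = 1 then u else 0)"
        unfolding N(2) using avg_tang[OF v _ g(1,2,3)] N(1) F_at_sub by blast
      moreover have "u \<in> ?V" if "character (lab N) g = 1"
      proof -
        have "lab N \<notin> Z" using g(5)[of "lab N"] that by auto
        then have "N \<in> ?P" using N(1) by (auto simp: Z_def)
        then show ?thesis using N(2) by (intro span_base) blast
      qed
      ultimately show "u \<in> {u. avg v g n u \<in> ?V}" by (auto simp: span_zero)
    qed
    ultimately have "span (\<Union>N\<in>F_at v. range (tang N v)) \<subseteq> {u. avg v g n u \<in> ?V}"
      by (rule span_minimal[rotated])
    then show ?thesis using span_planes[OF v] by auto
  qed
  obtain i where i: "lab e $ i \<noteq> 0" using label_nonzero[OF eE] by (auto simp: vec_eq_iff)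
  have "?Fix \<subseteq> (\<Union>N\<in>F_at v. range (tang N v))"
  proof
    fix u assume "u \<in> ?Fix"
    then have "avg v g n u = u" using avg_fixed[OF v g(1,2)] by simp
    then have uV: "u \<in> ?V" using avg_in[of u] by simp
    have "\<exists>s. isotropy v (torus_exp (\<eta> - s *\<^sub>R axis i 1)) u = u" for \<eta>
    proof -
      \<comment> \<open>The projection of \<open>\<eta>\<close> along the \<open>i\<close>-th axis
        to the kernel of \<open>angle (lab e)\<close>; this kernel acts trivially on all of
        \<open>?V\<close>.\<close>
      define \<eta>' where "\<eta>' = \<eta> - (angle (lab e) \<eta> / of_int (lab e $ i)) *\<^sub>R axis i 1"
      have a0: "angle (lab e) \<eta>' = 0" using i by (simp add: \<eta>'_def angle_diff angle_scaleR angle_axis)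
      have lin': "linear (isotropy v (torus_exp \<eta>'))" by (rule isotropy(1)[OF v torus_exp_carrier])
      have "subspace {u. isotropy v (torus_exp \<eta>') u = u}"
        using lin' by (auto simp: subspace_def linear_0 linear_add linear_cmul)
      moreover have "(\<Union>N\<in>?P. range (tang N v)) \<subseteq> {u. isotropy v (torus_exp \<eta>') u = u}"
      proof
        fix w assume "w \<in> (\<Union>N\<in>?P. range (tang N v))"
        then obtain N x where N: "N \<in> F_at v" "proportional (lab e) (lab N)" "w = tang N v x" by blast
        have "character (lab N) (torus_exp \<eta>') = 1"
          using proportional_angle[OF N(2) a0] by (simp add: character_exp)
        then show "w \<in> {u. isotropy v (torus_exp \<eta>') u = u}"
          using tang(3)[OF v subsetD[OF F_at_sub N(1)] torus_exp_carrier, of \<eta>' x] N(3) by simp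
      qed
      ultimately have "?V \<subseteq> {u. isotropy v (torus_exp \<eta>') u = u}" by (rule span_minimal[rotated])
      then have "isotropy v (torus_exp \<eta>') u = u" using uV by blast
      then show ?thesis unfolding \<eta>'_def by blast
    qed
    from direction_in_plane[OF v this] show "u \<in> (\<Union>N\<in>F_at v. range (tang N v))" by blast
  qed
  moreover have "subspace ?Fix" using lin by (auto simp: subspace_def linear_0 linear_add linear_cmul)
  ultimately have "\<exists>P\<in>(\<lambda>N. range (tang N v)) ` F_at v. ?Fix \<subseteq> P"
    using finite_F_at tang(1)[OF v subsetD[OF F_at_sub]]
    by (intro subspace_in_finite_Union) (auto intro: linear_subspace_image)
  then obtain N0 where N0: "N0 \<in> F_at v" "?Fix \<subseteq> range (tang N0 v)" by blast
  have N0E: "N0 \<in> E_at v" using N0(1) F_at_sub by blast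
  have sub: "range (tang e v) \<subseteq> ?Fix"
    using tang(3)[OF v e g(1)] g(4)[OF proportional_refl] by auto
  have dim2: "dim (range (tang N v)) = DIM(complex)" if "N \<in> E_at v" for N
    using dim_image_eq[of "tang N v" UNIV] tang(1,2)[OF v that] by (simp add: inj_on_subset)
  \<comment> \<open>The fixed space lies between two planes of the same dimension.\<close>
  have "range (tang e v) = range (tang N0 v)"
    using sub N0(2) dim2[OF e] dim2[OF N0E] tang(1)[OF v e] tang(1)[OF v N0E]
    by (intro subspace_dim_equal) (auto intro: linear_subspace_image)
  then have "?Fix = range (tang e v)" using sub N0(2) by blast
  then show ?thesis using g(1-4) by blast
qed

text \<open>At \<open>v\<close> the space fixed by \<open>g\<close> is the plane of
  \<open>e\<close>, on which a left inverse of \<open>tang e v\<close> is injective. Transport along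
  \<open>e\<close> commutes with \<open>g\<close> and carries this property to every point
  \<open>p\<close> of the sphere.\<close>

lemma sphere_point_separation:
  assumes v: "v \<in> fix_pts" and e: "e \<in> E_at v"
    and g: "g \<in> carrier torus" "n > 0" "g ^ n = 1" "character (lab e) g = 1"
    and Fix: "{u. isotropy v g u = u} = range (tang e v)" and p: "p \<in> e"
  shows "\<exists>c \<Lambda>. c \<in> charts \<and> p \<in> fst c \<and> linear (\<Lambda> :: real^'m \<Rightarrow> complex) \<and>
    (\<forall>u. tact c c g p u = u \<longrightarrow> \<Lambda> u = 0 \<longrightarrow> u = 0)"
proof -
  have eE: "e \<in> E" using e by (simp add: E_at_def)
  note rp = param[OF eE] and eq = pole_eq[OF v e]
  let ?\<epsilon> = "pole e v"
  note into = rotation_paramD(1)[OF rp pole]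
  have gk: "act g (\<kappa> e ?\<epsilon> \<zeta>) = \<kappa> e ?\<epsilon> \<zeta>" for \<zeta>
    using rotation_paramD(4)[OF rp pole g(1)] g(4) by simp
  have "\<exists>D. transports g (\<kappa> e ?\<epsilon> 0) (\<lambda>c. dchart c (\<kappa> e ?\<epsilon>) 0) p D"
  proof (cases "p = \<kappa> e (- ?\<epsilon>) 0")
    case True
    then show ?thesis using pole_transports[OF rp pole g(1,4,2,3)] by blast
  next
    case False
    then obtain \<zeta> where "p = \<kappa> e ?\<epsilon> \<zeta>" using rotation_paramD(5)[OF rp pole] p by blast
    then show ?thesis
      using param_transports[OF into rotation_paramD(2)[OF rp pole] g(1) gk g(2,3), of 0 \<zeta>] by blast
  qed
  then obtain D where D: "transports g v (\<lambda>c. dchart c (\<kappa> e ?\<epsilon>) 0) p D" unfolding eq by blast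
  have "p \<in> topspace X" using closedin_subset[OF edge_closed[OF eE]] p by blast
  then obtain c where c: "c \<in> B" "p \<in> fst c" using ex_chart_B by blast
  obtain \<Psi> where \<Psi>: "linear \<Psi>" "det (matrix \<Psi>) > 0"
    "\<And>u. \<Psi> (isotropy v g u) = tact c c g p (\<Psi> u)"
    using D chart_at(1,3)[OF v] c unfolding transports_def isotropy_def by blast
  have "invertible (matrix \<Psi>)" using \<Psi>(2) by (simp add: invertible_det_nz)
  then obtain \<Phi> where \<Phi>: "linear \<Phi>" "\<Psi> \<circ> \<Phi> = id" "\<Phi> \<circ> \<Psi> = id"
    using matrix_invertible[OF \<Psi>(1)] by blast
  have inv: "\<Phi> (\<Psi> u) = u" "\<Psi> (\<Phi> u) = u" for u using \<Phi>(2,3) by (auto simp: fun_eq_iff)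
  obtain \<Lambda>0 where \<Lambda>0: "linear \<Lambda>0" "\<And>x. \<Lambda>0 (tang e v x) = x"
    using linear_injective_left_inverse[OF tang(1,2)[OF v e]] by (auto simp: fun_eq_iff)
  have "u = 0" if u: "tact c c g p u = u" "\<Lambda>0 (\<Phi> u) = 0" for u
  proof -
    have "\<Psi> (isotropy v g (\<Phi> u)) = u" using \<Psi>(3)[of "\<Phi> u"] inv(2) u(1) by simp
    then have "isotropy v g (\<Phi> u) = \<Phi> u" using inv(1)[of "isotropy v g (\<Phi> u)"] by simp
    then obtain x where x: "\<Phi> u = tang e v x" using Fix by blast
    then have "x = 0" using u(2) \<Lambda>0(2)[of x] by simp
    then have "\<Phi> u = 0" using x linear_0[OF tang(1)[OF v e]] by simp
    then show "u = 0" using inv(2)[of u] linear_0[OF \<Psi>(1)] by simp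
  qed
  moreover have "linear (\<lambda>u. \<Lambda>0 (\<Phi> u))" using linear_compose[OF \<Phi>(1) \<Lambda>0(1)] by (simp add: o_def)
  ultimately show ?thesis using c by blast
qed

text \<open>The common points of the two spheres form a closed set, which is open in each sphere by
  \<open>spheres_agree_locally\<close>; spheres are connected. The local statement is needed at all
  common points, not only at \<open>v\<close>.\<close>

lemma edge_determined_by_label:
  assumes v: "v \<in> fix_pts" and e: "e \<in> E_at v" "e' \<in> E_at v" and pr: "proportional (lab e) (lab e')"
  shows "e = e'"
proof -
  have E: "e \<in> E" "e' \<in> E" "v \<in> e" "v \<in> e'" using e by (auto simp: E_at_def)
  obtain g n where g: "g \<in> carrier torus" "n > 0" "g ^ n = 1"
    "\<And>b. proportional (lab e) b \<Longrightarrow> character b g = 1" "{u. isotropy v g u = u} = range (tang e v)"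
    using fixed_plane[OF v e(1)] by blast
  have ch: "character (lab e) g = 1" "character (lab e') g = 1" using g(4) proportional_refl pr by auto
  have loc: "(\<exists>W. openin X W \<and> p \<in> W \<and> e \<inter> W \<subseteq> e') \<and> (\<exists>W. openin X W \<and> p \<in> W \<and> e' \<inter> W \<subseteq> e)"
    if p: "p \<in> e" "p \<in> e'" for p
  proof -
    obtain c \<Lambda> where c: "c \<in> charts" "p \<in> fst c" and \<Lambda>: "linear (\<Lambda> :: real^'m \<Rightarrow> complex)"
      "\<And>u. tact c c g p u = u \<Longrightarrow> \<Lambda> u = 0 \<Longrightarrow> u = 0"
      using sphere_point_separation[OF v e(1) g(1-3) ch(1) g(5) p(1)] by blast
    show ?thesis
      using spheres_agree_locally[OF param[OF E(1)] param[OF E(2)] p c g(1) ch \<Lambda>]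
        spheres_agree_locally[OF param[OF E(2)] param[OF E(1)] p(2,1) c g(1) ch(2,1) \<Lambda>] by blast
  qed
  have conn: "connectedin X e" "connectedin X e'"
    using param[OF E(1)] param[OF E(2)] unfolding rotation_param_def by blast+
  have "e \<subseteq> e'"
    by (rule connectedin_clopen_subset[OF conn(1) edge_closed[OF E(2)] E(3,4)]) (use loc in blast)
  moreover have "e' \<subseteq> e"
    by (rule connectedin_clopen_subset[OF conn(2) edge_closed[OF E(1)] E(4,3)]) (use loc in blast)
  ultimately show ?thesis by blast
qed

text \<open>A tangent vector of \<open>e\<close> meets the hypothesis of
  \<open>direction_in_plane\<close> and so is tangent to a sphere of \<open>F\<close>. Comparing
  weights gives proportional labels, hence the same sphere. In particular only finitely many edges
  meet at \<open>v\<close>.\<close>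

lemma E_at_eq:
  assumes v: "v \<in> fix_pts"
  shows "E_at v = F_at v"
proof
  show "E_at v \<subseteq> F_at v"
  proof
    fix e assume e: "e \<in> E_at v"
    have eE: "e \<in> E" using e by (simp add: E_at_def)
    obtain i where i: "lab e $ i \<noteq> 0" using label_nonzero[OF eE] by (auto simp: vec_eq_iff)
    have "\<exists>s. isotropy v (torus_exp (\<eta> - s *\<^sub>R axis i 1)) (tang e v 1) = tang e v 1" for \<eta>
    proof -
      have "angle (lab e) (\<eta> - (angle (lab e) \<eta> / of_int (lab e $ i)) *\<^sub>R axis i 1) = 0"
        using i by (simp add: angle_diff angle_scaleR angle_axis)
      then have "character (lab e) (torus_exp (\<eta> - (angle (lab e) \<eta> / of_int (lab e $ i)) *\<^sub>R axis i 1)) = 1"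
        by (simp add: character_exp)
      then show ?thesis using tang(3)[OF v e torus_exp_carrier] by (metis mult_1)
    qed
    from direction_in_plane[OF v this] obtain N x where N: "N \<in> F_at v" "tang e v 1 = tang N v x" by blast
    have NE: "N \<in> E_at v" using N(1) F_at_sub by blast
    have "proportional (lab e) (lab N)"
    proof (rule ccontr)
      \<comment> \<open>Then some \<open>g\<close> fixes the plane of \<open>e\<close> and moves
        every nonzero vector in the plane of \<open>N\<close>, although \<open>tang e v 1\<close>
        lies in both.\<close>
      assume "\<not> proportional (lab e) (lab N)"
      then obtain g n where g: "g \<in> carrier torus" "n > 0" "g ^ n = 1"
        "\<And>b. proportional (lab e) b \<Longrightarrow> character b g = 1" "\<And>z. z \<in> {lab N} \<Longrightarrow> Im (character z g) \<noteq> 0"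
        using generic_torsion_element[of "{lab N}" "lab e"] label_nonzero[OF eE] by blast
      have "tang N v (character (lab N) g * x) = tang N v x"
        using tang(3)[OF v e g(1), of 1] g(4)[OF proportional_refl] tang(3)[OF v NE g(1), of x] N(2) by simp
      then have "character (lab N) g * x = x" using injD[OF tang(2)[OF v NE]] by blast
      moreover have "character (lab N) g \<noteq> 1" using g(5) by force
      ultimately have "x = 0" by simp
      then have "tang e v 1 = tang e v 0" using N(2) linear_0[OF tang(1)[OF v NE]] linear_0[OF tang(1)[OF v e]] by simp
      then show False using injD[OF tang(2)[OF v e]] by fastforce
    qed
    then show "e \<in> F_at v" using edge_determined_by_label[OF v e NE] N(1) by simp
  qed
qed (rule F_at_sub)

lemma finite_E_at: "v \<in> fix_pts \<Longrightarrow> finite (E_at v)"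
  using E_at_eq finite_F_at by simp

text \<open>Averaging over an element that is generic for the label of \<open>e\<close> keeps the
  plane of \<open>e\<close> and kills all others.\<close>

lemma planes_independent:
  assumes v: "v \<in> fix_pts" and e: "e \<in> E_at v" and sum: "(\<Sum>N\<in>E_at v. tang N v (x N)) = 0"
  shows "x e = 0"
proof -
  have eE: "e \<in> E" using e by (simp add: E_at_def)
  note fin = finite_E_at[OF v]
  define Z where "Z = lab ` (E_at v - {e})"
  have Z: "finite Z" "\<And>z. z \<in> Z \<Longrightarrow> \<not> proportional (lab e) z"
    using edge_determined_by_label[OF v e] fin by (auto simp: Z_def)
  obtain g n where g: "g \<in> carrier torus" "n > 0" "g ^ n = 1"
    "\<And>b. proportional (lab e) b \<Longrightarrow> character b g = 1" "\<And>z. z \<in> Z \<Longrightarrow> Im (character z g) \<noteq> 0"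
    using generic_torsion_element[OF Z(1) label_nonzero[OF eE] Z(2)] by blast
  have "avg v g n (tang N v (x N)) = (if N = e then tang e v (x e) else 0)" if N: "N \<in> E_at v" for N
  proof (cases "N = e")
    case False
    then have "Im (character (lab N) g) \<noteq> 0" using g(5)[of "lab N"] N by (simp add: Z_def)
    then have "character (lab N) g \<noteq> 1" by auto
    then show ?thesis using avg_tang[OF v N g(1-3)] False by simp
  qed (use avg_tang[OF v e g(1-3)] g(4)[OF proportional_refl] in simp)
  then have "(\<Sum>N\<in>E_at v. avg v g n (tang N v (x N))) = (\<Sum>N\<in>E_at v. if N = e then tang e v (x e) else 0)"
    by (intro sum.cong) auto
  also have "\<dots> = tang e v (x e)" using fin e by simp
  finally have "avg v g n 0 = tang e v (x e)"
    using sum linear_sum[OF linear_avg[OF v g(1)], of n "\<lambda>N. tang N v (x N)" "E_at v"] by simp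
  then have "tang e v (x e) = tang e v 0"
    using linear_0[OF linear_avg[OF v g(1)]] linear_0[OF tang(1)[OF v e]] by simp
  then show ?thesis using injD[OF tang(2)[OF v e]] by blast
qed

end

section \<open>Orientation signs of the fixed points\<close>

text \<open>On an element where \<open>a\<close> is trivial the multiple of \<open>a\<close>
  disappears, and a sign \<open>s = -1\<close> conjugates the value. This turns the signs in the
  congruences of a connection into ratios of signs of imaginary parts.\<close>

lemma character_transport:
  assumes t: "t \<in> carrier torus" and a: "character a t = 1" and s: "s \<in> {1, -1}"
  shows "Im (character (s *s b + c *s a) t) = of_int s * Im (character b t)"
proof -
  obtain \<theta> where \<theta>: "t = torus_exp \<theta>" using torus_exp_surj[OF t] by blast
  have "cis (of_int c * angle a \<theta>) = 1"
    using a unfolding \<theta> character_exp by (metis cis_power_int power_int_1_left)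
  then have "character (s *s b + c *s a) t = cis (of_int s * angle b \<theta>)"
    unfolding \<theta> character_exp by (simp add: angle_add_left angle_cmul_left flip: cis_mult)
  then show ?thesis using s by (auto simp: \<theta> character_exp)
qed

context gkm_setting
begin

text \<open>The planes are independent and span, so the vectors \<open>b (N, i)\<close> form a real
  basis. The valence is thus the same at all fixed points, and one index set \<open>I\<close> serves
  all of them.\<close>

lemma card_E_at:
  assumes v: "v \<in> fix_pts"
  shows "2 * card (E_at v) = CARD('m)"
proof -
  let ?S = "E_at v \<times> (UNIV :: bool set)"
  define b where "b = (\<lambda>(N, i). tang N v (if i then \<i> else 1))"
  note fin = finite_E_at[OF v]
  have lin: "linear (tang N v)" if "N \<in> E_at v" for N by (rule tang(1)[OF v that])
  have split: "(\<Sum>x\<in>?S. k x *\<^sub>R b x) = (\<Sum>N\<in>E_at v. tang N v (Complex (k (N, False)) (k (N, True))))" for k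
  proof -
    have "(\<Sum>x\<in>?S. k x *\<^sub>R b x) = (\<Sum>N\<in>E_at v. \<Sum>i\<in>UNIV. k (N, i) *\<^sub>R b (N, i))"
      by (simp add: sum.cartesian_product)
    also have "\<dots> = (\<Sum>N\<in>E_at v. tang N v (Complex (k (N, False)) (k (N, True))))"
    proof (rule sum.cong[OF refl])
      fix N assume N: "N \<in> E_at v"
      have "k (N, False) *\<^sub>R 1 + k (N, True) *\<^sub>R \<i> = Complex (k (N, False)) (k (N, True))"
        by (simp add: complex_eq_iff)
      then show "(\<Sum>i\<in>UNIV. k (N, i) *\<^sub>R b (N, i)) = tang N v (Complex (k (N, False)) (k (N, True)))"
        by (simp add: UNIV_bool b_def flip: linear_cmul[OF lin[OF N]] linear_add[OF lin[OF N]])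
    qed
    finally show ?thesis .
  qed
  have zero: "k x = 0" if k: "(\<Sum>x\<in>?S. k x *\<^sub>R b x) = 0" and x: "x \<in> ?S" for k x
  proof -
    obtain N i where Ni: "x = (N, i)" "N \<in> E_at v" using x by blast
    have "Complex (k (N, False)) (k (N, True)) = 0"
      by (rule planes_independent[OF v Ni(2), where x = "\<lambda>N. Complex (k (N, False)) (k (N, True))"])
         (use k split in simp)
    then show ?thesis using Ni by (cases i) (auto simp: complex_eq_iff)
  qed
  have finS: "finite ?S" using fin by simp
  have inj: "inj_on b ?S"
  proof (rule inj_onI, rule ccontr)
    fix x y assume xy: "x \<in> ?S" "y \<in> ?S" "b x = b y" "x \<noteq> y"
    define k where "k = (\<lambda>z. if z = x then 1 else if z = y then -1 else 0 :: real)"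
    have "(\<Sum>z\<in>?S. k z *\<^sub>R b z) = (\<Sum>z\<in>{x, y}. k z *\<^sub>R b z)"
      by (rule sum.mono_neutral_right[OF finS]) (use xy in \<open>auto simp: k_def\<close>)
    also have "\<dots> = 0" using xy by (simp add: k_def)
    finally show False using zero[of k x] xy(1) by (simp add: k_def)
  qed
  have "independent (b ` ?S)"
  proof (rule independent_if_scalars_zero)
    fix f w assume f: "(\<Sum>w\<in>b ` ?S. f w *\<^sub>R w) = 0" and w: "w \<in> b ` ?S"
    have "(\<Sum>x\<in>?S. f (b x) *\<^sub>R b x) = 0" using f by (simp add: sum.reindex[OF inj] o_def)
    then show "f w = 0" using zero[of "\<lambda>x. f (b x)"] w by blast
  qed (use finS in simp)
  moreover have "span (b ` ?S) = UNIV"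
  proof -
    have "(\<Union>N\<in>F_at v. range (tang N v)) \<subseteq> span (b ` ?S)"
    proof
      fix u assume "u \<in> (\<Union>N\<in>F_at v. range (tang N v))"
      then obtain N x where N: "N \<in> E_at v" "u = tang N v x" using F_at_sub by blast
      have x: "Re x *\<^sub>R 1 + Im x *\<^sub>R \<i> = x" by (simp add: complex_eq_iff)
      have "Re x *\<^sub>R b (N, False) + Im x *\<^sub>R b (N, True) = tang N v (Re x *\<^sub>R 1 + Im x *\<^sub>R \<i>)"
        by (simp only: b_def case_prod_conv if_True if_False linear_add[OF lin[OF N(1)]] linear_cmul[OF lin[OF N(1)]])
      then have "u = Re x *\<^sub>R b (N, False) + Im x *\<^sub>R b (N, True)"
        unfolding x N(2) by (rule sym)
      moreover have "b (N, i) \<in> span (b ` ?S)" for i using N(1) by (intro span_base) blast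
      ultimately show "u \<in> span (b ` ?S)" by (simp add: span_add span_scale)
    qed
    then have "span (\<Union>N\<in>F_at v. range (tang N v)) \<subseteq> span (b ` ?S)" by (rule span_minimal) simp
    then show ?thesis using span_planes[OF v] by blast
  qed
  ultimately have "card (b ` ?S) = dim (UNIV :: (real^'m) set)"
    using basis_card_eq_dim[of "b ` ?S" UNIV] by simp
  then show ?thesis by (simp add: card_image[OF inj] card_cartesian_product)
qed

end

locale gkm_frame = gkm_setting X A B act E F lab \<kappa> + coordinate_pairing I h
  for X :: "'a topology" and A B :: "('a, real^'m) chart set" and act :: "complex^'k \<Rightarrow> 'a \<Rightarrow> 'a"
    and E F :: "'a set set" and lab :: "'a set \<Rightarrow> int^'k" and \<kappa> :: "'a set \<Rightarrow> real \<Rightarrow> complex \<Rightarrow> 'a"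
    and I :: "nat set" and h :: "nat \<times> bool \<Rightarrow> 'm"
begin

definition idx :: "'a \<Rightarrow> nat \<Rightarrow> 'a set" where
  "idx v = (SOME f. bij_betw f I (E_at v))"

lemma idx:
  assumes v: "v \<in> fix_pts"
  shows "bij_betw (idx v) I (E_at v)"
proof -
  have "card (I \<times> (UNIV::bool set)) = CARD('m)" using bij_betw_same_card[OF h] by simp
  then have "card I = card (E_at v)" using card_E_at[OF v] by (simp add: card_cartesian_product)
  then have "\<exists>f. bij_betw f I (E_at v)"
    using finite_same_card_bij[OF finite_I finite_E_at[OF v]] by blast
  then show ?thesis unfolding idx_def by (rule someI_ex)
qed

definition frame :: "'a \<Rightarrow> real^'m \<Rightarrow> real^'m" where
  "frame v u = (\<Sum>i\<in>I. tang (idx v i) v (coord u i))"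

text \<open>The arbitrary enumeration \<open>idx\<close> does no harm, as permuting complex lines
  preserves orientation. The pairing \<open>h\<close> is the same at all fixed points, so its choice
  cancels in a product of two signs.\<close>

definition orientation_sign :: "'a \<Rightarrow> real" where
  "orientation_sign v = sgn (det (matrix (frame v)))"

context
  fixes v assumes v: "v \<in> fix_pts"
begin

lemma idx_in: "i \<in> I \<Longrightarrow> idx v i \<in> E_at v"
  using idx[OF v] bij_betwE by blast

lemma linear_frame: "linear (frame v)"
  unfolding frame_def
  by (intro linear_compose_sum ballI linear_compose[OF linear_coord, unfolded o_def] tang(1)[OF v idx_in])

lemma inj_frame: "inj (frame v)"
  unfolding linear_injective_0[OF linear_frame]
proof (intro allI impI)
  fix u assume u: "frame v u = 0"
  let ?x = "\<lambda>N. coord u (inv_into I (idx v) N)"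
  have inj: "inj_on (idx v) I" using idx[OF v] by (simp add: bij_betw_def)
  have "(\<Sum>N\<in>E_at v. tang N v (?x N)) = (\<Sum>i\<in>I. tang (idx v i) v (?x (idx v i)))"
    by (rule sum.reindex_bij_betw[OF idx[OF v], symmetric])
  also have "\<dots> = 0" using u inj by (simp add: frame_def)
  finally have "?x N = 0" if "N \<in> E_at v" for N using planes_independent[OF v that, of ?x] by blast
  then have "coord u i = 0" if "i \<in> I" for i using that idx_in[OF that] inj by fastforce
  then show "u = 0" by (intro eq_if_coord) simp
qed

lemma frame_inverse: "\<exists>G. linear G \<and> (\<forall>u. G (frame v u) = u) \<and> (\<forall>u. frame v (G u) = u)"
  using linear_injective_isomorphism[OF linear_frame inj_frame] by blast

lemma orientation_sign: "orientation_sign v = 1 \<or> orientation_sign v = - 1"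
proof -
  obtain G where G: "linear G" "\<And>u. G (frame v u) = u" using frame_inverse by blast
  have "G \<circ> frame v = id" using G(2) by (simp add: fun_eq_iff)
  then have "matrix G ** matrix (frame v) = mat 1"
    using matrix_compose[OF linear_frame G(1)] by (simp add: matrix_id_mat_1)
  from arg_cong[OF this, of det] have "det (matrix (frame v)) \<noteq> 0" by (auto simp: det_mul)
  then show ?thesis by (simp add: orientation_sign_def sgn_if)
qed

lemma frame_scale:
  assumes "g \<in> carrier torus"
  shows "frame v (coord_scale (\<lambda>i. character (lab (idx v i)) g) u) = isotropy v g (frame v u)"
  unfolding frame_def linear_sum[OF isotropy(1)[OF v assms]]
  by (rule sum.cong[OF refl]) (simp add: tang(3)[OF v idx_in assms])

lemma frame_of_coords:
  assumes "i0 \<in> I" "idx v i0 = e"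
  shows "frame v (of_coords (\<lambda>i. if i = i0 then x else 0)) = tang e v x"
proof -
  have "frame v (of_coords (\<lambda>i. if i = i0 then x else 0)) = (\<Sum>i\<in>I. if i = i0 then tang e v x else 0)"
    unfolding frame_def
    by (rule sum.cong[OF refl]) (use assms linear_0[OF tang(1)[OF v idx_in]] in auto)
  then show ?thesis using assms finite_I by simp
qed

end

text \<open>Read in the frames at \<open>v\<close> and \<open>w\<close>, the transport along
  \<open>e\<close> is a map \<open>M\<close> whose determinant has the sign
  \<open>orientation_sign v * orientation_sign w\<close>. \<open>sgn_det_intertwiner\<close>
  computes this sign from the imaginary parts of the weights at \<open>g\<close>, and imaginary
  parts that correspond under \<open>T\<close> differ by the factor \<open>s f\<close>.\<close>

lemma orientation_sign_edge:
  assumes e: "e \<in> E" "e \<inter> fix_pts = {v, w}"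
    and nabla: "bij_betw T (E_at v) (E_at w)" "T e = e"
    and s: "\<And>f. f \<in> E_at v - {e} \<Longrightarrow> s f \<in> {1, -1} \<and> (\<exists>c. lab (T f) = s f *s lab f + c *s lab e)"
  shows "of_int (- (\<Prod>f\<in>E_at v - {e}. s f)) = orientation_sign v * orientation_sign w"
proof -
  have v: "v \<in> fix_pts" "v \<in> e" and w: "w \<in> fix_pts" "w \<in> e" using e(2) by blast+
  have ev: "e \<in> E_at v" and ew: "e \<in> E_at w" using e(1) v w by (auto simp: E_at_def)
  have vw: "v \<noteq> w" using poles[OF e(1)] e(2) by (metis doubleton_eq_iff insert_absorb2)
  have pole_w: "pole e w = - pole e v"
    using pole_eq[OF v(1) ev] pole_eq[OF w(1) ew] vw by (auto simp: pole_def split: if_splits)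
  \<comment> \<open>The same \<open>g\<close> has to be generic at both ends of the edge.\<close>
  define Z where "Z = lab ` (E_at v - {e}) \<union> lab ` (E_at w - {e})"
  have Z: "finite Z" "\<And>z. z \<in> Z \<Longrightarrow> \<not> proportional (lab e) z"
    using edge_determined_by_label[OF v(1) ev] edge_determined_by_label[OF w(1) ew]
      finite_E_at[OF v(1)] finite_E_at[OF w(1)] by (auto simp: Z_def)
  obtain g n where g: "g \<in> carrier torus" "n > 0" "g ^ n = 1"
    "\<And>b. proportional (lab e) b \<Longrightarrow> character b g = 1" "\<And>z. z \<in> Z \<Longrightarrow> Im (character z g) \<noteq> 0"
    using generic_torsion_element[OF Z(1) label_nonzero[OF e(1)] Z(2)] by blast
  have ge: "character (lab e) g = 1" by (rule g(4)[OF proportional_refl])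
  have "transports g v (\<lambda>c. dchart c (\<kappa> e (pole e v)) 0) w (\<lambda>c x. dchart c (\<kappa> e (pole e w)) 0 (- cnj x))"
    using pole_transports[OF param[OF e(1)] pole[of e v] g(1) ge g(2,3)] pole_eq[OF v(1) ev] pole_eq[OF w(1) ew]
    by (simp add: pole_w)
  then obtain \<Psi> where \<Psi>: "linear \<Psi>" "det (matrix \<Psi>) > 0"
    "\<And>u. \<Psi> (isotropy v g u) = isotropy w g (\<Psi> u)" "\<And>x. \<Psi> (tang e v x) = tang e w (- cnj x)"
    using chart_at(1,3)[OF v(1)] chart_at(1,3)[OF w(1)] unfolding transports_def isotropy_def tang_def by blast
  obtain G where G: "linear G" "\<And>u. G (frame w u) = u" "\<And>u. frame w (G u) = u"
    using frame_inverse[OF w(1)] by blast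
  define \<omega> where "\<omega> = (\<lambda>i. character (lab (idx v i)) g)"
  define \<omega>' where "\<omega>' = (\<lambda>i. character (lab (idx w i)) g)"
  define M where "M = G \<circ> (\<Psi> \<circ> frame v)"
  have linM: "linear M" 
    unfolding M_def by (rule linear_compose[OF linear_compose[OF linear_frame[OF v(1)] \<Psi>(1)] G(1)])
  obtain i0 where i0: "i0 \<in> I" "idx v i0 = e"
    using ev unfolding bij_betw_imp_surj_on[OF idx[OF v(1)], symmetric] by (elim imageE) simp
  obtain i1 where i1: "i1 \<in> I" "idx w i1 = e"
    using ew unfolding bij_betw_imp_surj_on[OF idx[OF w(1)], symmetric] by (elim imageE) simp
  have inj_v: "inj_on (idx v) I" and inj_w: "inj_on (idx w) I"
    using idx[OF v(1)] idx[OF w(1)] by (auto simp: bij_betw_def)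
  have bij_v: "bij_betw (idx v) (I - {i0}) (E_at v - {e})" and bij_w: "bij_betw (idx w) (I - {i1}) (E_at w - {e})"
    using bij_betw_DiffI[OF idx[OF v(1)], of "{i0}" "{e}"] bij_betw_DiffI[OF idx[OF w(1)], of "{i1}" "{e}"] i0 i1 ev ew
    by (auto simp: bij_betw_def)
  have bij_n: "bij_betw T (E_at v - {e}) (E_at w - {e})"
    using bij_betw_DiffI[OF nabla(1), of "{e}" "{e}"] nabla(2) ev ew by (auto simp: bij_betw_def)
  have ImZ: "Im (\<omega> i) \<noteq> 0" if "i \<in> I - {i0}" for i
    using g(5)[of "lab (idx v i)"] bij_betwE[OF bij_v] that unfolding \<omega>_def Z_def by blast
  have ImZ': "Im (\<omega>' i) \<noteq> 0" if "i \<in> I - {i1}" for i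
    using g(5)[of "lab (idx w i)"] bij_betwE[OF bij_w] that unfolding \<omega>'_def Z_def by blast
  have inter: "M (coord_scale \<omega> u) = coord_scale \<omega>' (M u)" for u
  proof -
    have "M (coord_scale \<omega> u) = G (isotropy w g (\<Psi> (frame v u)))"
      unfolding M_def \<omega>_def by (simp add: frame_scale[OF v(1) g(1)] \<Psi>(3))
    also have "\<dots> = G (isotropy w g (frame w (M u)))" by (simp add: M_def G(3))
    also have "\<dots> = coord_scale \<omega>' (M u)" unfolding frame_scale[OF w(1) g(1), symmetric] \<omega>'_def by (rule G(2))
    finally show ?thesis .
  qed
  have Me: "M (of_coords (\<lambda>i. if i = i0 then x else 0)) = of_coords (\<lambda>i. if i = i1 then - cnj x else 0)" for x
    using G(2)[of "of_coords (\<lambda>i. if i = i1 then - cnj x else 0)"]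
    by (simp add: M_def frame_of_coords[OF v(1) i0] \<Psi>(4) frame_of_coords[OF w(1) i1])
  let ?P = "\<Prod>i\<in>I - {i0}. sgn (Im (\<omega> i))" and ?P' = "\<Prod>i\<in>I - {i1}. sgn (Im (\<omega>' i))"
  have nonneg: "0 \<le> - (det (matrix M) * (?P * ?P'))"
    by (rule sgn_det_intertwiner[OF linM i0(1) i1(1) _ _ _ _ ImZ ImZ' inter Me])
       (use character_norm[OF g(1)] ge i0 i1 in \<open>simp_all add: \<omega>_def \<omega>'_def\<close>)
  let ?\<sigma> = "\<lambda>f. sgn (Im (character (lab f) g))"
  have P: "?P = (\<Prod>f\<in>E_at v - {e}. ?\<sigma> f)"
    unfolding \<omega>_def by (rule prod.reindex_bij_betw[OF bij_v])
  have "?P' = (\<Prod>f\<in>E_at w - {e}. ?\<sigma> f)"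
    unfolding \<omega>'_def by (rule prod.reindex_bij_betw[OF bij_w])
  also have "\<dots> = (\<Prod>f\<in>E_at v - {e}. ?\<sigma> (T f))"
    by (rule prod.reindex_bij_betw[OF bij_n, symmetric])
  also have "\<dots> = (\<Prod>f\<in>E_at v - {e}. of_int (s f) * ?\<sigma> f)"
  proof (rule prod.cong[OF refl])
    fix f assume f: "f \<in> E_at v - {e}"
    obtain c where "s f \<in> {1, -1}" "lab (T f) = s f *s lab f + c *s lab e" using s[OF f] by blast
    then show "?\<sigma> (T f) = of_int (s f) * ?\<sigma> f"
      using character_transport[OF g(1) ge, of "s f" "lab f" c] by (auto simp: sgn_mult)
  qed
  finally have "?P * ?P' = (\<Prod>f\<in>E_at v - {e}. ?\<sigma> f * (of_int (s f) * ?\<sigma> f))"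
    unfolding P by (simp add: prod.distrib)
  also have "\<dots> = (\<Prod>f\<in>E_at v - {e}. of_int (s f))"
  proof (rule prod.cong[OF refl])
    fix f assume "f \<in> E_at v - {e}"
    then have "Im (character (lab f) g) \<noteq> 0" using g(5)[of "lab f"] unfolding Z_def by blast
    then show "?\<sigma> f * (of_int (s f) * ?\<sigma> f) = of_int (s f)" by (simp add: sgn_if)
  qed
  also have "\<dots> = of_int (\<Prod>f\<in>E_at v - {e}. s f)" by simp
  finally have PP: "?P * ?P' = of_int (\<Prod>f\<in>E_at v - {e}. s f)" .
  have s1: "(\<Prod>f\<in>E_at v - {e}. s f) \<in> {1, -1}"
  proof -
    have "\<bar>\<Prod>f\<in>E_at v - {e}. s f\<bar> = (\<Prod>f\<in>E_at v - {e}. \<bar>s f\<bar>)" by (rule abs_prod)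
    also have "\<dots> = 1" using s by (intro prod.neutral) force
    finally show ?thesis by auto
  qed
  have "G \<circ> frame w = id" using G(2) by (simp add: fun_eq_iff)
  then have "matrix G ** matrix (frame w) = mat 1"
    using matrix_compose[OF linear_frame[OF w(1)] G(1)] by (simp add: matrix_id_mat_1)
  from arg_cong[OF this, of det] have dG: "det (matrix G) * det (matrix (frame w)) = 1" by (simp add: det_mul)
  have "sgn (det (matrix G)) * orientation_sign w = 1"
    unfolding orientation_sign_def sgn_mult[symmetric] dG by simp
  then have "sgn (det (matrix G)) = orientation_sign w" using orientation_sign[OF w(1)] by auto
  moreover have "det (matrix M) = det (matrix G) * (det (matrix \<Psi>) * det (matrix (frame v)))"
    unfolding M_def by (simp add: matrix_compose linear_compose linear_frame[OF v(1)] \<Psi>(1) G(1) det_mul)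
  ultimately have "sgn (det (matrix M)) = orientation_sign w * orientation_sign v"
    using \<Psi>(2) by (simp add: sgn_mult orientation_sign_def)
  moreover have "sgn (det (matrix M)) * of_int (\<Prod>f\<in>E_at v - {e}. s f) \<le> 0"
  proof -
    have "det (matrix M) * of_int (\<Prod>f\<in>E_at v - {e}. s f) \<le> 0" using nonneg unfolding PP by linarith
    then show ?thesis using s1 by (auto simp: sgn_if simp del: of_int_prod)
  qed
  \<comment> \<open>All three factors are signs, so a product that is not positive equals
    -1.\<close>
  ultimately have "orientation_sign w * orientation_sign v * of_int (\<Prod>f\<in>E_at v - {e}. s f) \<le> 0" by simp
  then show ?thesis
    using s1 orientation_sign[OF v(1)] orientation_sign[OF w(1)] by (auto simp del: of_int_prod)
qed

end

section \<open>Signs along closed edge paths\<close>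

lemma prod_telescope_signs:
  fixes f :: "nat \<Rightarrow> 'b::comm_monoid_mult"
  assumes "\<And>i. i \<le> m \<Longrightarrow> f i * f i = 1"
  shows "(\<Prod>i<m. f i * f (Suc i)) = f 0 * f m"
  using assms
proof (induction m)
  case 0
  then show ?case by simp
next
  case (Suc m)
  have "(\<Prod>i<Suc m. f i * f (Suc i)) = f 0 * f m * (f m * f (Suc m))" using Suc by simp
  also have "\<dots> = f 0 * (f m * f m) * f (Suc m)" by (simp only: mult.assoc)
  finally show ?case using Suc.prems[of m] by simp
qed

text \<open>Two different signs would make a nonzero multiple of the label of \<open>f\<close> a
  multiple of the label of \<open>e\<close>. This is what gives the \<open>THE\<close> in
  \<open>transport_sign\<close> its meaning.\<close>

lemma transport_sign_eqI:
  assumes np: "\<not> proportional (\<alpha> e) (\<alpha> f)" and s: "s \<in> {1, -1}" "\<alpha> (conn e v w f) = s *s \<alpha> f + c *s \<alpha> e"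
  shows "transport_sign conn \<alpha> e v w f = s"
  unfolding transport_sign_def
proof (rule the_equality)
  show "s \<in> {1, - 1} \<and> (\<exists>c. \<alpha> (conn e v w f) = s *s \<alpha> f + c *s \<alpha> e)" using s by blast
  fix s' assume "s' \<in> {1, - 1} \<and> (\<exists>c. \<alpha> (conn e v w f) = s' *s \<alpha> f + c *s \<alpha> e)"
  then obtain c' where "s' *s \<alpha> f + c' *s \<alpha> e = s *s \<alpha> f + c *s \<alpha> e" using s(2) by auto
  then have "(s' - s) *s \<alpha> f = (c - c') *s \<alpha> e"
    by (simp add: vec_eq_iff algebra_simps)
  then have "s' - s = 0" using np unfolding proportional_def by blast
  then show "s' = s" by simp
qed

lemma gkm_manifoldD:
  fixes A :: "('a, real^'m) chart set"
  assumes "gkm_manifold G X A act"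
  shows "even CARD('m)" "smooth_manifold X A" "orientable_manifold X A"
    "smooth_effective_torus_action X A act" "finite (fixed_points X act)"
    "\<exists>F. finite F \<and> (\<forall>N\<in>F. invariant_2_sphere X A act N) \<and> one_skeleton X A act = \<Union>F"
  using assms unfolding gkm_manifold_def by - (elim conjE, assumption)+

theorem proposition1p4:
  fixes X :: "'a topology"
    and A :: "('a, real^'m) chart set"
    and act :: "complex^'k \<Rightarrow> 'a \<Rightarrow> 'a"
    and \<Gamma> :: "('a, 'a set, 'k) labelled_graph"
    and conn :: "'a set \<Rightarrow> 'a \<Rightarrow> 'a \<Rightarrow> 'a set \<Rightarrow> 'a set"
  assumes "integer_gkm_manifold X A act \<or> rational_gkm_manifold X A act"
    and "is_gkm_graph X A act \<Gamma>"
    and "compatible_connection \<Gamma> conn"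
  shows "orientable_gkm_graph \<Gamma> conn"
proof -
  have mfd: "even CARD('m)" "smooth_manifold X A" "orientable_manifold X A"
    "smooth_effective_torus_action X A act" "finite (fixed_points X act)"
    "\<exists>F. finite F \<and> (\<forall>N\<in>F. invariant_2_sphere X A act N) \<and> one_skeleton X A act = \<Union>F"
    using assms(1) by - (erule disjE; erule gkm_manifoldD)+
  obtain F where F0: "finite F \<and> (\<forall>N\<in>F. invariant_2_sphere X A act N) \<and> one_skeleton X A act = \<Union>F"
    using mfd(6) by (elim exE)
  have F: "finite F" "\<And>N. N \<in> F \<Longrightarrow> invariant_2_sphere X A act N" "one_skeleton X A act = \<Union>F"
    by (rule conjunct1[OF F0], rule bspec[OF conjunct1[OF conjunct2[OF F0]]], assumption,
        rule conjunct2[OF conjunct2[OF F0]])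
  obtain B where B: "smooth_atlas X B" "smooth_atlas X (A \<union> B)"
    "\<And>c d y. c \<in> B \<Longrightarrow> d \<in> B \<Longrightarrow> y \<in> snd c ` (fst c \<inter> fst d) \<Longrightarrow>
      det (matrix (frechet_derivative (transition c d) (at y))) > 0"
    using mfd(3) unfolding orientable_manifold_def by meson
  have \<Gamma>: "verts \<Gamma> = fixed_points X act" "edges \<Gamma> = {N. invariant_2_sphere X A act N}"
    "\<And>N. N \<in> edges \<Gamma> \<Longrightarrow> ends \<Gamma> N = N \<inter> fixed_points X act"
    "\<And>N. N \<in> edges \<Gamma> \<Longrightarrow> \<exists>a. glabel \<Gamma> N = {a, - a} \<and> has_rotation_label X A act N a"
    using assms(2) unfolding is_gkm_graph_def by blast+
  interpret oriented_torus_manifold X A B act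
    by unfold_locales (use mfd B in \<open>auto simp: smooth_manifold_def\<close>)
  \<comment> \<open>An arbitrary choice of representatives; no particular signs have to be
    arranged.\<close>
  obtain lab where lab: "\<And>N. N \<in> edges \<Gamma> \<Longrightarrow> glabel \<Gamma> N = {lab N, - lab N}"
    "\<And>N. N \<in> edges \<Gamma> \<Longrightarrow> has_rotation_label X A act N (lab N)"
    using \<Gamma>(4) by metis
  have "\<forall>N\<in>edges \<Gamma>. \<exists>\<kappa>. rotation_param N (lab N) \<kappa>" using rotation_param_exists lab(2) by blast
  then obtain \<kappa> where \<kappa>: "\<And>N. N \<in> edges \<Gamma> \<Longrightarrow> rotation_param N (lab N) (\<kappa> N)" by metis
  \<comment> \<open>One index for each complex coordinate, that is, for each edge at a fixed
    point.\<close>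
  define I where "I = {..<CARD('m) div 2}"
  have "card (I \<times> (UNIV::bool set)) = CARD('m)"
    using mfd(1) by (simp add: I_def card_cartesian_product)
  then obtain h :: "nat \<times> bool \<Rightarrow> 'm" where h: "bij_betw h (I \<times> UNIV) UNIV"
    using finite_same_card_bij[of "I \<times> (UNIV::bool set)" "UNIV::'m set"] by (auto simp: I_def)
  interpret gkm_frame X A B act "edges \<Gamma>" F lab \<kappa> I h
    by unfold_locales (use mfd F \<Gamma>(2) \<kappa> h in auto)
  have at: "edges_at \<Gamma> v = E_at v" if "v \<in> fix_pts" for v
    using that \<Gamma>(3) by (auto simp: edges_at_def E_at_def)
  \<comment> \<open>Writing the sign of an edge as a product over its two ends makes the product
    along a path telescope.\<close>
  have sign: "real_of_int (edge_sign \<Gamma> conn lab e v w) = orientation_sign v * orientation_sign w"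
    if conn: "connects \<Gamma> e v w" for e v w
  proof -
    have e: "e \<in> edges \<Gamma>" "e \<inter> fix_pts = {v, w}" using conn \<Gamma>(3) by (auto simp: connects_def)
    have vw: "v \<in> fix_pts" "w \<in> fix_pts" "e \<in> E_at v" using e by (auto simp: E_at_def)
    note compat = assms(3)[unfolded compatible_connection_def, rule_format, OF conn]
    have bij: "bij_betw (conn e v w) (E_at v) (E_at w)" "conn e v w e = e"
      using compat at vw by auto
    have ex: "\<exists>s\<in>{1, -1}. \<exists>c. lab (conn e v w f) = s *s lab f + c *s lab e" if f: "f \<in> E_at v" for f
    proof -
      have "conn e v w f \<in> edges \<Gamma>" using bij_betwE[OF bij(1)] f by (auto simp: E_at_def)
      moreover have "f \<in> edges \<Gamma>" using f by (simp add: E_at_def)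
      ultimately have "\<exists>c. lab (conn e v w f) = lab f + c *s lab e \<or> lab (conn e v w f) = - lab f + c *s lab e"
        using compat lab(1) e(1) f at[OF vw(1)] by auto
      then obtain c where "lab (conn e v w f) = 1 *s lab f + c *s lab e \<or> lab (conn e v w f) = (-1) *s lab f + c *s lab e"
        by (auto simp: vec_eq_iff)
      then show ?thesis by blast
    qed
    have ts: "transport_sign conn lab e v w f \<in> {1, -1} \<and>
        (\<exists>c. lab (conn e v w f) = transport_sign conn lab e v w f *s lab f + c *s lab e)"
      if f: "f \<in> E_at v - {e}" for f
    proof -
      obtain s c where s: "s \<in> {1, -1}" "lab (conn e v w f) = s *s lab f + c *s lab e" using ex f by blast
      have "\<not> proportional (lab e) (lab f)" using edge_determined_by_label[OF vw(1,3)] f by blast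
      then have "transport_sign conn lab e v w f = s" using s by (rule transport_sign_eqI)
      then show ?thesis using s by blast
    qed
    show ?thesis
      unfolding edge_sign_def at[OF vw(1)] by (rule orientation_sign_edge[OF e bij ts])
  qed
  have "(\<Prod>i<length fs. edge_sign \<Gamma> conn lab (fs ! i) (vs ! i) (vs ! Suc i)) = 1"
    if path: "closed_edge_path \<Gamma> vs fs" for vs fs
  proof -
    have len: "length vs = Suc (length fs)" and sub: "set vs \<subseteq> fix_pts"
      and con: "\<And>i. i < length fs \<Longrightarrow> connects \<Gamma> (fs ! i) (vs ! i) (vs ! Suc i)" and closed: "hd vs = last vs"
      using path \<Gamma>(1) by (auto simp: closed_edge_path_def)
    let ?o = "\<lambda>i. orientation_sign (vs ! i)"
    have sq: "?o i * ?o i = 1" if "i \<le> length fs" for i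
      using orientation_sign[of "vs ! i"] sub len that by (force simp: nth_mem subset_iff)
    have "real_of_int (\<Prod>i<length fs. edge_sign \<Gamma> conn lab (fs ! i) (vs ! i) (vs ! Suc i))
        = (\<Prod>i<length fs. ?o i * ?o (Suc i))"
      by (simp add: sign[OF con])
    also have "\<dots> = ?o 0 * ?o (length fs)" by (rule prod_telescope_signs[OF sq])
    also have "\<dots> = 1"
    proof -
      have "vs \<noteq> []" using len by auto
      then have "vs ! 0 = vs ! length fs" using closed len by (simp add: hd_conv_nth last_conv_nth)
      then show ?thesis using sq[of 0] by simp
    qed
    finally show ?thesis by linarith
  qed
  moreover have "sign_choice \<Gamma> lab" using lab(1) by (auto simp: sign_choice_def)
  ultimately show ?thesis unfolding orientable_gkm_graph_def by blast
qed

end
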